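(* Let $\mathcal U\subset\mathcal F$ be open. For any fixed symmetric positive definite $Q\in\mathbb{R}^{N\times N}$, the solution $P_Q(\Lambda)\succ0$ of $A(\Lambda)^{\top}P_Q+P_QA(\Lambda)=-Q$ is real analytic on $\mathcal U$, and $$A^{\top}P_{Q,i}+P_{Q,i}A=-\bigl(A_i^{\top}P_Q+P_QA_i\bigr),\qquad P_{Q,i}:=\partial_{\lambda_i}P_Q,\quad A_i:=\partial_{\lambda_i}A.$$ For $Q=I_N$, $P=P_{I_N}$, its positive-diagonal Cholesky factor $P_f$, and $J_{\rm r}$ depend real analytically on the gain. The value $\phi$ is locally Lipschitz, hence continuous, on $\mathcal U$, and its reduced inner minimizers are locally uniformly bounded (every point of $\mathcal U$ has a neighborhood on which all minimizers $\nu$ of $\lVert J_{\rm r}(\Lambda,\cdot)\rVert$ lie in a common ball). Fix $\Lambda\in\mathcal U$, let $(\nu^\star,\tau^\star)$ be an optimum of the primal semidefinite program and $Y^\star\succeq0$ an optimum of the dual semidefinite program given in the context, and put $J^\star=J_{\rm r}(\Lambda,\nu^\star)$. Partition $Y^\star=(Y^\star_{ab})_{a,b=1}^2$ conformally with $F_\Lambda$. Then $$\operatorname{tr}Y^\star_{22}=1,\qquad\langle Y^\star_{12},\mathcal B_\ell\rangle_F=0\ (\ell=1,\dots,q),\qquad\langle Y^\star,F_\Lambda(\nu^\star,\tau^\star)\rangle_F=0 .$$ If $\phi(\Lambda)>0$, then $$Z^\star:=-\frac{X^{\top}Y^\star_{12}}{\phi(\Lambda)}\in\partial\lVert\cdot\rVert(J^\star),\qquad\lVert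 Z^\star\rVert_*=1,$$ and $Z^\star$ is a maximizer of $\langle Z,J(\Lambda,0)\rangle_F$ over $\{Z\in\mathbb{R}^{N^2\times N}:\lVert Z\rVert_*\le1,\ Z\in\mathcal W_\Lambda^\perp\}$ and satisfies $\langle Z^\star,J_\ell(\Lambda)\rangle_F=0$ for $\ell=1,\dots,q$. The vector $g=(g_1,\dots,g_m)$ with $$g_i=\langle Z^\star,\dot J_i\rangle_F=-\frac{\langle Y^\star_{11},\dot P_i\otimes I_N\rangle_F+2\langle Y^\star_{12},\dot G_i^0\rangle_F}{2\phi(\Lambda)}$$ belongs to the Clarke subdifferential $\partial_C\phi(\Lambda)$, and equals $\nabla\phi(\Lambda)$ wherever $\phi$ is differentiable. If, in addition, the reduced minimizer $\nu^\star$ is unique and the largest singular value of $J^\star$ is simple, with paired unit singular vectors $u,v$ (so $J^\star v=\phi(\Lambda)u$), then $\phi$ is differentiable at $\Lambda$ and $$\partial_{\lambda_i}\phi(\Lambda)=g_i=u^{\top}\dot J_iv,\qquad i=1,\dots,m.$$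
   Context: Polynomial system: $\dot{\mathbf x}=\mathbf p(\mathbf x)$ with $\mathbf p\in\mathbb{R}[\mathbf x]^n$, $\mathbf p(\mathbf 0)=\mathbf 0$, and the standing assumption that the Jacobian $J_x(\mathbf p)|_{\mathbf 0}$ is Hurwitz (all eigenvalues have negative real part). $\lVert\cdot\rVert$ is the spectral norm, $\lVert\cdot\rVert_*$ the nuclear norm, $\langle U,V\rangle_F=\operatorname{tr}(U^{\top}V)$, and $\partial\lVert\cdot\rVert$ the convex subdifferential of the spectral norm. Fixed lift: $m\ge0$, $N=n+m$, $\mathbf g=(g_1,\dots,g_m)$ with each $g_i$ a monomial in $\mathbf x$ of degree at least $2$; $\Phi(\mathbf x)=(\mathbf x,\mathbf g(\mathbf x))\in\mathbb{R}^N$; coordinates $\mathbf w=(\mathbf x,\mathbf y)$. The lift is inner-quadratic: for each $i$ a factorization $g_i=a_ib_i$ is fixed, with $a_i,b_i\in\{x_1,\dots,x_n,y_1,\dots,y_{i-1}\}$ (the identity holding after substituting $\mathbf y=\mathbf g(\mathbf x)$). Stabilizers: $h_i=y_i-a_ib_i$. Reference extension: $\mathbf F_0(\mathbf w)=A_0\mathbf w+H_0(\mathbf w\otimes\mathbf w)$, a vector field on $\mathbb{R}^N$ with polynomial components of total degree at most two, satisfying $\mathbf F_0(\Phi(\mathbf x))=J_x(\Phi)(\mathbf x)\mathbf p(\mathbf x)$ for all $\mathbf x$. Stabilized family: for $\Lambda\in\mathbb{R}^m$, $\mathbf F_\Lambda=\mathbf F_0-\sum_i\lambda_i\mathbf e_{n+i}h_i=A(\Lambda)\mathbf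 w+H(\Lambda)(\mathbf w\otimes\mathbf w)$ with $A(\Lambda)=A_0-\sum_i\lambda_i\mathbf e_{n+i}\mathbf e_{n+i}^{\top}$, $H(\Lambda)=H_0+\sum_i\lambda_i\mathbf e_{n+i}s_i^{\top}$, where $s_i\in\mathbb{R}^{N^2}$ satisfies $s_i^{\top}(\mathbf w\otimes\mathbf w)=a_ib_i$. Let $\mathcal F=\{\Lambda:A(\Lambda)\text{ Hurwitz}\}$. Gauge: let $\mathcal K=\{K\in\mathbb{R}^{N\times N^2}:K(\mathbf w\otimes\mathbf w)=0\ \forall\mathbf w\}$, of dimension $d=\frac12N^2(N-1)$, with fixed basis $\{K_k\}$; $K(\mu)=\sum_k\mu_kK_k$ and $H(\Lambda,\mu)=H(\Lambda)+K(\mu)$, $\mu\in\mathbb{R}^d$. Certificate: for $\Lambda\in\mathcal F$, $P(\Lambda)\succ0$ is the unique solution of $A(\Lambda)^{\top}P+PA(\Lambda)=-I_N$, and $P_f=P_f(\Lambda)$ is its upper triangular Cholesky factor with positive diagonal, $P=P_f^{\top}P_f$. With blocks $(M_i)_{rj}:=(H(\Lambda,\mu))_{r,(i-1)N+j}$, let $G(\Lambda,\mu):=\operatorname{col}_{i=1}^N(M_i^{\top}P+PM_i)\in\mathbb{R}^{N^2\times N}$ ($\operatorname{col}$ = vertical stacking) and $J(\Lambda,\mu):=X^{-1}G(\Lambda,\mu)$, where $X=X(\Lambda):=P_f(\Lambda)^{\top}\otimes I_N$. Put $\phi(\Lambda)=\min_{\mu\in\mathbb{R}^d}\lVert J(\Lambda,\mu)\rVert$.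 Reduced coordinates: let $\mathcal C:=\{(B_i)_{i=1}^N\in(\mathbb{S}^N)^N:(B_i)_{jk}+(B_j)_{ki}+(B_k)_{ij}=0\ \text{for all }i,j,k\}$, with $\mathbb{S}^N$ the symmetric matrices; $\dim\mathcal C=q=N(N^2-1)/3$. Fix a basis $(B_1^{(\ell)},\dots,B_N^{(\ell)})$, $\ell=1,\dots,q$, independent of $\Lambda$; put $\mathcal B_\ell:=\operatorname{col}_{r=1}^NB_r^{(\ell)}$, $G_{\rm r}(\Lambda,\nu):=G(\Lambda,0)+\sum_\ell\nu_\ell\mathcal B_\ell$, $J_{\rm r}(\Lambda,\nu):=X(\Lambda)^{-1}G_{\rm r}(\Lambda,\nu)$, $J_\ell(\Lambda):=X(\Lambda)^{-1}\mathcal B_\ell$. The matrices $J_\ell(\Lambda)$ form a basis of $\mathcal W_\Lambda:=\{J(\Lambda,\mu)-J(\Lambda,0):\mu\in\mathbb{R}^d\}$, and $\phi(\Lambda)=\min_\nu\lVert J_{\rm r}(\Lambda,\nu)\rVert$; $\perp$ is with respect to $\langle\cdot,\cdot\rangle_F$. Primal semidefinite program (optimal value $\tau^\star=\phi(\Lambda)^2$): minimize $\tau$ over $(\nu,\tau)\in\mathbb{R}^q\times\mathbb{R}$ subject to $$F_\Lambda(\nu,\tau):=\begin{bmatrix}P(\Lambda)\otimes I_N & G_{\rm r}(\Lambda,\nu) \\ G_{\rm r}(\Lambda,\nu)^{\top} & \tau I_N\end{bmatrix}\succeq0.$$ Dual semidefinite program: maximize $-\langle Y_{11},P\otimes I_N\rangle_F-2\langle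 Y_{12},G(\Lambda,0)\rangle_F$ over symmetric $Y\succeq0$, partitioned conformally with $F_\Lambda$, subject to $\operatorname{tr}Y_{22}=1$ and $\langle Y_{12},\mathcal B_\ell\rangle_F=0$, $\ell=1,\dots,q$. Derivatives at $\Lambda$: $\dot P_i:=\partial_{\lambda_i}P(\Lambda)$, $\dot G_i^0:=\partial_{\lambda_i}G(\Lambda,0)$, and $\dot J_i:=\partial_{\lambda_i}J_{\rm r}(\Lambda,\nu)|_{\nu=\nu^\star}$ with $\nu=\nu^\star$ held fixed. *)

theory Defs
  imports "HOL-Analysis.Analysis"
begin

text \<open>
  A matrix with rows indexed by \<open>'r\<close> and columns by \<open>'c\<close> is an element of \<open>real^'c^'r\<close>, also
  written \<open>('r, 'c) rmat\<close>: the notation \<open>real^'k\<close> does not allow \<open>'k\<close> to have the sort of a finite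
  linear order. The (row, column) entry is \<open>M $ row $ column\<close>.
  Its type-class norm is the Frobenius norm, so the spectral norm is written \<open>spec_norm\<close>.
  Its type-class inner product is the Frobenius inner product.
  An index \<open>(i - 1) N + j\<close> of \<open>R^(N^2)\<close> is represented by the pair \<open>(i, j)\<close>.
\<close>

type_synonym 'i rvec = "(real, 'i) vec"
type_synonym ('r, 'c) rmat = "((real, 'c) vec, 'r) vec"

lemma inner_matrix_eq_trace:
  fixes U V :: "real^'c^'r"
  shows "U \<bullet> V = trace (transpose U ** V)"
proof -
  have "U \<bullet> V = (\<Sum>r\<in>UNIV. \<Sum>c\<in>UNIV. U $ r $ c * V $ r $ c)"
    by (simp add: inner_vec_def)
  also have "\<dots> = (\<Sum>c\<in>UNIV. \<Sum>r\<in>UNIV. U $ r $ c * V $ r $ c)"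
    by (rule sum.swap)
  finally show ?thesis
    by (simp add: trace_def matrix_matrix_mult_def transpose_def)
qed

definition spec_norm :: "real^'c^'r \<Rightarrow> real" where
  "spec_norm M = onorm (\<lambda>v. M *v v)"

definition spec_norm_subdiff :: "real^'c^'r \<Rightarrow> (real^'c^'r) set" where
  "spec_norm_subdiff J = {Z. \<forall>M. spec_norm M \<ge> spec_norm J + Z \<bullet> (M - J)}"

definition singular_values :: "real^'c^'r \<Rightarrow> real set" where
  "singular_values M = {\<sigma>. \<sigma> \<ge> 0 \<and> (\<exists>v. v \<noteq> 0 \<and> (transpose M ** M) *v v = \<sigma>\<^sup>2 *\<^sub>R v)}"

definition singular_mult :: "real^'c^'r \<Rightarrow> real \<Rightarrow> nat" where
  "singular_mult M \<sigma> = dim {v. (transpose M ** M) *v v = \<sigma>\<^sup>2 *\<^sub>R v}"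

definition singular_pair :: "real^'c^'r \<Rightarrow> real \<Rightarrow> real^'r \<Rightarrow> real^'c \<Rightarrow> bool" where
  "singular_pair M \<sigma> u v \<longleftrightarrow>
     norm u = 1 \<and> norm v = 1 \<and> M *v v = \<sigma> *\<^sub>R u \<and> transpose M *v u = \<sigma> *\<^sub>R v"

definition nuclear_norm :: "real^'c^'r \<Rightarrow> real" where
  "nuclear_norm M = (\<Sum>\<sigma>\<in>singular_values M. real (singular_mult M \<sigma>) * \<sigma>)"

definition hurwitz :: "real^'k^'k \<Rightarrow> bool" where
  "hurwitz A \<longleftrightarrow>
     (\<forall>(c::complex) (v::complex^'k).
        v \<noteq> 0 \<and> (\<chi> i j. complex_of_real (A $ i $ j)) *v v = c *s v \<longrightarrow> Re c < 0)"

definition pos_def :: "real^'k^'k \<Rightarrow> bool" where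
  "pos_def M \<longleftrightarrow> transpose M = M \<and> (\<forall>x. x \<noteq> 0 \<longrightarrow> x \<bullet> (M *v x) > 0)"

definition pos_semidef :: "real^'k^'k \<Rightarrow> bool" where
  "pos_semidef M \<longleftrightarrow> transpose M = M \<and> (\<forall>x. x \<bullet> (M *v x) \<ge> 0)"

definition cholesky :: "('k::{finite,linorder}, 'k) rmat \<Rightarrow> ('k, 'k) rmat" where
  "cholesky P = (THE R. (\<forall>i j. j < i \<longrightarrow> R $ i $ j = 0) \<and> (\<forall>i. R $ i $ i > 0)
                        \<and> P = transpose R ** R)"

definition lyap_sol :: "real^'k^'k \<Rightarrow> real^'k^'k \<Rightarrow> real^'k^'k" where
  "lyap_sol A Q = (THE P. pos_def P \<and> transpose A ** P + P ** A = - Q)"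

definition kron :: "real^'b^'a \<Rightarrow> real^'d^'c \<Rightarrow> real^('b \<times> 'd)^('a \<times> 'c)" where
  "kron A B = (\<chi> i j. A $ fst i $ fst j * B $ snd i $ snd j)"

definition vkron :: "real^'a \<Rightarrow> real^'b \<Rightarrow> real^('a \<times> 'b)" where
  "vkron v w = (\<chi> i. v $ fst i * w $ snd i)"

definition outer :: "real^'r \<Rightarrow> real^'c \<Rightarrow> real^'c^'r" where
  "outer u v = (\<chi> i j. u $ i * v $ j)"

definition col :: "real^'c^'r^'i \<Rightarrow> real^'c^('i \<times> 'r)" where
  "col B = (\<chi> ir c. B $ fst ir $ snd ir $ c)"

definition block22 ::
  "real^'a^'a \<Rightarrow> real^'b^'a \<Rightarrow> real^'a^'b \<Rightarrow> real^'b^'b \<Rightarrow> real^('a + 'b)^('a + 'b)" where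
  "block22 A B C D = (\<chi> i j.
     case i of
       Inl a \<Rightarrow> (case j of Inl a' \<Rightarrow> A $ a $ a' | Inr b' \<Rightarrow> B $ a $ b')
     | Inr b \<Rightarrow> (case j of Inl a' \<Rightarrow> C $ b $ a' | Inr b' \<Rightarrow> D $ b $ b'))"

definition blk11 :: "real^('a::finite + 'b::finite)^('a + 'b) \<Rightarrow> real^'a^'a" where
  "blk11 Y = (\<chi> i j. Y $ Inl i $ Inl j)"

definition blk12 :: "real^('a::finite + 'b::finite)^('a + 'b) \<Rightarrow> real^'b^'a" where
  "blk12 Y = (\<chi> i j. Y $ Inl i $ Inr j)"

definition blk22 :: "real^('a::finite + 'b::finite)^('a + 'b) \<Rightarrow> real^'b^'b" where
  "blk22 Y = (\<chi> i j. Y $ Inr i $ Inr j)"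

definition basis_family :: "(nat \<Rightarrow> 'v::real_vector) \<Rightarrow> nat \<Rightarrow> 'v set \<Rightarrow> bool" where
  "basis_family b d V \<longleftrightarrow>
     inj_on b {1..d} \<and> independent (b ` {1..d}) \<and> span (b ` {1..d}) = V"

text \<open>
  The number m of lifted coordinates may be 0, which no type \<open>real^'m\<close> provides. The gain space
  \<open>R^m\<close> is therefore the subspace of the vectors of \<open>R^N\<close> supported on the set \<open>I\<close> of the m lifted
  coordinates, with the induced Euclidean structure. The following notions are the
  usual ones on that copy of \<open>R^m\<close>.
\<close>

definition coord_space :: "'k::finite set \<Rightarrow> (real^'k) set" where
  "coord_space I = {x. \<forall>k. k \<notin> I \<longrightarrow> x $ k = 0}"

definition partial :: "(real^'k \<Rightarrow> 'b::real_normed_vector) \<Rightarrow> real^'k \<Rightarrow> 'k \<Rightarrow> 'b" where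
  "partial f x i = vector_derivative (\<lambda>t. f (x + t *\<^sub>R axis i 1)) (at 0)"

text \<open>In finite dimension \<open>has_sum\<close> is absolute convergence of the power series; the multi-indices
  \<open>\<alpha>\<close> are those of \<open>R^m\<close>.\<close>

definition real_analytic_on ::
  "'k::finite set \<Rightarrow> (real^'k) set \<Rightarrow> (real^'k \<Rightarrow> 'b::real_normed_vector) \<Rightarrow> bool" where
  "real_analytic_on I U f \<longleftrightarrow>
     (\<forall>x\<in>U. \<exists>r>0. \<exists>c :: ('k \<Rightarrow> nat) \<Rightarrow> 'b. \<forall>y \<in> coord_space I \<inter> ball x r.
        ((\<lambda>\<alpha>. (\<Prod>i\<in>I. (y $ i - x $ i) ^ \<alpha> i) *\<^sub>R c \<alpha>) has_sum f y) {\<alpha>. \<forall>i. i \<notin> I \<longrightarrow> \<alpha> i = 0})"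

definition locally_lipschitz_on :: "'a::metric_space set \<Rightarrow> ('a \<Rightarrow> 'b::metric_space) \<Rightarrow> bool" where
  "locally_lipschitz_on U f \<longleftrightarrow> (\<forall>x\<in>U. \<exists>\<epsilon>>0. \<exists>L. L-lipschitz_on (U \<inter> ball x \<epsilon>) f)"

text \<open>The generalized directional derivative
  \<open>f\<degree>(x; v) = limsup (f (y + t v) - f y) / t\<close> as \<open>y \<rightarrow> x\<close> in \<open>V\<close> and \<open>t \<down> 0\<close>.\<close>

definition clarke_deriv :: "'a::real_inner set \<Rightarrow> ('a \<Rightarrow> real) \<Rightarrow> 'a \<Rightarrow> 'a \<Rightarrow> ereal" where
  "clarke_deriv V f x v =
     Limsup (inf (nhds x) (principal V) \<times>\<^sub>F at_right (0::real))
       (\<lambda>(y, t). ereal ((f (y + t *\<^sub>R v) - f y) / t))"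

definition clarke_subdiff :: "'a::real_inner set \<Rightarrow> ('a \<Rightarrow> real) \<Rightarrow> 'a \<Rightarrow> 'a set" where
  "clarke_subdiff V f x = {g \<in> V. \<forall>v\<in>V. ereal (g \<bullet> v) \<le> clarke_deriv V f x v}"

text \<open>
  \<open>'n\<close> indexes the state coordinates and \<open>'k\<close> the coordinates of \<open>w = (x, y)\<close>, in their linear
  order. \<open>emb\<close> lists the positions of \<open>x\<close> in \<open>w\<close>; the remaining positions are those of \<open>y\<close>, and
  \<open>y_i\<close> and its data are indexed by the position \<open>n + i\<close> of \<open>y_i\<close>:
  \<open>expo k\<close> is the exponent vector of the monomial \<open>g_i\<close>, the factors are
  \<open>a_i = w $ facA k\<close> and \<open>b_i = w $ facB k\<close>, and \<open>svec k\<close> is \<open>s_i\<close>.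
  \<open>gbasis 1, \<dots>, gbasis gdim\<close> is the basis of the gauge space and
  \<open>rbasis 1, \<dots>, rbasis rdim\<close> that of the reduced space.
  Coefficient vectors \<open>\<mu>\<close> and \<open>\<nu>\<close> are functions of which only the values on \<open>{1..gdim}\<close>
  and \<open>{1..rdim}\<close> matter (both dimensions are 0 for N = 1).
\<close>

record ('n::finite, 'k::finite) lifted_system =
  vf :: "real^'n \<Rightarrow> real^'n"
  emb :: "'n \<Rightarrow> 'k"
  expo :: "'k \<Rightarrow> 'n \<Rightarrow> nat"
  facA :: "'k \<Rightarrow> 'k"
  facB :: "'k \<Rightarrow> 'k"
  svec :: "'k \<Rightarrow> real^('k \<times> 'k)"
  A0 :: "real^'k^'k"
  H0 :: "real^('k \<times> 'k)^'k"
  gdim :: nat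
  gbasis :: "nat \<Rightarrow> real^('k \<times> 'k)^'k"
  rdim :: nat
  rbasis :: "nat \<Rightarrow> real^'k^'k^'k"

definition lift_idx :: "('n::finite, 'k::finite) lifted_system \<Rightarrow> 'k set" where
  "lift_idx S = - range (emb S)"

definition lift_map :: "('n::finite, 'k::finite) lifted_system \<Rightarrow> real^'n \<Rightarrow> 'k rvec" where
  "lift_map S x = (\<chi> k. if k \<in> lift_idx S then (\<Prod>j\<in>UNIV. (x $ j) ^ expo S k j)
                          else x $ inv (emb S) k)"

definition gauge_space :: "(real^('k \<times> 'k)^'k) set" where
  "gauge_space = {K. \<forall>w. K *v vkron w w = 0}"

definition cyclic_space :: "(real^'k^'k^'k) set" where
  "cyclic_space = {B. (\<forall>i. transpose (B $ i) = B $ i) \<and>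
     (\<forall>i j k. B $ i $ j $ k + B $ j $ k $ i + B $ k $ i $ j = 0)}"

definition ref_field :: "('n::finite, 'k::finite) lifted_system \<Rightarrow> 'k rvec \<Rightarrow> 'k rvec" where
  "ref_field S w = A0 S *v w + H0 S *v vkron w w"

text \<open>In the ordering of the coordinates, membership of \<open>a_i, b_i\<close> in
  \<open>{x_1, \<dots>, x_n, y_1, \<dots>, y_(i-1)}\<close> reads \<open>facA k < k\<close> and \<open>facB k < k\<close>.\<close>

definition inner_quadratic_lift ::
  "('n::{finite,linorder}, 'k::{finite,linorder}) lifted_system \<Rightarrow> bool" where
  "inner_quadratic_lift S \<longleftrightarrow>
     polynomial_function (vf S) \<and> vf S 0 = 0 \<and> hurwitz (jacobian (vf S) (at 0)) \<and>
     strict_mono (emb S) \<and>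
     (\<forall>k\<in>lift_idx S.
        (\<forall>j. emb S j < k) \<and>
        (\<Sum>j\<in>UNIV. expo S k j) \<ge> 2 \<and>
        facA S k < k \<and> facB S k < k \<and>
        (\<forall>x. lift_map S x $ k = lift_map S x $ facA S k * lift_map S x $ facB S k) \<and>
        (\<forall>w. svec S k \<bullet> vkron w w = w $ facA S k * w $ facB S k)) \<and>
     (\<forall>x. ref_field S (lift_map S x) = jacobian (lift_map S) (at x) *v vf S x) \<and>
     basis_family (gbasis S) (gdim S) gauge_space \<and>
     basis_family (rbasis S) (rdim S) cyclic_space"

definition gain_space :: "('n::finite, 'k::finite) lifted_system \<Rightarrow> ('k rvec) set" where
  "gain_space S = coord_space (lift_idx S)"

definition gain_A :: "('n::finite, 'k::finite) lifted_system \<Rightarrow> 'k rvec \<Rightarrow> ('k, 'k) rmat" where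
  "gain_A S \<Lambda> = A0 S - (\<Sum>k\<in>lift_idx S. (\<Lambda> $ k) *\<^sub>R outer (axis k 1) (axis k 1))"

definition gain_H ::
  "('n::finite, 'k::finite) lifted_system \<Rightarrow> 'k rvec \<Rightarrow> (nat \<Rightarrow> real) \<Rightarrow> ('k, 'k \<times> 'k) rmat" where
  "gain_H S \<Lambda> \<mu> = H0 S + (\<Sum>k\<in>lift_idx S. (\<Lambda> $ k) *\<^sub>R outer (axis k 1) (svec S k))
                       + (\<Sum>l=1..gdim S. \<mu> l *\<^sub>R gbasis S l)"

definition hurwitz_gains :: "('n::finite, 'k::finite) lifted_system \<Rightarrow> ('k rvec) set" where
  "hurwitz_gains S = {\<Lambda> \<in> gain_space S. hurwitz (gain_A S \<Lambda>)}"

definition lyapQ ::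
  "('n::finite, 'k::finite) lifted_system \<Rightarrow> ('k, 'k) rmat \<Rightarrow> 'k rvec \<Rightarrow> ('k, 'k) rmat" where
  "lyapQ S Q \<Lambda> = lyap_sol (gain_A S \<Lambda>) Q"

abbreviation lyapP :: "('n::finite, 'k::finite) lifted_system \<Rightarrow> 'k rvec \<Rightarrow> ('k, 'k) rmat" where
  "lyapP S \<equiv> lyapQ S (mat 1)"

definition Pf ::
  "('n::finite, 'k::{finite,linorder}) lifted_system \<Rightarrow> 'k rvec \<Rightarrow> ('k, 'k) rmat" where
  "Pf S \<Lambda> = cholesky (lyapP S \<Lambda>)"

definition Xmat ::
  "('n::finite, 'k::{finite,linorder}) lifted_system \<Rightarrow> 'k rvec \<Rightarrow> ('k \<times> 'k, 'k \<times> 'k) rmat" where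
  "Xmat S \<Lambda> = kron (transpose (Pf S \<Lambda>)) (mat 1)"

definition Mblock :: "real^('k \<times> 'k)^'k \<Rightarrow> 'k \<Rightarrow> real^'k^'k" where
  "Mblock H i = (\<chi> r j. H $ r $ (i, j))"

definition Gmat ::
  "('n::finite, 'k::finite) lifted_system \<Rightarrow> 'k rvec \<Rightarrow> (nat \<Rightarrow> real) \<Rightarrow> ('k \<times> 'k, 'k) rmat" where
  "Gmat S \<Lambda> \<mu> = col (\<chi> i. transpose (Mblock (gain_H S \<Lambda> \<mu>) i) ** lyapP S \<Lambda>
                          + lyapP S \<Lambda> ** Mblock (gain_H S \<Lambda> \<mu>) i)"

definition Jmat ::
  "('n::finite, 'k::{finite,linorder}) lifted_system \<Rightarrow> 'k rvec \<Rightarrow> (nat \<Rightarrow> real)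
     \<Rightarrow> ('k \<times> 'k, 'k) rmat" where
  "Jmat S \<Lambda> \<mu> = matrix_inv (Xmat S \<Lambda>) ** Gmat S \<Lambda> \<mu>"

text \<open>The infimum is attained: \<open>\<mu> \<mapsto> Jmat S \<Lambda> \<mu>\<close> is affine on a finite-dimensional space.\<close>

definition phi ::
  "('n::finite, 'k::{finite,linorder}) lifted_system \<Rightarrow> 'k rvec \<Rightarrow> real" where
  "phi S \<Lambda> = (INF \<mu>. spec_norm (Jmat S \<Lambda> \<mu>))"

definition Wspace ::
  "('n::finite, 'k::{finite,linorder}) lifted_system \<Rightarrow> 'k rvec \<Rightarrow> (('k \<times> 'k, 'k) rmat) set" where
  "Wspace S \<Lambda> = {Jmat S \<Lambda> \<mu> - Jmat S \<Lambda> (\<lambda>_. 0) |\<mu>. True}"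

definition Gr ::
  "('n::finite, 'k::finite) lifted_system \<Rightarrow> 'k rvec \<Rightarrow> (nat \<Rightarrow> real) \<Rightarrow> ('k \<times> 'k, 'k) rmat" where
  "Gr S \<Lambda> \<nu> = Gmat S \<Lambda> (\<lambda>_. 0) + (\<Sum>l=1..rdim S. \<nu> l *\<^sub>R col (rbasis S l))"

definition Jr ::
  "('n::finite, 'k::{finite,linorder}) lifted_system \<Rightarrow> 'k rvec \<Rightarrow> (nat \<Rightarrow> real)
     \<Rightarrow> ('k \<times> 'k, 'k) rmat" where
  "Jr S \<Lambda> \<nu> = matrix_inv (Xmat S \<Lambda>) ** Gr S \<Lambda> \<nu>"

definition Jbasis ::
  "('n::finite, 'k::{finite,linorder}) lifted_system \<Rightarrow> 'k rvec \<Rightarrow> nat \<Rightarrow> ('k \<times> 'k, 'k) rmat" where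
  "Jbasis S \<Lambda> l = matrix_inv (Xmat S \<Lambda>) ** col (rbasis S l)"

definition reduced_minimizer ::
  "('n::finite, 'k::{finite,linorder}) lifted_system \<Rightarrow> 'k rvec \<Rightarrow> (nat \<Rightarrow> real) \<Rightarrow> bool" where
  "reduced_minimizer S \<Lambda> \<nu> \<longleftrightarrow> (\<forall>\<nu>'. spec_norm (Jr S \<Lambda> \<nu>) \<le> spec_norm (Jr S \<Lambda> \<nu>'))"

definition Fsdp ::
  "('n::finite, 'k::finite) lifted_system \<Rightarrow> 'k rvec \<Rightarrow> (nat \<Rightarrow> real) \<Rightarrow> real
     \<Rightarrow> (('k \<times> 'k) + 'k, ('k \<times> 'k) + 'k) rmat" where
  "Fsdp S \<Lambda> \<nu> \<tau> =
     block22 (kron (lyapP S \<Lambda>) (mat 1)) (Gr S \<Lambda> \<nu>) (transpose (Gr S \<Lambda> \<nu>)) (\<tau> *\<^sub>R mat 1)"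

definition primal_optimum ::
  "('n::finite, 'k::finite) lifted_system \<Rightarrow> 'k rvec \<Rightarrow> (nat \<Rightarrow> real) \<Rightarrow> real \<Rightarrow> bool" where
  "primal_optimum S \<Lambda> \<nu> \<tau> \<longleftrightarrow>
     pos_semidef (Fsdp S \<Lambda> \<nu> \<tau>) \<and>
     (\<forall>\<nu>' \<tau>'. pos_semidef (Fsdp S \<Lambda> \<nu>' \<tau>') \<longrightarrow> \<tau> \<le> \<tau>')"

definition dual_feasible ::
  "('n::finite, 'k::finite) lifted_system \<Rightarrow> (('k \<times> 'k) + 'k, ('k \<times> 'k) + 'k) rmat \<Rightarrow> bool" where
  "dual_feasible S Y \<longleftrightarrow>
     pos_semidef Y \<and> trace (blk22 Y) = 1 \<and>
     (\<forall>l\<in>{1..rdim S}. blk12 Y \<bullet> col (rbasis S l) = 0)"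

definition dual_objective ::
  "('n::finite, 'k::finite) lifted_system \<Rightarrow> 'k rvec
     \<Rightarrow> (('k \<times> 'k) + 'k, ('k \<times> 'k) + 'k) rmat \<Rightarrow> real" where
  "dual_objective S \<Lambda> Y =
     - (blk11 Y \<bullet> kron (lyapP S \<Lambda>) (mat 1)) - 2 * (blk12 Y \<bullet> Gmat S \<Lambda> (\<lambda>_. 0))"

definition dual_optimum ::
  "('n::finite, 'k::finite) lifted_system \<Rightarrow> 'k rvec
     \<Rightarrow> (('k \<times> 'k) + 'k, ('k \<times> 'k) + 'k) rmat \<Rightarrow> bool" where
  "dual_optimum S \<Lambda> Y \<longleftrightarrow>
     dual_feasible S Y \<and> (\<forall>Y'. dual_feasible S Y' \<longrightarrow> dual_objective S \<Lambda> Y' \<le> dual_objective S \<Lambda> Y)"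

definition Zstar ::
  "('n::finite, 'k::{finite,linorder}) lifted_system \<Rightarrow> 'k rvec
     \<Rightarrow> (('k \<times> 'k) + 'k, ('k \<times> 'k) + 'k) rmat \<Rightarrow> ('k \<times> 'k, 'k) rmat" where
  "Zstar S \<Lambda> Y = - ((1 / phi S \<Lambda>) *\<^sub>R (transpose (Xmat S \<Lambda>) ** blk12 Y))"

definition dual_ball ::
  "('n::finite, 'k::{finite,linorder}) lifted_system \<Rightarrow> 'k rvec \<Rightarrow> (('k \<times> 'k, 'k) rmat) set" where
  "dual_ball S \<Lambda> = {Z. nuclear_norm Z \<le> 1 \<and> Z \<in> (Wspace S \<Lambda>)\<^sup>\<bottom>}"

definition gsub ::
  "('n::finite, 'k::{finite,linorder}) lifted_system \<Rightarrow> 'k rvec \<Rightarrow> (nat \<Rightarrow> real)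
     \<Rightarrow> (('k \<times> 'k) + 'k, ('k \<times> 'k) + 'k) rmat \<Rightarrow> 'k rvec" where
  "gsub S \<Lambda> \<nu> Y =
     (\<chi> k. if k \<in> lift_idx S then Zstar S \<Lambda> Y \<bullet> partial (\<lambda>\<Lambda>'. Jr S \<Lambda>' \<nu>) \<Lambda> k else 0)"

end

theory Submission
  imports Defs "HOL-Computational_Algebra.Fundamental_Theorem_Algebra"
begin

text \<open>
  \<^bold>\<open>Analytic dependence.\<close> For a Hurwitz matrix \<open>A\<close> the Lyapunov operator
  \<open>P \<mapsto> A\<^sup>T P + P A\<close> is injective: a kernel element \<open>P\<close> intertwines \<open>A\<close> with \<open>- A\<^sup>T\<close>, and these two
  have no eigenvalue in common (\<open>hurwitz_intertwiner_zero\<close>). Hence the solution is given by Cramer's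
  rule, a quotient of polynomials in the gain. It is positive definite since it can be followed along
  the segment of Hurwitz matrices from \<open>A\<close> to \<open>- 1\<close>, on which it never becomes singular
  (\<open>lyapunov_pos_def\<close>). Elimination by Schur complements computes the Cholesky factor with ring
  operations, division and square roots of positive numbers only (\<open>cholesky_analytic\<close>). So all
  analyticity claims reduce to the closure of convergent power series under these operations, which
  is the regrouping of an absolutely convergent sum (\<open>analytic_at_regroup\<close>, \<open>analytic_at_compose\<close>).

  \<^bold>\<open>The value.\<close> The map \<open>K \<mapsto> (M\<^sub>i\<^sup>T P + P M\<^sub>i)\<^sub>i\<close> sends the gauge space onto the space of cyclic
  symmetric families (\<open>sym_blocks_gauge\<close>), so the gauge minimization and the reduced one have the same
  value. Convergent power series are strictly differentiable, hence locally Lipschitz, and near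
  minimizers of the inner problem stay bounded; comparing the two objectives at a common near
  minimizer gives the Lipschitz bound for the value.

  \<^bold>\<open>Duality.\<close> Write a dual point as \<open>Y = B B\<^sup>T\<close> with upper and lower rows \<open>B\<^sub>1\<close> and \<open>B\<^sub>2\<close>, and put
  \<open>p = X\<^sup>T B\<^sub>1\<close>, \<open>q = B\<^sub>2\<close>. Then \<open>\<langle>Y, F\<rangle> = \<parallel>p + J q\<parallel>\<^sup>2 + \<tau> \<parallel>q\<parallel>\<^sup>2 - \<parallel>J q\<parallel>\<^sup>2\<close> (\<open>sdp_pairing\<close>), which yields
  weak duality at once. There is no gap: a hyperplane separating the open spectral-norm ball of
  radius \<open>\<phi>\<close> from the affine space of all \<open>J\<^sub>r\<close> is a dual point of the norm problem, and its singular
  value decomposition lifts it to a dual point of the semidefinite program (\<open>strong_duality\<close>). With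
  zero gap the identity forces \<open>p = - J q\<close> and \<open>\<parallel>J q\<parallel> = \<phi>\<close>, from which the claims about \<open>Z\<close> and the
  two formulas for \<open>g\<close> follow by matrix algebra.

  \<^bold>\<open>Sensitivity.\<close> Dual feasibility does not involve the gain. So for the fixed optimal \<open>Y\<close> the square
  root of the dual objective is a smooth function of the gain that lies below \<open>\<phi>\<close>, touches it at
  \<open>\<Lambda>\<close> and has gradient \<open>g\<close> there; this alone puts \<open>g\<close> in the Clarke subdifferential and identifies
  the gradient of \<open>\<phi>\<close> where it exists. When the largest singular value of \<open>J\<close> is simple, the squared
  spectral norm has a quadratic expansion from above, so \<open>\<phi>\<close> is squeezed between two smooth functions
  that agree at \<open>\<Lambda>\<close>, and hence is differentiable with their common gradient.
\<close>

declare transpose_matrix_vector [simp del] vector_transpose_matrix [simp del]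

section \<open>Power series on a coordinate subspace\<close>

definition multi_indices :: "'k set \<Rightarrow> ('k \<Rightarrow> nat) set" where
  "multi_indices I = {\<alpha>. \<forall>i. i \<notin> I \<longrightarrow> \<alpha> i = 0}"

definition monomial_at :: "'k::finite set \<Rightarrow> real^'k \<Rightarrow> ('k \<Rightarrow> nat) \<Rightarrow> real" where
  "monomial_at I d \<alpha> = (\<Prod>i\<in>I. (d $ i) ^ \<alpha> i)"

definition total_degree :: "'k::finite set \<Rightarrow> ('k \<Rightarrow> nat) \<Rightarrow> nat" where
  "total_degree I \<alpha> = (\<Sum>i\<in>I. \<alpha> i)"

text \<open>Expansions are considered on boxes, not balls: the corner of a box is a point at which all
  monomials take their largest absolute value, so convergence there dominates the whole box.\<close>

definition in_box :: "'k::finite set \<Rightarrow> real \<Rightarrow> real^'k \<Rightarrow> bool" where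
  "in_box I s d \<longleftrightarrow> (\<forall>i\<in>I. \<bar>d $ i\<bar> \<le> s)"

text \<open>Analyticity of a real function at one point, with the absolute convergence at the corner of the
  box recorded as part of the definition.\<close>

definition analytic_at :: "'k::finite set \<Rightarrow> (real^'k \<Rightarrow> real) \<Rightarrow> real^'k \<Rightarrow> bool" where
  "analytic_at I f x \<longleftrightarrow> (\<exists>s>0. \<exists>c. (\<lambda>\<alpha>. \<bar>c \<alpha>\<bar> * s ^ total_degree I \<alpha>) summable_on multi_indices I \<and>
     (\<forall>y\<in>coord_space I. in_box I s (y - x) \<longrightarrow>
        ((\<lambda>\<alpha>. c \<alpha> * monomial_at I (y - x) \<alpha>) has_sum f y) (multi_indices I)))"

lemma analytic_atE:
  assumes "analytic_at I f x"
  obtains s c where "s > 0" "(\<lambda>\<alpha>. \<bar>c \<alpha>\<bar> * s ^ total_degree I \<alpha>) summable_on multi_indices I"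
    "\<And>y. y \<in> coord_space I \<Longrightarrow> in_box I s (y - x) \<Longrightarrow>
        ((\<lambda>\<alpha>. c \<alpha> * monomial_at I (y - x) \<alpha>) has_sum f y) (multi_indices I)"
  using assms unfolding analytic_at_def by blast

lemma monomial_at_le:
  assumes "in_box I s d" shows "\<bar>monomial_at I d \<alpha>\<bar> \<le> s ^ total_degree I \<alpha>"
proof -
  have "\<bar>monomial_at I d \<alpha>\<bar> = (\<Prod>i\<in>I. \<bar>d $ i\<bar> ^ \<alpha> i)"
    by (simp add: monomial_at_def abs_prod power_abs)
  also have "\<dots> \<le> (\<Prod>i\<in>I. s ^ \<alpha> i)"
    using assms by (intro prod_mono) (auto simp: in_box_def intro!: power_mono)
  finally show ?thesis by (simp add: total_degree_def power_sum)
qed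

lemma in_box_mono: "in_box I s d \<Longrightarrow> s \<le> t \<Longrightarrow> in_box I t d"
  unfolding in_box_def by force

lemma monomial_at_const: "monomial_at I (\<chi> i. if i \<in> I then s else 0) \<alpha> = s ^ total_degree I \<alpha>"
  by (simp add: monomial_at_def total_degree_def power_sum)

lemma corner_point:
  assumes "x \<in> coord_space I" "s \<ge> 0"
  obtains y where "y \<in> coord_space I" "in_box I s (y - x)"
    "\<And>\<alpha>. monomial_at I (y - x) \<alpha> = s ^ total_degree I \<alpha>"
proof
  let ?y = "x + (\<chi> i. if i \<in> I then s else 0)"
  show "?y \<in> coord_space I" using assms by (auto simp: coord_space_def)
  show "in_box I s (?y - x)" using assms by (auto simp: in_box_def)
  show "monomial_at I (?y - x) \<alpha> = s ^ total_degree I \<alpha>" for \<alpha> by (simp add: monomial_at_const)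
qed

text \<open>Any absolutely convergent expansion in monomials becomes a power series by summing over the fibres
  of the exponent map. The coefficient of a multi-index is a sum over its fibre and does not depend
  on the point. Sums, products and compositions are all obtained from expansions
  over larger index sets in this way.\<close>

lemma analytic_at_regroup:
  fixes C :: "'x \<Rightarrow> real" and deg :: "'x \<Rightarrow> 'k::finite \<Rightarrow> nat"
  assumes x: "x \<in> coord_space I" and s: "s > 0"
    and deg: "\<And>w. w \<in> X \<Longrightarrow> deg w \<in> multi_indices I"
    and hs: "\<And>y. y \<in> coord_space I \<Longrightarrow> in_box I s (y - x) \<Longrightarrow>
        ((\<lambda>w. C w * monomial_at I (y - x) (deg w)) has_sum f y) X"
  shows "analytic_at I f x"
proof -
  define fib where "fib \<alpha> = {w\<in>X. deg w = \<alpha>}" for \<alpha>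
  define c where "c \<alpha> = infsum C (fib \<alpha>)" for \<alpha>
  \<comment> \<open>The index set is the disjoint union of the fibres of \<open>deg\<close>.\<close>
  have bij: "bij_betw snd (Sigma (multi_indices I) fib) X"
    by (rule bij_betw_byWitness[where f' = "\<lambda>w. (deg w, w)"]) (auto simp: fib_def deg)
  have main: "((\<lambda>\<alpha>. c \<alpha> * monomial_at I (y - x) \<alpha>) has_sum f y) (multi_indices I)"
    if y: "y \<in> coord_space I" "in_box I s (y - x)" for y
  proof (rule has_sum_SigmaD)
    have "((\<lambda>p. C (snd p) * monomial_at I (y - x) (deg (snd p))) has_sum f y) (Sigma (multi_indices I) fib)"
      using hs[OF y] has_sum_reindex_bij_betw[OF bij, of "\<lambda>w. C w * monomial_at I (y - x) (deg w)"] by blast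
    then show 1: "((\<lambda>p. C (snd p) * monomial_at I (y - x) (fst p)) has_sum f y) (Sigma (multi_indices I) fib)"
      by (rule has_sum_cong[THEN iffD1, rotated]) (auto simp: fib_def)
    fix \<alpha> assume a: "\<alpha> \<in> multi_indices I"
    have "(\<lambda>w. C w * monomial_at I (y - x) (deg w)) summable_on fib \<alpha>"
      by (rule summable_on_subset_banach[of _ X]) (use hs[OF y] in \<open>auto simp: fib_def summable_on_def\<close>)
    then have "(\<lambda>w. C w * monomial_at I (y - x) \<alpha>) summable_on fib \<alpha>"
      by (rule summable_on_cong[THEN iffD1, rotated]) (auto simp: fib_def)
    then have "((\<lambda>w. C w * monomial_at I (y - x) \<alpha>) has_sum infsum (\<lambda>w. C w * monomial_at I (y - x) \<alpha>) (fib \<alpha>)) (fib \<alpha>)"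
      by (rule has_sum_infsum)
    then show "((\<lambda>w. C (snd (\<alpha>, w)) * monomial_at I (y - x) (fst (\<alpha>, w))) has_sum c \<alpha> * monomial_at I (y - x) \<alpha>) (fib \<alpha>)"
      by (simp add: c_def infsum_cmult_left')
  qed
  obtain y where y: "y \<in> coord_space I" "in_box I s (y - x)" "\<And>\<alpha>. monomial_at I (y - x) \<alpha> = s ^ total_degree I \<alpha>"
    using corner_point[OF x, of s] s by auto
  have "(\<lambda>\<alpha>. c \<alpha> * s ^ total_degree I \<alpha>) summable_on multi_indices I"
    using main[OF y(1,2)] y(3) by (auto simp: summable_on_def)
  then have "(\<lambda>\<alpha>. \<bar>c \<alpha> * s ^ total_degree I \<alpha>\<bar>) summable_on multi_indices I"
    using summable_on_iff_abs_summable_on_real by fastforce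
  then have "(\<lambda>\<alpha>. \<bar>c \<alpha>\<bar> * s ^ total_degree I \<alpha>) summable_on multi_indices I"
    using s by (simp add: abs_mult)
  then show ?thesis using main s unfolding analytic_at_def by blast
qed

lemma analytic_at_const:
  fixes x :: "real^'k::finite"
  assumes "x \<in> coord_space I" shows "analytic_at I (\<lambda>_. a) x"
  by (rule analytic_at_regroup[OF assms zero_less_one, where X = "{()}" and C = "\<lambda>_. a" and deg = "\<lambda>_ _. 0"])
    (auto simp: multi_indices_def monomial_at_def intro!: has_sum_finiteI)

lemma analytic_at_coord:
  fixes x :: "real^'k::finite"
  assumes x: "x \<in> coord_space I" shows "analytic_at I (\<lambda>y. y $ i) x"
proof (cases "i \<in> I")
  case True
  show ?thesis
  proof (rule analytic_at_regroup[OF x zero_less_one, where X = "UNIV :: bool set" and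
        C = "\<lambda>b. if b then 1 else x $ i" and deg = "\<lambda>b j. if b \<and> j = i then 1 else 0"])
    show "(\<lambda>j. if b \<and> j = i then 1 else 0) \<in> multi_indices I" for b using True by (auto simp: multi_indices_def)
    fix y :: "real^'k"
    have "monomial_at I (y - x) (\<lambda>j. if j = i then 1 else 0) = y $ i - x $ i"
      using True by (simp add: monomial_at_def if_distrib[of "power _"] prod.delta cong: if_cong)
    then show "((\<lambda>b. (if b then 1 else x $ i) * monomial_at I (y - x) (\<lambda>j. if b \<and> j = i then 1 else 0))
       has_sum y $ i) UNIV"
      by (intro has_sum_finiteI) (auto simp: UNIV_bool monomial_at_def)
  qed
next
  case False
  show ?thesis
    by (rule analytic_at_regroup[OF x zero_less_one, where X = "{}" and C = "\<lambda>_::unit. 0" and deg = "\<lambda>_ _. 0"])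
      (use False in \<open>auto simp: coord_space_def\<close>)
qed

lemma has_sum_Plus:
  fixes F :: "'a + 'b \<Rightarrow> real"
  assumes "((\<lambda>a. F (Inl a)) has_sum s) A" "((\<lambda>b. F (Inr b)) has_sum t) B"
  shows "(F has_sum (s + t)) (A <+> B)"
  unfolding Plus_def
proof (rule has_sum_Un_disjoint)
  show "(F has_sum s) (Inl ` A)" using assms by (subst has_sum_reindex) (auto simp: o_def)
  show "(F has_sum t) (Inr ` B)" using assms by (subst has_sum_reindex) (auto simp: o_def)
qed auto

lemma analytic_at_add:
  fixes x :: "real^'k::finite"
  assumes x: "x \<in> coord_space I" and f: "analytic_at I f x" and g: "analytic_at I g x"
  shows "analytic_at I (\<lambda>y. f y + g y) x"
proof -
  obtain s c where s: "s > 0" and c: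
    "\<And>y. y \<in> coord_space I \<Longrightarrow> in_box I s (y - x) \<Longrightarrow>
        ((\<lambda>\<alpha>. c \<alpha> * monomial_at I (y - x) \<alpha>) has_sum f y) (multi_indices I)" using f by (elim analytic_atE) blast
  obtain s' c' where s': "s' > 0" and c':
    "\<And>y. y \<in> coord_space I \<Longrightarrow> in_box I s' (y - x) \<Longrightarrow>
        ((\<lambda>\<alpha>. c' \<alpha> * monomial_at I (y - x) \<alpha>) has_sum g y) (multi_indices I)" using g by (elim analytic_atE) blast
  show ?thesis
    by (rule analytic_at_regroup[OF x, where s = "min s s'" and X = "multi_indices I <+> multi_indices I" and
        C = "case_sum c c'" and deg = "case_sum (\<lambda>\<alpha>. \<alpha>) (\<lambda>\<alpha>. \<alpha>)"])
      (use s s' in \<open>auto simp: in_box_def intro!: has_sum_Plus c c'\<close>)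
qed

lemma has_sum_Times_real:
  fixes F :: "'a \<Rightarrow> real" and G :: "'b \<Rightarrow> real"
  assumes F: "(F has_sum s) A" and G: "(G has_sum t) B"
  shows "((\<lambda>(a, b). F a * G b) has_sum (s * t)) (A \<times> B)"
proof (rule has_sum_SigmaI)
  show "((\<lambda>b. case (a, b) of (a, b) \<Rightarrow> F a * G b) has_sum F a * t) B" for a
    using has_sum_cmult_right[OF G] by simp
  show "((\<lambda>a. F a * t) has_sum s * t) A" using has_sum_cmult_left[OF F] by simp
  have "(\<lambda>a. \<bar>F a\<bar>) summable_on A" "(\<lambda>b. \<bar>G b\<bar>) summable_on B"
    using F G summable_on_iff_abs_summable_on_real[of F A] summable_on_iff_abs_summable_on_real[of G B]
    by (auto simp: summable_on_def)
  then have "(\<lambda>p. norm ((\<lambda>(a, b). F a * G b) p)) summable_on A \<times> B"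
    by (subst Infinite_Sum.abs_summable_on_Sigma_iff)
      (auto simp: abs_mult infsum_cmult_right' intro!: summable_on_cmult_right summable_on_cmult_left)
  then show "(\<lambda>(a, b). F a * G b) summable_on A \<times> B"
    by (rule Infinite_Sum.abs_summable_summable)
qed

lemma monomial_at_plus: "monomial_at I d (\<lambda>i. \<alpha> i + \<beta> i) = monomial_at I d \<alpha> * monomial_at I d \<beta>"
  by (simp add: monomial_at_def power_add prod.distrib)

lemma analytic_at_mult:
  fixes x :: "real^'k::finite"
  assumes x: "x \<in> coord_space I" and f: "analytic_at I f x" and g: "analytic_at I g x"
  shows "analytic_at I (\<lambda>y. f y * g y) x"
proof -
  obtain s c where s: "s > 0" and c:
    "\<And>y. y \<in> coord_space I \<Longrightarrow> in_box I s (y - x) \<Longrightarrow>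
        ((\<lambda>\<alpha>. c \<alpha> * monomial_at I (y - x) \<alpha>) has_sum f y) (multi_indices I)" using f by (elim analytic_atE) blast
  obtain s' c' where s': "s' > 0" and c':
    "\<And>y. y \<in> coord_space I \<Longrightarrow> in_box I s' (y - x) \<Longrightarrow>
        ((\<lambda>\<alpha>. c' \<alpha> * monomial_at I (y - x) \<alpha>) has_sum g y) (multi_indices I)" using g by (elim analytic_atE) blast
  show ?thesis
  proof (rule analytic_at_regroup[OF x, where s = "min s s'" and X = "multi_indices I \<times> multi_indices I" and
        C = "\<lambda>(\<alpha>, \<beta>). c \<alpha> * c' \<beta>" and deg = "\<lambda>(\<alpha>, \<beta>) i. \<alpha> i + \<beta> i"])
    show "min s s' > 0" using s s' by simp
    show "(case w of (\<alpha>, \<beta>) \<Rightarrow> \<lambda>i. \<alpha> i + \<beta> i) \<in> multi_indices I" if "w \<in> multi_indices I \<times> multi_indices I" for w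
      using that by (auto simp: multi_indices_def)
    fix y assume y: "y \<in> coord_space I" "in_box I (min s s') (y - x)"
    have "((\<lambda>(\<alpha>, \<beta>). (c \<alpha> * monomial_at I (y - x) \<alpha>) * (c' \<beta> * monomial_at I (y - x) \<beta>)) has_sum f y * g y) (multi_indices I \<times> multi_indices I)"
      using y by (intro has_sum_Times_real c c') (auto elim: in_box_mono)
    then show "((\<lambda>w. (case w of (\<alpha>, \<beta>) \<Rightarrow> c \<alpha> * c' \<beta>) * monomial_at I (y - x) (case w of (\<alpha>, \<beta>) \<Rightarrow> \<lambda>i. \<alpha> i + \<beta> i))
       has_sum f y * g y) (multi_indices I \<times> multi_indices I)"
      by (rule has_sum_cong[THEN iffD1, rotated]) (auto simp: monomial_at_plus)
  qed
qed

text \<open>Expanding the \<open>n\<close>-th power of a sum: its terms are indexed by the words of length \<open>n\<close>.\<close>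

lemma has_sum_words:
  fixes F :: "'a \<Rightarrow> real"
  assumes F: "(F has_sum s) A"
  shows "((\<lambda>w. prod_list (map F w)) has_sum s ^ n) {w. length w = n \<and> set w \<subseteq> A}"
proof (induction n)
  case 0
  have "{w. length w = 0 \<and> set w \<subseteq> A} = {[]}" by auto
  then show ?case by (simp add: has_sum_finiteI)
next
  case (Suc n)
  have "bij_betw (\<lambda>(a, w). a # w) (A \<times> {w. length w = n \<and> set w \<subseteq> A}) {w. length w = Suc n \<and> set w \<subseteq> A}"
    by (rule bij_betw_byWitness[where f' = "\<lambda>w. (hd w, tl w)"])
      (auto simp: length_Suc_conv image_iff)
  from has_sum_reindex_bij_betw[OF this, of "\<lambda>w. prod_list (map F w)"] has_sum_Times_real[OF F Suc]
  show ?case by (simp add: case_prod_unfold)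
qed

lemma monomial_at_0: "monomial_at I d (\<lambda>_. 0) = 1" by (simp add: monomial_at_def)

lemma analytic_coeff_0:
  assumes x: "x \<in> coord_space I" and c:
    "\<And>y. y \<in> coord_space I \<Longrightarrow> in_box I s (y - x) \<Longrightarrow>
        ((\<lambda>\<alpha>. c \<alpha> * monomial_at I (y - x) \<alpha>) has_sum f y) (multi_indices I)" and "s > 0"
  shows "c (\<lambda>_. 0) = f x"
proof -
  have "((\<lambda>\<alpha>. c \<alpha> * monomial_at I (x - x) \<alpha>) has_sum f x) (multi_indices I)"
    using x \<open>s > 0\<close> by (intro c) (auto simp: in_box_def)
  moreover have "((\<lambda>\<alpha>. c \<alpha> * monomial_at I (x - x) \<alpha>) has_sum c (\<lambda>_. 0)) (multi_indices I)"
  proof (rule has_sum_finite_neutralI[of "{\<lambda>_. 0}"])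
    fix \<alpha> assume a: "\<alpha> \<in> multi_indices I - {\<lambda>_. 0}"
    then obtain i where "\<alpha> i \<noteq> 0" by auto
    then have "i \<in> I" using a by (auto simp: multi_indices_def)
    have "monomial_at I (x - x) \<alpha> = 0"
      unfolding monomial_at_def using \<open>i \<in> I\<close> \<open>\<alpha> i \<noteq> 0\<close> by (intro prod_zero) auto
    then show "c \<alpha> * monomial_at I (x - x) \<alpha> = 0" by simp
  qed (auto simp: multi_indices_def monomial_at_0)
  ultimately show ?thesis by (metis has_sum_unique)
qed

lemma total_degree_pos: "\<alpha> \<in> multi_indices I \<Longrightarrow> \<alpha> \<noteq> (\<lambda>_. 0) \<Longrightarrow> total_degree I \<alpha> \<ge> 1"
  unfolding multi_indices_def total_degree_def fun_eq_iff by (auto simp: Suc_le_eq sum_nonneg_eq_0_iff intro!: sum_pos2)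

text \<open>Substituting \<open>f y - f x\<close> into a power series produces one term for every finite word of
  multi-indices. The constant coefficient of \<open>f y - f x\<close> vanishes, so shrinking the box by a factor
  \<open>e \<le> 1\<close> shrinks its absolute sum by the same factor; once that is below the radius of convergence
  \<open>\<rho>\<close>, the sum over all words converges absolutely.\<close>

lemma analytic_at_compose:
  fixes x :: "real^'k::finite" and h :: "real \<Rightarrow> real"
  assumes x: "x \<in> coord_space I" and f: "analytic_at I f x" and \<rho>: "\<rho> > 0"
    and h: "\<And>t. \<bar>t\<bar> < \<rho> \<Longrightarrow> (\<lambda>n. b n * t ^ n) sums h (f x + t)"
  shows "analytic_at I (\<lambda>y. h (f y)) x"
proof -
  obtain s c where s: "s > 0" and sm: "(\<lambda>\<alpha>. \<bar>c \<alpha>\<bar> * s ^ total_degree I \<alpha>) summable_on multi_indices I" and c: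
    "\<And>y. y \<in> coord_space I \<Longrightarrow> in_box I s (y - x) \<Longrightarrow>
        ((\<lambda>\<alpha>. c \<alpha> * monomial_at I (y - x) \<alpha>) has_sum f y) (multi_indices I)" using f by (elim analytic_atE) blast
  have c0: "c (\<lambda>_. 0) = f x" using x c s by (rule analytic_coeff_0)
  define M where "M = multi_indices I - {\<lambda>_. 0}"
  have z: "(\<lambda>_. 0) \<in> multi_indices I" by (simp add: multi_indices_def)
  have smM: "(\<lambda>\<alpha>. \<bar>c \<alpha>\<bar> * s ^ total_degree I \<alpha>) summable_on M"
    using sm by (rule summable_on_subset_banach) (auto simp: M_def)
  define T where "T = infsum (\<lambda>\<alpha>. \<bar>c \<alpha>\<bar> * s ^ total_degree I \<alpha>) M"
  have T: "T \<ge> 0" unfolding T_def using s by (intro infsum_nonneg) auto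
  \<comment> \<open>The scaling is chosen such that \<open>e * T < \<rho>\<close>, also for \<open>T = 0\<close>.\<close>
  define e where "e = min 1 (\<rho> / (2 * (T + 1)))"
  have e: "0 < e" "e \<le> 1" using \<rho> T by (auto simp: e_def)
  have eT: "e * T < \<rho>"
  proof -
    have "e * T \<le> \<rho> / (2 * (T + 1)) * T" using T by (intro mult_right_mono) (auto simp: e_def)
    also have "\<dots> < \<rho>" using T \<rho> by (simp add: field_simps add_nonneg_pos)
    finally show ?thesis .
  qed
  define W where "W n = {w. length w = n \<and> set w \<subseteq> M}" for n
  define X where "X = Sigma (UNIV :: nat set) W"
  show ?thesis
  proof (rule analytic_at_regroup[OF x, where s = "e * s" and X = X and
        C = "\<lambda>(n, w). b n * prod_list (map c w)" and deg = "\<lambda>(n, w) i. sum_list (map (\<lambda>\<alpha>. \<alpha> i) w)"])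
    show "e * s > 0" using e s by simp
    show "(case p of (n, w) \<Rightarrow> \<lambda>i. sum_list (map (\<lambda>\<alpha>. \<alpha> i) w)) \<in> multi_indices I" if "p \<in> X" for p
      using that by (force simp: X_def W_def M_def multi_indices_def sum_list_eq_0_iff)
    fix y assume y: "y \<in> coord_space I" "in_box I (e * s) (y - x)"
    define F where "F \<alpha> = c \<alpha> * monomial_at I (y - x) \<alpha>" for \<alpha>
    have "in_box I s (y - x)" using y(2) by (rule in_box_mono) (use e s in simp)
    then have "(F has_sum f y) (multi_indices I)" unfolding F_def using c y by blast
    then have FM: "(F has_sum (f y - f x)) M"
      unfolding M_def using has_sum_Diff[of F "multi_indices I" "f y" "{\<lambda>_. 0}" "f x"] z
      by (simp add: F_def has_sum_finiteI c0 monomial_at_0)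
    have Fle: "\<bar>F \<alpha>\<bar> \<le> e * (\<bar>c \<alpha>\<bar> * s ^ total_degree I \<alpha>)" if "\<alpha> \<in> M" for \<alpha>
    proof -
      have "\<bar>monomial_at I (y - x) \<alpha>\<bar> \<le> e ^ total_degree I \<alpha> * s ^ total_degree I \<alpha>"
        using monomial_at_le[OF y(2)] by (simp add: power_mult_distrib)
      also have "e ^ total_degree I \<alpha> \<le> e ^ 1"
        using that e by (intro power_decreasing total_degree_pos) (auto simp: M_def)
      finally have "\<bar>monomial_at I (y - x) \<alpha>\<bar> \<le> e * s ^ total_degree I \<alpha>" using s by (simp add: mult_right_mono)
      then have "\<bar>c \<alpha>\<bar> * \<bar>monomial_at I (y - x) \<alpha>\<bar> \<le> \<bar>c \<alpha>\<bar> * (e * s ^ total_degree I \<alpha>)" by (intro mult_left_mono) auto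
      then show ?thesis by (simp add: F_def abs_mult mult_ac)
    qed
    define t where "t = infsum (\<lambda>\<alpha>. \<bar>F \<alpha>\<bar>) M"
    have Fa: "((\<lambda>\<alpha>. \<bar>F \<alpha>\<bar>) has_sum t) M"
      unfolding t_def using FM summable_on_iff_abs_summable_on_real[of F M]
      by (intro has_sum_infsum) (auto simp: summable_on_def)
    have t: "0 \<le> t" "t < \<rho>"
    proof -
      show "t \<ge> 0" unfolding t_def by (intro infsum_nonneg) auto
      have "t \<le> infsum (\<lambda>\<alpha>. e * (\<bar>c \<alpha>\<bar> * s ^ total_degree I \<alpha>)) M"
        unfolding t_def using Fa Fle smM
        by (intro infsum_mono summable_on_cmult_right) (auto simp: summable_on_def)
      also have "\<dots> = e * T" unfolding T_def by (rule infsum_cmult_right')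
      finally show "t < \<rho>" using eT by simp
    qed
    have dle: "\<bar>f y - f x\<bar> \<le> t"
      using norm_has_sum_bound[OF _ FM, of t] Fa by simp
    have sumb: "summable (\<lambda>n. norm (b n * t ^ n))"
      using powser_insidea[of b "(t + \<rho>) / 2" t] h[of "(t + \<rho>) / 2"] t by (simp add: sums_iff)
    have "((\<lambda>p. b (fst p) * prod_list (map F (snd p))) has_sum h (f y)) X"
      unfolding X_def
    proof (rule has_sum_SigmaI)
      fix n
      show "((\<lambda>w. b (fst (n, w)) * prod_list (map F (snd (n, w)))) has_sum b n * (f y - f x) ^ n) (W n)"
        unfolding W_def using has_sum_cmult_right[OF has_sum_words[OF FM]] by simp
    next
      have "summable (\<lambda>n. norm (b n * (f y - f x) ^ n))"
      proof (rule summable_comparison_test[OF _ sumb], intro exI[of _ 0] allI impI)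
        fix n
        have "\<bar>f y - f x\<bar> ^ n \<le> t ^ n" using dle by (intro power_mono) auto
        then show "norm (norm (b n * (f y - f x) ^ n)) \<le> norm (b n * t ^ n)"
          using t by (simp add: abs_mult power_abs mult_left_mono)
      qed
      moreover have "(\<lambda>n. b n * (f y - f x) ^ n) sums h (f y)"
        using h[of "f y - f x"] dle t by simp
      ultimately show "((\<lambda>n. b n * (f y - f x) ^ n) has_sum h (f y)) UNIV"
        by (rule norm_summable_imp_has_sum)
    next
      have w: "((\<lambda>w. \<bar>b n\<bar> * \<bar>prod_list (map F w)\<bar>) has_sum \<bar>b n\<bar> * t ^ n) (W n)" for n
      proof -
        have "\<bar>prod_list (map F w)\<bar> = prod_list (map (\<lambda>\<alpha>. \<bar>F \<alpha>\<bar>) w)" for w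
          by (induction w) (auto simp: abs_mult)
        then show ?thesis unfolding W_def using has_sum_cmult_right[OF has_sum_words[OF Fa]] by simp
      qed
      have "(\<lambda>n. \<bar>b n\<bar> * t ^ n) summable_on UNIV"
        using sumb t by (intro norm_summable_imp_summable_on) (auto simp: abs_mult)
      then have "(\<lambda>p. norm (b (fst p) * prod_list (map F (snd p)))) summable_on (SIGMA n:UNIV. W n)"
        using w infsumI[OF w] t
        by (subst Infinite_Sum.abs_summable_on_Sigma_iff) (auto simp: abs_mult summable_on_def)
      then show "(\<lambda>p. b (fst p) * prod_list (map F (snd p))) summable_on (SIGMA n:UNIV. W n)"
        by (rule Infinite_Sum.abs_summable_summable)
    qed
    moreover have "prod_list (map F w) = prod_list (map c w) * monomial_at I (y - x) (\<lambda>i. sum_list (map (\<lambda>\<alpha>. \<alpha> i) w))" for w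
      by (induction w) (auto simp: F_def monomial_at_plus monomial_at_0)
    ultimately show "((\<lambda>p. (case p of (n, w) \<Rightarrow> b n * prod_list (map c w)) * monomial_at I (y - x)
         (case p of (n, w) \<Rightarrow> \<lambda>i. sum_list (map (\<lambda>\<alpha>. \<alpha> i) w))) has_sum h (f y)) X"
      by (simp add: case_prod_unfold mult.assoc)
  qed
qed

lemma analytic_at_inverse:
  fixes x :: "real^'k::finite"
  assumes x: "x \<in> coord_space I" and f: "analytic_at I f x" and nz: "f x \<noteq> 0"
  shows "analytic_at I (\<lambda>y. inverse (f y)) x"
proof (rule analytic_at_compose[OF x f])
  show "\<bar>f x\<bar> > 0" using nz by simp
  fix t :: real assume t: "\<bar>t\<bar> < \<bar>f x\<bar>"
  have "(\<lambda>n. (- (t / f x)) ^ n) sums (1 / (1 - (- (t / f x))))"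
    using t nz by (intro geometric_sums) auto
  from sums_mult[OF this, of "inverse (f x)"]
  have "(\<lambda>n. (inverse (f x) * (- inverse (f x)) ^ n) * t ^ n) sums (inverse (f x) * (1 / (1 - (- (t / f x)))))"
    by (simp add: divide_inverse mult_ac power_mult_distrib power_minus')
  moreover have "f x + t \<noteq> 0" using t by auto
  then have "inverse (f x) * (1 / (1 - (- (t / f x)))) = inverse (f x + t)"
    using nz by (simp add: divide_simps)
  ultimately show "(\<lambda>n. (inverse (f x) * (- inverse (f x)) ^ n) * t ^ n) sums inverse (f x + t)" by simp
qed

lemma analytic_at_sqrt:
  fixes x :: "real^'k::finite"
  assumes x: "x \<in> coord_space I" and f: "analytic_at I f x" and pos: "f x > 0"
  shows "analytic_at I (\<lambda>y. sqrt (f y)) x"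
  by (rule analytic_at_compose[OF x f pos sqrt_series'])

text \<open>Analyticity at \<open>x\<close> only depends on the values near \<open>x\<close>. This transfers it from closed formulas to
  functions that are described by them on \<open>U\<close> only.\<close>

lemma analytic_at_cong:
  assumes U: "openin (top_of_set (coord_space I)) U" "x \<in> U" and eq: "\<And>y. y \<in> U \<Longrightarrow> f y = g y"
    and f: "analytic_at I f x"
  shows "analytic_at I g x"
proof -
  obtain s c where s: "s > 0" and c:
    "\<And>y. y \<in> coord_space I \<Longrightarrow> in_box I s (y - x) \<Longrightarrow>
        ((\<lambda>\<alpha>. c \<alpha> * monomial_at I (y - x) \<alpha>) has_sum f y) (multi_indices I)" using f by (elim analytic_atE) blast
  obtain r where r: "r > 0" "ball x r \<inter> coord_space I \<subseteq> U"
    using U by (auto simp: openin_contains_ball)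
  have x: "x \<in> coord_space I" using U openin_imp_subset by blast
  define t where "t = min s (r / (2 * (real CARD('a))))"
  have t: "t > 0" using s r by (simp add: t_def)
  show ?thesis
  proof (rule analytic_at_regroup[OF x t, where X = "multi_indices I" and C = c and deg = "\<lambda>\<alpha>. \<alpha>"])
    fix y assume y: "y \<in> coord_space I" "in_box I t (y - x)"
    have "\<bar>(y - x) $ i\<bar> \<le> t" for i
      using y x t by (cases "i \<in> I") (auto simp: in_box_def coord_space_def)
    then have "norm (y - x) \<le> (\<Sum>i\<in>(UNIV :: 'a set). t)"
      by (intro order_trans[OF norm_le_l1_cart] sum_mono) auto
    also have "\<dots> = real CARD('a) * t" by simp
    also have "\<dots> \<le> real CARD('a) * (r / (2 * (real CARD('a))))"
      by (intro mult_left_mono) (auto simp: t_def)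
    also have "\<dots> < r" using r by (simp add: field_simps)
    finally have "y \<in> U" using r y by (auto simp: dist_norm norm_minus_commute)
    moreover have "in_box I s (y - x)" using y(2) by (rule in_box_mono) (simp add: t_def)
    ultimately show "((\<lambda>w. c w * monomial_at I (y - x) w) has_sum g y) (multi_indices I)"
      using c[of y] y eq by simp
  qed
qed

lemma real_analytic_on_real:
  fixes f :: "real^'k::finite \<Rightarrow> real"
  assumes "\<And>x. x \<in> U \<Longrightarrow> analytic_at I f x"
  shows "real_analytic_on I U f"
  unfolding real_analytic_on_def
proof
  fix x assume "x \<in> U"
  from assms[OF this] obtain s c where s: "s > 0" and c:
    "\<And>y. y \<in> coord_space I \<Longrightarrow> in_box I s (y - x) \<Longrightarrow>
        ((\<lambda>\<alpha>. c \<alpha> * monomial_at I (y - x) \<alpha>) has_sum f y) (multi_indices I)"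
    by (elim analytic_atE) blast
  have "in_box I s (y - x)" if "y \<in> ball x s" for y
    unfolding in_box_def
  proof
    fix i show "\<bar>(y - x) $ i\<bar> \<le> s"
      using that component_le_norm_cart[of "y - x" i] by (simp add: dist_norm norm_minus_commute)
  qed
  then show "\<exists>r>0. \<exists>c. \<forall>y\<in>coord_space I \<inter> ball x r.
        ((\<lambda>\<alpha>. (\<Prod>i\<in>I. (y $ i - x $ i) ^ \<alpha> i) *\<^sub>R c \<alpha>) has_sum f y) {\<alpha>. \<forall>i. i \<notin> I \<longrightarrow> \<alpha> i = 0}"
    using s c unfolding multi_indices_def monomial_at_def by (intro exI[of _ s] conjI exI[of _ c]) (auto simp: mult.commute)
qed

lemma has_sum_vecI:
  fixes g :: "'i \<Rightarrow> 'b::real_normed_vector^'a"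
  assumes "\<And>j. ((\<lambda>w. g w $ j) has_sum v $ j) A"
  shows "(g has_sum v) A"
  using assms unfolding has_sum_def by (intro vec_tendstoI) simp

lemma real_analytic_on_vec:
  fixes f :: "real^'k::finite \<Rightarrow> 'b::real_normed_vector^'a"
  assumes "\<And>j. real_analytic_on I U (\<lambda>x. f x $ j)"
  shows "real_analytic_on I U f"
  unfolding real_analytic_on_def
proof
  fix x assume x: "x \<in> U"
  define P where "P j r c \<longleftrightarrow> (\<forall>y\<in>coord_space I \<inter> ball x r.
      ((\<lambda>\<alpha>. (\<Prod>i\<in>I. (y $ i - x $ i) ^ \<alpha> i) *\<^sub>R c \<alpha>) has_sum f y $ j) {\<alpha>. \<forall>i. i \<notin> I \<longrightarrow> \<alpha> i = 0})"
    for j r c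
  have "\<exists>r>0. \<exists>c. P j r c" for j
    using assms[of j] x unfolding real_analytic_on_def P_def by (rule bspec)
  then obtain r c where r: "\<And>j. r j > (0::real)" and P: "\<And>j. P j (r j) (c j)"
    by metis
  have c: "((\<lambda>\<alpha>. (\<Prod>i\<in>I. (y $ i - x $ i) ^ \<alpha> i) *\<^sub>R c j \<alpha>) has_sum f y $ j) {\<alpha>. \<forall>i. i \<notin> I \<longrightarrow> \<alpha> i = 0}"
    if "y\<in>coord_space I \<inter> ball x (r j)" for j y
    using P[of j] that unfolding P_def by (rule bspec)
  show "\<exists>r>0. \<exists>c. \<forall>y\<in>coord_space I \<inter> ball x r.
        ((\<lambda>\<alpha>. (\<Prod>i\<in>I. (y $ i - x $ i) ^ \<alpha> i) *\<^sub>R c \<alpha>) has_sum f y) {\<alpha>. \<forall>i. i \<notin> I \<longrightarrow> \<alpha> i = 0}"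
  proof (intro exI[of _ "Min (range r)"] conjI exI[of _ "\<lambda>\<alpha>. \<chi> j. c j \<alpha>"] ballI has_sum_vecI)
    show "Min (range r) > 0" using r by simp
    fix y j assume "y \<in> coord_space I \<inter> ball x (Min (range r))"
    then have "y \<in> coord_space I \<inter> ball x (r j)" by simp
    from c[OF this] show "((\<lambda>\<alpha>. ((\<Prod>i\<in>I. (y $ i - x $ i) ^ \<alpha> i) *\<^sub>R (\<chi> j. c j \<alpha>)) $ j) has_sum f y $ j)
       {\<alpha>. \<forall>i. i \<notin> I \<longrightarrow> \<alpha> i = 0}"
      by (simp only: vector_scaleR_component vec_lambda_beta)
  qed
qed

section \<open>Strict differentiability of power series\<close>

text \<open>After scaling by \<open>\<rho>\<close> all factors have absolute value at most 1, and differences of products of such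
  factors are bounded by the sum of the differences of the factors.\<close>

lemma monomial_at_diff_le:
  assumes a: "in_box I \<rho> a" and b: "in_box I \<rho> b" and \<rho>: "\<rho> > 0"
  shows "\<bar>monomial_at I a \<alpha> - monomial_at I b \<alpha>\<bar> \<le> \<rho> ^ total_degree I \<alpha> * (real (total_degree I \<alpha>) * (norm (a - b) / \<rho>))"
proof -
  have 1: "\<bar>a $ i / \<rho>\<bar> \<le> 1" "\<bar>b $ i / \<rho>\<bar> \<le> 1" if "i \<in> I" for i
    using a b \<rho> that by (auto simp: in_box_def)
  have sc: "monomial_at I v \<alpha> = \<rho> ^ total_degree I \<alpha> * (\<Prod>i\<in>I. (v $ i / \<rho>) ^ \<alpha> i)" for v
    using \<rho> by (simp add: monomial_at_def total_degree_def power_sum power_divide prod_dividef)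
  have "\<bar>(\<Prod>i\<in>I. (a $ i / \<rho>) ^ \<alpha> i) - (\<Prod>i\<in>I. (b $ i / \<rho>) ^ \<alpha> i)\<bar>
      \<le> (\<Sum>i\<in>I. \<bar>(a $ i / \<rho>) ^ \<alpha> i - (b $ i / \<rho>) ^ \<alpha> i\<bar>)"
    using 1 norm_prod_diff[of I "\<lambda>i. (a $ i / \<rho>) ^ \<alpha> i" "\<lambda>i. (b $ i / \<rho>) ^ \<alpha> i"]
    by (simp add: power_abs power_le_one del: abs_divide)
  also have "\<dots> \<le> (\<Sum>i\<in>I. real (\<alpha> i) * (norm (a - b) / \<rho>))"
  proof (rule sum_mono)
    fix i assume i: "i \<in> I"
    have "\<bar>(a $ i / \<rho>) ^ \<alpha> i - (b $ i / \<rho>) ^ \<alpha> i\<bar> \<le> real (\<alpha> i) * \<bar>a $ i / \<rho> - b $ i / \<rho>\<bar>"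
      using norm_power_diff[of "a $ i / \<rho>" "b $ i / \<rho>" "\<alpha> i"] 1[OF i] by simp
    also have "\<bar>a $ i / \<rho> - b $ i / \<rho>\<bar> \<le> norm (a - b) / \<rho>"
      using component_le_norm_cart[of "a - b" i] \<rho> by (simp add: divide_right_mono flip: diff_divide_distrib)
    finally show "\<bar>(a $ i / \<rho>) ^ \<alpha> i - (b $ i / \<rho>) ^ \<alpha> i\<bar> \<le> real (\<alpha> i) * (norm (a - b) / \<rho>)"
      by (simp add: mult_left_mono)
  qed
  also have "\<dots> = real (total_degree I \<alpha>) * (norm (a - b) / \<rho>)"
    by (simp only: total_degree_def of_nat_sum sum_distrib_right)
  finally show ?thesis
    unfolding sc right_diff_distrib[symmetric] abs_mult using \<rho> by (simp add: mult_left_mono del: times_divide_eq_right)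
qed

text \<open>The linear part of the series is the derivative. On a box smaller by the factor \<open>\<epsilon>\<close> the terms of
  degree at least 2 contribute at most a multiple of \<open>\<epsilon> * norm (y - z)\<close> to \<open>f y - f z\<close>. Comparing two
  arbitrary nearby points, instead of one point with \<open>x\<close>, gives the derivative and a
  local Lipschitz constant at the same time.\<close>

lemma analytic_at_strict_derivative:
  fixes x :: "real^'k::finite"
  assumes x: "x \<in> coord_space I" and f: "analytic_at I f x"
  obtains D :: "real^'k" where "\<And>e. e > 0 \<Longrightarrow> \<exists>d>0. \<forall>y\<in>coord_space I. \<forall>z\<in>coord_space I.
     norm (y - x) < d \<longrightarrow> norm (z - x) < d \<longrightarrow> \<bar>f y - f z - D \<bullet> (y - z)\<bar> \<le> e * norm (y - z)"
proof -
  obtain s c where s: "s > 0" and sm: "(\<lambda>\<alpha>. \<bar>c \<alpha>\<bar> * s ^ total_degree I \<alpha>) summable_on multi_indices I" and c: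
    "\<And>y. y \<in> coord_space I \<Longrightarrow> in_box I s (y - x) \<Longrightarrow>
        ((\<lambda>\<alpha>. c \<alpha> * monomial_at I (y - x) \<alpha>) has_sum f y) (multi_indices I)" using f by (elim analytic_atE) blast
  define ee where "ee i = (\<lambda>j. if j = i then 1 else 0 :: nat)" for i :: 'k
  define E where "E = insert (\<lambda>_. 0) (ee ` I)"
  define M2 where "M2 = multi_indices I - E"
  have E: "E \<subseteq> multi_indices I" by (auto simp: E_def multi_indices_def ee_def)
  have ee_inj: "inj_on ee I" unfolding inj_on_def ee_def by (metis zero_neq_one)
  have me: "monomial_at I v (ee i) = v $ i" if "i \<in> I" for v :: "real^'k" and i
    using that by (simp add: monomial_at_def ee_def if_distrib[of "power _"] prod.delta cong: if_cong)
  have deg2: "total_degree I \<alpha> \<ge> 2" if "\<alpha> \<in> M2" for \<alpha>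
  proof (rule ccontr)
    assume lt: "\<not> total_degree I \<alpha> \<ge> 2"
    have "\<alpha> \<noteq> (\<lambda>_. 0)" using that by (auto simp: M2_def E_def)
    then obtain i where i: "\<alpha> i \<noteq> 0" by auto
    have iI: "i \<in> I" using that i by (auto simp: M2_def multi_indices_def)
    have "total_degree I \<alpha> = \<alpha> i + (\<Sum>j\<in>I - {i}. \<alpha> j)"
      unfolding total_degree_def using iI by (simp add: sum.remove)
    then have ai: "\<alpha> i = 1" and "(\<Sum>j\<in>I - {i}. \<alpha> j) = 0" using lt i by linarith+
    then have "\<forall>j\<in>I - {i}. \<alpha> j = 0" by (subst (asm) sum_eq_0_iff) auto
    then have "\<alpha> j = ee i j" for j
      using that iI ai by (cases "j \<in> I") (auto simp: ee_def M2_def multi_indices_def)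
    then have "\<alpha> = ee i" by auto
    then show False using that iI by (auto simp: M2_def E_def)
  qed
  define D :: "real^'k" where "D = (\<chi> i. if i \<in> I then c (ee i) else 0)"
  have smM: "(\<lambda>\<alpha>. \<bar>c \<alpha>\<bar> * s ^ total_degree I \<alpha>) summable_on M2"
    using sm by (rule summable_on_subset_banach) (auto simp: M2_def)
  define T where "T = infsum (\<lambda>\<alpha>. \<bar>c \<alpha>\<bar> * s ^ total_degree I \<alpha>) M2"
  have T: "T \<ge> 0" unfolding T_def using s by (intro infsum_nonneg) auto
  show thesis
  proof (rule that[of D])
    fix e :: real assume e: "e > 0"
    define \<epsilon> where "\<epsilon> = min (1/2) (e * s / (2 * (T + 1)))"
    have \<epsilon>: "\<epsilon> > 0" "\<epsilon> \<le> 1/2"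
      using e s T unfolding \<epsilon>_def by (simp, intro min.cobounded1)
    have \<epsilon>T: "2 * \<epsilon> / s * T \<le> e"
    proof -
      have "2 * \<epsilon> / s * T \<le> 2 * (e * s / (2 * (T + 1))) / s * T"
        using T s by (intro mult_right_mono divide_right_mono) (auto simp: \<epsilon>_def)
      also have "\<dots> = e * (T / (T + 1))" using s T by (simp add: divide_simps)
      also have "\<dots> \<le> e * 1" using e T by (intro mult_left_mono) auto
      also have "\<dots> = e" by simp
      finally show ?thesis .
    qed
    show "\<exists>d>0. \<forall>y\<in>coord_space I. \<forall>z\<in>coord_space I.
     norm (y - x) < d \<longrightarrow> norm (z - x) < d \<longrightarrow> \<bar>f y - f z - D \<bullet> (y - z)\<bar> \<le> e * norm (y - z)"
    proof (intro exI[of _ "\<epsilon> * s"] conjI ballI impI)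
      show "\<epsilon> * s > 0" using \<epsilon> s by simp
      fix y z :: "real^'k"
      assume y: "y \<in> coord_space I" "norm (y - x) < \<epsilon> * s" and z: "z \<in> coord_space I" "norm (z - x) < \<epsilon> * s"
      have box: "in_box I (\<epsilon> * s) v" if "norm v < \<epsilon> * s" for v :: "real^'k"
        unfolding in_box_def using that by (auto intro: order_trans[OF component_le_norm_cart])
      have box': "in_box I s v" if "norm v < \<epsilon> * s" for v :: "real^'k"
        using box[OF that] by (rule in_box_mono) (use \<epsilon> s in simp)
      define G where "G \<alpha> = c \<alpha> * monomial_at I (y - x) \<alpha> - c \<alpha> * monomial_at I (z - x) \<alpha>" for \<alpha>
      have "(G has_sum (f y - f z)) (multi_indices I)"
        using has_sum_add[OF c[OF y(1) box'[OF y(2)]]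
            has_sum_cmult_right[OF c[OF z(1) box'[OF z(2)]], of "-1"]]
        unfolding G_def[abs_def] by simp
      moreover have "sum G E = D \<bullet> (y - z)"
      proof -
        have "(\<lambda>_. 0) \<notin> ee ` I" by (auto simp: ee_def fun_eq_iff) (metis zero_neq_one)
        then have "sum G E = G (\<lambda>_. 0) + (\<Sum>i\<in>I. G (ee i))"
          unfolding E_def by (simp add: sum.reindex[OF ee_inj])
        also have "\<dots> = (\<Sum>i\<in>I. c (ee i) * (y $ i - z $ i))"
          by (simp add: G_def monomial_at_0 me flip: right_diff_distrib)
        also have "\<dots> = (\<Sum>i\<in>UNIV. D $ i * (y $ i - z $ i))"
          by (rule sum.mono_neutral_cong_left) (auto simp: D_def)
        finally show ?thesis by (simp add: inner_vec_def)
      qed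
      moreover have "finite E" by (simp add: E_def)
      ultimately have GM: "(G has_sum (f y - f z - D \<bullet> (y - z))) M2"
        unfolding M2_def using E has_sum_Diff[of G "multi_indices I" "f y - f z" E "D \<bullet> (y - z)"]
        by (metis has_sum_finite)
      have Gle: "\<bar>G \<alpha>\<bar> \<le> 2 * \<epsilon> / s * norm (y - z) * (\<bar>c \<alpha>\<bar> * s ^ total_degree I \<alpha>)" if \<alpha>: "\<alpha> \<in> M2" for \<alpha>
      proof -
        obtain k where k: "total_degree I \<alpha> = Suc (Suc k)"
          using deg2[OF \<alpha>] by (metis add_2_eq_Suc le_Suc_ex)
        \<comment> \<open>With \<open>\<epsilon> \<le> 1/2\<close> the geometric factor absorbs the degree.\<close>
        have "real (Suc (Suc k)) * \<epsilon> ^ k \<le> 2"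
        proof -
          have "real (Suc (Suc k)) \<le> 2 * 2 ^ k" by (induction k) auto
          moreover have "\<epsilon> ^ k \<le> (1/2) ^ k" using \<epsilon> by (intro power_mono) auto
          ultimately have "real (Suc (Suc k)) * \<epsilon> ^ k \<le> (2 * 2 ^ k) * (1/2) ^ k"
            using \<epsilon> by (intro mult_mono) auto
          also have "\<dots> = 2" by (simp add: power_one_over)
          finally show ?thesis .
        qed
        then have kk: "real (Suc (Suc k)) * \<epsilon> ^ k * (\<epsilon> * s ^ Suc k) \<le> 2 * (\<epsilon> * s ^ Suc k)"
          using \<epsilon> s by (intro mult_right_mono) auto
        have pw: "(\<epsilon> * s) ^ Suc (Suc k) * (real (Suc (Suc k)) * (N / (\<epsilon> * s))) \<le> 2 * \<epsilon> / s * N * s ^ Suc (Suc k)"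
          if "N \<ge> 0" for N
        proof -
          have "(\<epsilon> * s) ^ Suc (Suc k) * (real (Suc (Suc k)) * (N / (\<epsilon> * s))) =
              (real (Suc (Suc k)) * \<epsilon> ^ k * (\<epsilon> * s ^ Suc k)) * N"
            using \<epsilon> s by (simp add: power_mult_distrib)
          also have "\<dots> \<le> (2 * (\<epsilon> * s ^ Suc k)) * N" using kk that by (rule mult_right_mono)
          also have "\<dots> = 2 * \<epsilon> / s * N * s ^ Suc (Suc k)" using s by simp
          finally show ?thesis .
        qed
        have "\<bar>G \<alpha>\<bar> = \<bar>c \<alpha>\<bar> * \<bar>monomial_at I (y - x) \<alpha> - monomial_at I (z - x) \<alpha>\<bar>"
          by (simp add: G_def abs_mult flip: right_diff_distrib)
        also have "\<dots> \<le> \<bar>c \<alpha>\<bar> * ((\<epsilon> * s) ^ total_degree I \<alpha> * (real (total_degree I \<alpha>) * (norm (y - z) / (\<epsilon> * s))))"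
          using monomial_at_diff_le[of I "\<epsilon> * s" "y - x" "z - x" \<alpha>] box y z \<epsilon> s
          by (intro mult_left_mono) auto
        also have "\<dots> \<le> \<bar>c \<alpha>\<bar> * (2 * \<epsilon> / s * norm (y - z) * s ^ total_degree I \<alpha>)"
          unfolding k using pw[of "norm (y - z)"] by (intro mult_left_mono) auto
        finally show ?thesis by (simp add: mult_ac)
      qed
      have "\<bar>f y - f z - D \<bullet> (y - z)\<bar> \<le> 2 * \<epsilon> / s * norm (y - z) * T"
      proof -
        have Ga: "((\<lambda>\<alpha>. \<bar>G \<alpha>\<bar>) has_sum infsum (\<lambda>\<alpha>. \<bar>G \<alpha>\<bar>) M2) M2"
          using GM summable_on_iff_abs_summable_on_real[of G M2]
          by (intro has_sum_infsum) (auto simp: summable_on_def)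
        have "\<bar>f y - f z - D \<bullet> (y - z)\<bar> \<le> infsum (\<lambda>\<alpha>. \<bar>G \<alpha>\<bar>) M2"
          using norm_has_sum_bound[OF _ GM] Ga by simp
        also have "\<dots> \<le> infsum (\<lambda>\<alpha>. 2 * \<epsilon> / s * norm (y - z) * (\<bar>c \<alpha>\<bar> * s ^ total_degree I \<alpha>)) M2"
          using Ga Gle smM by (intro infsum_mono summable_on_cmult_right) (auto simp: summable_on_def)
        also have "\<dots> = 2 * \<epsilon> / s * norm (y - z) * T" unfolding T_def by (rule infsum_cmult_right')
        finally show ?thesis .
      qed
      also have "\<dots> = (2 * \<epsilon> / s * T) * norm (y - z)" by simp
      also have "\<dots> \<le> e * norm (y - z)" using \<epsilon>T by (rule mult_right_mono) simp
      finally show "\<bar>f y - f z - D \<bullet> (y - z)\<bar> \<le> e * norm (y - z)" .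
    qed
  qed
qed

lemma analytic_at_has_derivative:
  fixes x :: "real^'k::finite"
  assumes x: "x \<in> coord_space I" and f: "analytic_at I f x"
  obtains D where "(f has_derivative (\<lambda>h. D \<bullet> h)) (at x within coord_space I)"
proof -
  obtain D where D: "\<And>e. e > 0 \<Longrightarrow> \<exists>d>0. \<forall>y\<in>coord_space I. \<forall>z\<in>coord_space I.
     norm (y - x) < d \<longrightarrow> norm (z - x) < d \<longrightarrow> \<bar>f y - f z - D \<bullet> (y - z)\<bar> \<le> e * norm (y - z)"
    using analytic_at_strict_derivative[OF assms] by blast
  have "(f has_derivative (\<lambda>h. D \<bullet> h)) (at x within coord_space I)"
    unfolding has_derivative_within_alt
  proof (intro conjI allI impI)
    show "bounded_linear ((\<bullet>) D)" by (rule bounded_linear_inner_right)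
    fix e :: real assume "e > 0"
    from D[OF this] obtain d where d: "d > 0" "\<And>y z. y\<in>coord_space I \<Longrightarrow> z\<in>coord_space I \<Longrightarrow>
      norm (y - x) < d \<Longrightarrow> norm (z - x) < d \<Longrightarrow> \<bar>f y - f z - D \<bullet> (y - z)\<bar> \<le> e * norm (y - z)"
      by blast
    have "norm (x - x) < d" using d(1) by simp
    then show "\<exists>d>0. \<forall>y\<in>coord_space I. norm (y - x) < d \<longrightarrow> norm (f y - f x - D \<bullet> (y - x)) \<le> e * norm (y - x)"
      using d x unfolding real_norm_def by blast
  qed
  then show thesis by (rule that)
qed

lemma analytic_at_lipschitz:
  fixes x :: "real^'k::finite"
  assumes x: "x \<in> coord_space I" and f: "analytic_at I f x"
  shows "\<exists>d>0. \<exists>L\<ge>0. \<forall>y\<in>coord_space I \<inter> ball x d. \<forall>z\<in>coord_space I \<inter> ball x d.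
     \<bar>f y - f z\<bar> \<le> L * norm (y - z)"
proof -
  obtain D where D: "\<And>e. e > 0 \<Longrightarrow> \<exists>d>0. \<forall>y\<in>coord_space I. \<forall>z\<in>coord_space I.
     norm (y - x) < d \<longrightarrow> norm (z - x) < d \<longrightarrow> \<bar>f y - f z - D \<bullet> (y - z)\<bar> \<le> e * norm (y - z)"
    using analytic_at_strict_derivative[OF assms] by blast
  obtain d where d: "d > 0" "\<And>y z. y\<in>coord_space I \<Longrightarrow> z\<in>coord_space I \<Longrightarrow>
     norm (y - x) < d \<Longrightarrow> norm (z - x) < d \<Longrightarrow> \<bar>f y - f z - D \<bullet> (y - z)\<bar> \<le> norm (y - z)"
    using D[OF zero_less_one] unfolding mult_1 by blast
  have "\<bar>f y - f z\<bar> \<le> (1 + norm D) * norm (y - z)"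
    if "y\<in>coord_space I \<inter> ball x d" "z\<in>coord_space I \<inter> ball x d" for y z
  proof -
    have "norm (y - x) < d" "norm (z - x) < d"
      using that by (auto simp: dist_norm norm_minus_commute)
    then have "\<bar>f y - f z - D \<bullet> (y - z)\<bar> \<le> norm (y - z)" using d(2) that by blast
    moreover have "\<bar>D \<bullet> (y - z)\<bar> \<le> norm D * norm (y - z)" by (rule Cauchy_Schwarz_ineq2)
    ultimately have "\<bar>f y - f z\<bar> \<le> norm (y - z) + norm D * norm (y - z)" by linarith
    then show ?thesis by (simp add: distrib_right)
  qed
  then have "\<forall>y\<in>coord_space I \<inter> ball x d. \<forall>z\<in>coord_space I \<inter> ball x d.
     \<bar>f y - f z\<bar> \<le> (1 + norm D) * norm (y - z)" by blast
  moreover have "1 + norm D \<ge> 0" by simp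
  ultimately show ?thesis using d(1) by blast
qed

section \<open>The Lyapunov equation\<close>

lemma transpose_add: "transpose (A + B) = transpose A + transpose B" for A B :: "'a::ab_group_add^'c^'r"
  by (simp add: transpose_def vec_eq_iff)

lemma transpose_uminus: "transpose (- A) = - transpose A" for A :: "'a::ab_group_add^'c^'r"
  by (simp add: transpose_def vec_eq_iff)

lemma sum_UNIV_pair: "(\<Sum>q\<in>UNIV. f q) = (\<Sum>a\<in>UNIV. \<Sum>b\<in>UNIV. f (a, b))"
  for f :: "'a::finite \<times> 'b::finite \<Rightarrow> 'c::comm_monoid_add"
  by (simp add: sum.cartesian_product UNIV_Times_UNIV)

lemma inner_matrix_transpose: "x \<bullet> (A *v y) = (transpose A *v x) \<bullet> y"
  for A :: "real^'a^'b"
  by (simp add: transpose_matrix_vector dot_lmul_matrix)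

definition cmatrix :: "real^'k^'k \<Rightarrow> complex^'k^'k" where
  "cmatrix A = (\<chi> i j. complex_of_real (A $ i $ j))"

lemma cmatrix_mult: "cmatrix (A ** B) = cmatrix A ** cmatrix B"
  by (simp add: cmatrix_def matrix_matrix_mult_def vec_eq_iff)

lemma cmatrix_transpose: "cmatrix (transpose A) = transpose (cmatrix A)"
  by (simp add: cmatrix_def transpose_def vec_eq_iff)

lemma cmatrix_uminus: "cmatrix (- A) = - cmatrix A"
  by (simp add: cmatrix_def vec_eq_iff)

lemma cmatrix_eq_0: "cmatrix A = 0 \<longleftrightarrow> A = 0"
  by (simp add: cmatrix_def vec_eq_iff)

text \<open>The vector \<open>p(A) x\<close>, by Horner's scheme.\<close>

definition poly_apply :: "complex^'k^'k \<Rightarrow> complex poly \<Rightarrow> complex^'k \<Rightarrow> complex^'k" where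
  "poly_apply A p x = fold_coeffs (\<lambda>a v. a *s x + A *v v) p 0"

lemma poly_apply_0 [simp]: "poly_apply A 0 x = 0"
  by (simp add: poly_apply_def)

lemma poly_apply_pCons [simp]: "poly_apply A (pCons a p) x = a *s x + A *v poly_apply A p x"
  by (cases "p = 0 \<and> a = 0") (auto simp: poly_apply_def)

lemma poly_apply_add: "poly_apply A (p + q) x = poly_apply A p x + poly_apply A q x"
  by (induction p q rule: poly_induct2)
    (auto simp: vector_sadd_rdistrib matrix_vector_right_distrib)

lemma poly_apply_smult: "poly_apply A (smult c p) x = c *s poly_apply A p x"
  by (induction p) (auto simp: vector_add_ldistrib vec.scale vector_smult_assoc)

lemma poly_apply_sum: "poly_apply A (sum p S) x = (\<Sum>i\<in>S. poly_apply A (p i) x)"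
  by (induction S rule: infinite_finite_induct) (auto simp: poly_apply_add)

lemma poly_apply_monom: "poly_apply A (monom c n) x = c *s (((*v) A) ^^ n) x"
  by (induction n) (auto simp: monom_0 monom_Suc vec.scale)

lemma poly_apply_linear_factor:
  "poly_apply A ([:- c, 1:] * p) x = A *v poly_apply A p x - c *s poly_apply A p x"
  by (simp only: mult_pCons_left mult_zero_left poly_apply_add poly_apply_smult poly_apply_pCons poly_apply_0)
    (simp add: vec_eq_iff)

text \<open>The \<open>n + 1\<close> vectors \<open>x, A x, \<dots>, A\<^sup>n x\<close> are linearly dependent (or two of them coincide).\<close>

lemma annihilating_poly:
  fixes A :: "complex^'k^'k"
  obtains p where "p \<noteq> 0" "poly_apply A p x = 0"
proof -
  define f where "f n = (((*v) A) ^^ n) x" for n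
  let ?N = "{..CARD('k)}"
  show thesis
  proof (cases "inj_on f ?N")
    case False
    then obtain m n where mn: "m \<noteq> n" "f m = f n" by (auto simp: inj_on_def)
    have "coeff (monom 1 m + monom (- 1) n) m \<noteq> (0::complex)" using mn by simp
    then have "monom 1 m + monom (- 1) n \<noteq> (0 :: complex poly)" by (metis coeff_0)
    then show thesis
      by (rule that) (use mn in \<open>simp add: poly_apply_add poly_apply_monom f_def\<close>)
  next
    case True
    have "vec.dependent (f ` ?N)"
    proof (rule ccontr)
      assume "vec.independent (f ` ?N)"
      then have "card (f ` ?N) \<le> vec.dim (UNIV :: (complex^'k) set)"
        by (intro vec.independent_card_le_dim) auto
      then show False using True by (simp add: card_image card_cart_basis)
    qed
    then obtain u where u: "\<exists>v\<in>f ` ?N. u v \<noteq> 0" "(\<Sum>v\<in>f ` ?N. u v *s v) = 0"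
      by (subst (asm) vec.dependent_finite) auto
    then obtain n where n: "n \<in> ?N" "u (f n) \<noteq> 0" by auto
    define p where "p = (\<Sum>i\<in>?N. monom (u (f i)) i)"
    have "coeff p n = u (f n)" using n by (simp add: p_def coeff_sum)
    then have "p \<noteq> 0" using n by auto
    moreover have "poly_apply A p x = 0"
      using u(2) unfolding sum.reindex[OF True] o_def
      by (simp add: p_def poly_apply_sum poly_apply_monom f_def)
    ultimately show thesis by (rule that)
  qed
qed

definition shift_list :: "complex^'k^'k \<Rightarrow> complex list \<Rightarrow> complex^'k \<Rightarrow> complex^'k" where
  "shift_list A cs x = foldr (\<lambda>c v. A *v v - c *s v) cs x"

lemma shift_list_simps [simp]:
  "shift_list A [] x = x"
  "shift_list A (c # cs) x = A *v shift_list A cs x - c *s shift_list A cs x"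
  by (auto simp: shift_list_def)

lemma shift_list_commute:
  "shift_list A cs (A *v x - c *s x) = A *v shift_list A cs x - c *s shift_list A cs x"
proof (induction cs)
  case (Cons d cs)
  show ?case
    unfolding shift_list_simps Cons
    by (simp add: vec.diff vec.scale vector_smult_assoc algebra_simps vector_ssub_ldistrib)
qed simp

text \<open>The annihilating polynomial splits into linear factors over the complex numbers.\<close>

lemma annihilating_shifts:
  fixes A :: "complex^'k^'k"
  obtains cs where "shift_list A cs x = 0"
proof -
  obtain p where p: "p \<noteq> 0" "poly_apply A p x = 0" by (rule annihilating_poly)
  obtain root where r: "smult (lead_coeff p) (\<Prod>i<degree p. [:-root i, 1:]) = p"
    by (rule complex_poly_decompose')
  have eq: "poly_apply A (\<Prod>i<n. [:-root i, 1:]) x = shift_list A (rev (map root [0..<n])) x" for n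
  proof (induction n)
    case (Suc n)
    have "(\<Prod>i<Suc n. [:-root i, 1:]) = [:-root n, 1:] * (\<Prod>i<n. [:-root i, 1:])"
      by (simp only: prod.lessThan_Suc mult.commute)
    then show ?case by (simp only: poly_apply_linear_factor Suc) simp
  qed (simp add: one_pCons)
  have "lead_coeff p *s poly_apply A (\<Prod>i<degree p. [:-root i, 1:]) x = 0"
    using p(2) by (subst (asm) r[symmetric]) (simp only: poly_apply_smult)
  then have "poly_apply A (\<Prod>i<degree p. [:-root i, 1:]) x = 0" using p(1) by simp
  then show thesis using that eq by metis
qed

lemma eigenvector_iff_det:
  fixes A :: "complex^'k^'k"
  shows "(\<exists>v. v \<noteq> 0 \<and> A *v v = c *s v) \<longleftrightarrow> det (A - mat c) = 0"
proof -
  have "(A - mat c) *v v = A *v v - c *s v" for v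
    by (simp add: vec_eq_iff matrix_vector_mult_def mat_def left_diff_distrib sum_subtractf if_distrib[of "\<lambda>a. a * _"] cong: if_cong)
  then have "(\<exists>v. v \<noteq> 0 \<and> A *v v = c *s v) \<longleftrightarrow> \<not> (\<forall>v. (A - mat c) *v v = 0 \<longrightarrow> v = 0)"
    by auto
  also have "\<dots> \<longleftrightarrow> det (A - mat c) = 0"
    using matrix_left_invertible_ker[of "A - mat c"] invertible_left_inverse[of "A - mat c"] invertible_det_nz[of "A - mat c"]
    by blast
  finally show ?thesis .
qed

lemma eigenvalue_transpose:
  fixes A :: "complex^'k^'k"
  assumes "w \<noteq> 0" "transpose A *v w = c *s w"
  obtains v where "v \<noteq> 0" "A *v v = c *s v"
proof -
  have "det (transpose A - mat c) = 0" using assms eigenvector_iff_det by blast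
  moreover have "transpose A - mat c = transpose (A - mat c)"
    by (auto simp: vec_eq_iff transpose_def mat_def)
  ultimately have "det (A - mat c) = 0" by (simp add: det_transpose)
  then show thesis using that eigenvector_iff_det by blast
qed

text \<open>Let \<open>y = (A - c) x\<close> and \<open>P y = 0\<close>. Then \<open>P A x = c P x\<close>, and since \<open>P A = - A\<^sup>T P\<close> the vector \<open>P x\<close> is
  zero or an eigenvector of \<open>A\<^sup>T\<close> for \<open>- c\<close>. In the second case \<open>c\<close> has positive real part and is not an
  eigenvalue of \<open>A\<close>, so the factor \<open>A - c\<close> can be dropped. By induction on the number of factors
  of a polynomial that annihilates \<open>x\<close>, every \<open>P x\<close> vanishes.\<close>

lemma hurwitz_intertwiner_zero:
  assumes hw: "hurwitz A" and P: "transpose A ** P + P ** A = 0"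
  shows "P = 0"
proof -
  let ?A = "cmatrix A" and ?P = "cmatrix P"
  have ev: "Re c < 0" if "v \<noteq> 0" "?A *v v = c *s v" for c v
    using hw that unfolding hurwitz_def cmatrix_def by blast
  have "P ** A = - (transpose A ** P)" using P by (simp add: add_eq_0_iff2)
  from arg_cong[OF this, of cmatrix] have PA: "?P ** ?A = - (transpose ?A ** ?P)"
    by (simp add: cmatrix_mult cmatrix_uminus cmatrix_transpose)
  have PAv: "?P *v (?A *v x) = - (transpose ?A *v (?P *v x))" for x
    unfolding matrix_vector_mul_assoc PA
    by (simp add: vec_eq_iff matrix_vector_mult_def sum_negf)
  have "?P *v x = 0" if "shift_list ?A cs x = 0" for cs x
    using that
  proof (induction cs arbitrary: x)
    case (Cons c cs)
    have "shift_list ?A cs (?A *v x - c *s x) = 0" using Cons.prems by (simp add: shift_list_commute)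
    then have "?P *v (?A *v x - c *s x) = 0" by (rule Cons.IH)
    then have "- (transpose ?A *v (?P *v x)) = c *s (?P *v x)"
      by (simp add: vec.diff vec.scale flip: PAv)
    then have tA: "transpose ?A *v (?P *v x) = (- c) *s (?P *v x)"
      by (metis minus_minus vector_smult_lneg)
    show ?case
    proof (rule ccontr)
      assume "?P *v x \<noteq> 0"
      then obtain v where "v \<noteq> 0" "?A *v v = (- c) *s v"
        using eigenvalue_transpose[OF _ tA] by blast
      then have "Re (- c) < 0" by (rule ev)
      then have "shift_list ?A cs x = 0"
        using Cons.prems ev[of "shift_list ?A cs x" c] by auto
      then show False using Cons.IH \<open>?P *v x \<noteq> 0\<close> by blast
    qed
  qed simp
  then have "?P *v x = 0" for x using annihilating_shifts[of ?A x] by metis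
  then have "?P = 0" by (simp add: matrix_eq)
  then show ?thesis by (simp add: cmatrix_eq_0)
qed

text \<open>The matrix of \<open>X \<mapsto> A\<^sup>T X + X A\<close> with respect to the entries of \<open>X\<close>.\<close>

definition lyap_matrix :: "real^'k^'k \<Rightarrow> real^('k \<times> 'k)^('k \<times> 'k)" where
  "lyap_matrix A = (\<chi> p q. (if snd p = snd q then A $ fst q $ fst p else 0)
                          + (if fst p = fst q then A $ snd q $ snd p else 0))"

definition vectorize :: "real^'k^'k \<Rightarrow> real^('k \<times> 'k)" where
  "vectorize X = (\<chi> p. X $ fst p $ snd p)"

definition unvectorize :: "real^('k \<times> 'k) \<Rightarrow> real^'k^'k" where
  "unvectorize v = (\<chi> i j. v $ (i, j))"

lemma vectorize_inverse [simp]: "unvectorize (vectorize X) = X" "vectorize (unvectorize v) = v"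
  by (auto simp: unvectorize_def vectorize_def vec_eq_iff)

lemma vectorize_eq_0: "vectorize X = 0 \<longleftrightarrow> X = 0"
  by (auto simp: vectorize_def vec_eq_iff)

lemma unvectorize_eq_0: "unvectorize v = 0 \<longleftrightarrow> v = 0"
  by (auto simp: unvectorize_def vec_eq_iff)

lemma lyap_matrix_vectorize:
  "lyap_matrix A *v vectorize X = vectorize (transpose A ** X + X ** A)"
proof -
  have "(\<Sum>q\<in>UNIV. ((if snd p = snd q then A $ fst q $ fst p else 0)
           + (if fst p = fst q then A $ snd q $ snd p else 0)) * X $ fst q $ snd q)
      = (\<Sum>k\<in>UNIV. A $ k $ fst p * X $ k $ snd p) + (\<Sum>k\<in>UNIV. X $ fst p $ k * A $ k $ snd p)" for p
  proof -
    have "(\<Sum>q\<in>UNIV. ((if snd p = snd q then A $ fst q $ fst p else 0)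
           + (if fst p = fst q then A $ snd q $ snd p else 0)) * X $ fst q $ snd q)
      = (\<Sum>a\<in>UNIV. \<Sum>b\<in>UNIV. (if snd p = b then A $ a $ fst p * X $ a $ b else 0)
           + (if fst p = a then A $ b $ snd p * X $ a $ b else 0))"
      unfolding sum_UNIV_pair by (intro sum.cong refl) (simp add: distrib_right)
    also have "\<dots> = (\<Sum>a\<in>UNIV. \<Sum>b\<in>UNIV. (if snd p = b then A $ a $ fst p * X $ a $ b else 0))
       + (\<Sum>b\<in>UNIV. \<Sum>a\<in>UNIV. (if fst p = a then A $ b $ snd p * X $ a $ b else 0))"
      unfolding sum.distrib by (simp only: sum.swap[of "\<lambda>b a. (if fst p = a then A $ b $ snd p * X $ a $ b else 0)"])
    finally show ?thesis by (simp add: mult.commute)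
  qed
  then show ?thesis
    by (simp add: lyap_matrix_def vectorize_def matrix_vector_mult_def matrix_matrix_mult_def transpose_def vec_eq_iff)
qed

lemma lyap_matrix_det_nz:
  assumes "hurwitz A" shows "det (lyap_matrix A) \<noteq> 0"
proof -
  have "v = 0" if "lyap_matrix A *v v = 0" for v
  proof -
    have "vectorize (transpose A ** unvectorize v + unvectorize v ** A) = 0"
      using that lyap_matrix_vectorize[of A "unvectorize v"] by simp
    then have "transpose A ** unvectorize v + unvectorize v ** A = 0"
      by (simp only: vectorize_eq_0)
    then have "unvectorize v = 0" using assms by (rule hurwitz_intertwiner_zero[rotated])
    then show "v = 0" by (simp only: unvectorize_eq_0)
  qed
  then show ?thesis
    using matrix_left_invertible_ker[of "lyap_matrix A"] invertible_left_inverse[of "lyap_matrix A"] invertible_det_nz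
    by blast
qed

definition lyap_cramer :: "real^'k^'k \<Rightarrow> real^'k^'k \<Rightarrow> real^'k^'k" where
  "lyap_cramer A Q = (\<chi> k l. det (\<chi> p q. if q = (k, l) then - Q $ fst p $ snd p else lyap_matrix A $ p $ q)
      / det (lyap_matrix A))"

lemma lyapunov_iff_cramer:
  assumes "hurwitz A"
  shows "transpose A ** X + X ** A = - Q \<longleftrightarrow> X = lyap_cramer A Q"
proof -
  have "transpose A ** X + X ** A = - Q \<longleftrightarrow> lyap_matrix A *v vectorize X = vectorize (- Q)"
    unfolding lyap_matrix_vectorize by (metis vectorize_inverse(1))
  also have "\<dots> \<longleftrightarrow> vectorize X = vectorize (lyap_cramer A Q)"
    unfolding cramer[OF lyap_matrix_det_nz[OF assms]]
    by (rule arg_cong[where f = "(=) (vectorize X)"])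
      (auto simp: lyap_cramer_def vectorize_def vec_eq_iff intro!: arg_cong[where f = det] arg_cong2[where f = "(/)"])
  also have "\<dots> \<longleftrightarrow> X = lyap_cramer A Q" by (metis vectorize_inverse(1))
  finally show ?thesis .
qed

text \<open>The eigenvalues of \<open>(1 - t) A - t\<close> are \<open>(1 - t) c - t\<close> for the eigenvalues \<open>c\<close> of \<open>A\<close>.\<close>

lemma hurwitz_segment:
  assumes A: "hurwitz A" and t: "0 \<le> t" "t \<le> 1"
  shows "hurwitz ((1 - t) *\<^sub>R A - mat t)"
  unfolding hurwitz_def
proof (intro allI impI, elim conjE)
  fix c v assume v: "v \<noteq> 0" and ev: "(\<chi> i j. complex_of_real (((1 - t) *\<^sub>R A - mat t) $ i $ j)) *v v = c *s v"
  have "(\<chi> i j. complex_of_real (((1 - t) *\<^sub>R A - mat t) $ i $ j)) *v v =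
     of_real (1 - t) *s ((\<chi> i j. complex_of_real (A $ i $ j)) *v v) - of_real t *s v"
    unfolding vec_eq_iff
  proof
    fix i
    have "((\<chi> i j. complex_of_real (((1 - t) *\<^sub>R A - mat t) $ i $ j)) *v v) $ i
       = (\<Sum>j\<in>UNIV. of_real (1 - t) * (complex_of_real (A $ i $ j) * v $ j) - (if j = i then of_real t * v $ j else 0))"
      unfolding matrix_vector_mult_def mat_def vec_lambda_beta
      by (intro sum.cong refl) (auto simp: algebra_simps)
    also have "\<dots> = of_real (1 - t) * (\<Sum>j\<in>UNIV. complex_of_real (A $ i $ j) * v $ j) - of_real t * v $ i"
      unfolding sum_subtractf sum_distrib_left[symmetric] by simp
    finally show "((\<chi> i j. complex_of_real (((1 - t) *\<^sub>R A - mat t) $ i $ j)) *v v) $ i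
       = (of_real (1 - t) *s ((\<chi> i j. complex_of_real (A $ i $ j)) *v v) - of_real t *s v) $ i"
      by (simp add: matrix_vector_mult_def del: of_real_diff)
  qed
  then have e: "of_real (1 - t) *s ((\<chi> i j. complex_of_real (A $ i $ j)) *v v) = (c + of_real t) *s v"
    using ev unfolding vector_sadd_rdistrib by (metis diff_eq_eq)
  show "Re c < 0"
  proof (cases "t = 1")
    case True
    then have "(c + 1) *s v = 0" using e by simp
    then have "c + 1 = 0" using v by (simp only: vector_mul_eq_0 simp_thms)
    then have "c = -1" by (simp add: add_eq_0_iff2)
    then show ?thesis by simp
  next
    case False
    then have t1: "t < 1" using t by simp
    have "(\<chi> i j. complex_of_real (A $ i $ j)) *v v = ((c + of_real t) / of_real (1 - t)) *s v"
    proof -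
      define w where "w = (\<chi> i j. complex_of_real (A $ i $ j)) *v v"
      have nz: "complex_of_real (1 - t) \<noteq> 0" using t1 by simp
      have "(1 / of_real (1 - t)) *s (of_real (1 - t) *s w) = (1 / of_real (1 - t)) *s ((c + of_real t) *s v)"
        using e unfolding w_def by (rule arg_cong)
      then have "w = ((c + of_real t) / of_real (1 - t)) *s v"
        unfolding vector_smult_assoc using nz by (simp del: of_real_diff)
      then show ?thesis unfolding w_def .
    qed
    then have "Re ((c + of_real t) / of_real (1 - t)) < 0"
      using A v unfolding hurwitz_def by blast
    then have "Re c + t < 0" using t1 by (simp add: Re_divide_of_real divide_less_0_iff del: of_real_diff)
    then show ?thesis using t by simp
  qed
qed

text \<open>A point where the nonnegative form \<open>l \<parallel>y\<parallel>\<^sup>2 - \<langle>y, S y\<rangle>\<close> vanishes is a minimum of it, so its derivative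
  vanishes there in all directions of \<open>V\<close>; by invariance \<open>S x - l x\<close> is one of these directions.\<close>

lemma form_zero_kernel:
  fixes l :: real
  assumes V: "subspace V" "\<And>y. y \<in> V \<Longrightarrow> S *v y \<in> V" and sym: "transpose S = (S :: real^'n^'n)"
    and le: "\<And>y. y \<in> V \<Longrightarrow> y \<bullet> (S *v y) \<le> l * (y \<bullet> y)" and x: "x \<in> V" "x \<bullet> (S *v x) = l * (x \<bullet> x)"
  shows "S *v x = l *\<^sub>R x"
proof -
  define y where "y = S *v x - l *\<^sub>R x"
  have y: "y \<in> V" using V x by (simp add: y_def subspace_diff subspace_scale)
  have xSy: "x \<bullet> (S *v y) = y \<bullet> (S *v x)" 
    unfolding inner_matrix_transpose[of x] sym by (rule inner_commute)
  have q: "0 \<le> - 2 * s * (y \<bullet> y) + s\<^sup>2 * (l * (y \<bullet> y) - y \<bullet> (S *v y))" for s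
  proof -
    have "0 \<le> l * ((x + s *\<^sub>R y) \<bullet> (x + s *\<^sub>R y)) - (x + s *\<^sub>R y) \<bullet> (S *v (x + s *\<^sub>R y))"
      using le[of "x + s *\<^sub>R y"] V(1) x y by (simp add: subspace_add subspace_scale)
    also have "\<dots> = (l * (x \<bullet> x) - x \<bullet> (S *v x)) - 2 * s * (y \<bullet> (S *v x) - l * (x \<bullet> y)) + s\<^sup>2 * (l * (y \<bullet> y) - y \<bullet> (S *v y))"
      using xSy by (simp add: algebra_simps inner_add_left inner_add_right matrix_vector_mult_scaleR power2_eq_square inner_commute)
    also have "y \<bullet> (S *v x) - l * (x \<bullet> y) = y \<bullet> y"
      by (simp add: y_def inner_diff_right inner_diff_left inner_commute algebra_simps)
    finally show ?thesis using x by simp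
  qed
  have "y \<bullet> y = 0"
  proof (rule ccontr)
    assume "y \<bullet> y \<noteq> 0"
    then have yy: "y \<bullet> y > 0" by simp
    \<comment> \<open>The step \<open>k *\<^sub>R y\<close> from \<open>x\<close> makes the form negative.\<close>
    define a k where "a = l * (y \<bullet> y) - y \<bullet> (S *v y)" and "k = (y \<bullet> y) / (1 + a)"
    have a: "a \<ge> 0" using le[OF y] by (simp add: a_def)
    have k: "k > 0" "y \<bullet> y = k * (1 + a)" using yy a by (simp_all add: k_def)
    have "0 \<le> - 2 * k * (y \<bullet> y) + k\<^sup>2 * a" using q unfolding a_def .
    also have "\<dots> = - (k\<^sup>2 * (2 + a))" unfolding k(2) by (simp add: power2_eq_square algebra_simps)
    also have "\<dots> < 0" using k a by simp
    finally show False by simp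
  qed
  then show ?thesis by (simp add: y_def)
qed

lemma psd_kernel:
  fixes X :: "real^'k^'k"
  assumes sym: "transpose X = X" and psd: "\<And>y. y \<bullet> (X *v y) \<ge> 0" and x: "x \<bullet> (X *v x) = 0"
  shows "X *v x = 0"
proof -
  have neg: "(- X) *v y = - (X *v y)" for y
    by (simp add: vec_eq_iff matrix_vector_mult_def sum_negf)
  have "(- X) *v x = 0 *\<^sub>R x"
    by (rule form_zero_kernel[of UNIV]) (simp_all add: neg psd x transpose_uminus sym)
  then show ?thesis by (simp add: neg)
qed

text \<open>Follow the solution \<open>X t\<close> for \<open>B t = (1 - t) A - t\<close>. At \<open>t = 1\<close> it is \<open>Q / 2\<close>. It is never singular,
  because \<open>X t x = 0\<close> gives \<open>\<langle>x, Q x\<rangle> = 0\<close>. If some \<open>X t\<close> fails to be positive definite,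
  take the largest such \<open>t\<close>: there \<open>X t\<close> is positive semidefinite, as a limit of positive definite
  matrices, but its form vanishes at some unit vector, so it is singular.\<close>

lemma lyapunov_pos_def:
  fixes A :: "real^'k^'k"
  assumes A: "hurwitz A" and Q: "pos_def Q"
  shows "pos_def (lyap_cramer A Q)"
proof -
  define B where "B t = (1 - t) *\<^sub>R A - mat t" for t :: real
  define X where "X t = lyap_cramer (B t) Q" for t
  have hB: "hurwitz (B t)" if "t \<in> {0..1}" for t using hurwitz_segment[OF A] that by (simp add: B_def)
  have eq: "transpose (B t) ** X t + X t ** B t = - Q" if "t \<in> {0..1}" for t
    using lyapunov_iff_cramer[OF hB[OF that]] X_def by blast
  have Qs: "transpose Q = Q" and Qp: "\<And>x. x \<noteq> 0 \<Longrightarrow> x \<bullet> (Q *v x) > 0" using Q by (auto simp: pos_def_def)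
  have sym: "transpose (X t) = X t" if t: "t \<in> {0..1}" for t
  proof -
    have "transpose (B t) ** transpose (X t) + transpose (X t) ** B t = transpose (transpose (B t) ** X t + X t ** B t)"
      by (simp add: transpose_add matrix_transpose_mul)
    also have "\<dots> = - Q" using eq[OF t] Qs by (simp add: transpose_uminus)
    finally show ?thesis using lyapunov_iff_cramer[OF hB[OF t]] X_def by metis
  qed
  have nonsing: "x = 0" if t: "t \<in> {0..1}" and x: "X t *v x = 0" for t x
  proof (rule ccontr)
    assume "x \<noteq> 0"
    have "x \<bullet> ((transpose (B t) ** X t + X t ** B t) *v x) = 0"
    proof -
      have "x \<bullet> ((X t ** B t) *v x) = (X t *v x) \<bullet> (B t *v x)"
        using sym[OF t] by (simp add: inner_matrix_transpose flip: matrix_vector_mul_assoc)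
      then show ?thesis using x
        by (simp add: matrix_vector_mult_add_rdistrib inner_add_right flip: matrix_vector_mul_assoc)
    qed
    then have "x \<bullet> (Q *v x) = 0"
      unfolding eq[OF t] by (simp add: matrix_vector_mult_def inner_vec_def sum_negf)
    then show False using Qp[OF \<open>x \<noteq> 0\<close>] by simp
  qed
  have contX: "continuous_on {0..1} (\<lambda>t. X t $ i $ j)" for i j
  proof -
    have "det (lyap_matrix (B t)) \<noteq> 0" if "t \<in> {0..1}" for t using lyap_matrix_det_nz hB that by blast
    moreover have cl: "continuous_on {0..1} (\<lambda>t. lyap_matrix (B t) $ p $ q)" for p q
      unfolding lyap_matrix_def B_def mat_def
      by (cases "snd p = snd q"; cases "fst p = fst q"; cases "fst q = fst p"; cases "snd q = snd p")
        (auto intro!: continuous_intros)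
    moreover have "continuous_on {0..1} (\<lambda>t. (if q = (i, j) then - Q $ fst p $ snd p else lyap_matrix (B t) $ p $ q))" for p q
      using cl by (cases "q = (i, j)") auto
    ultimately show ?thesis
      unfolding X_def lyap_cramer_def vec_lambda_beta det_def
      by (intro continuous_on_divide continuous_on_sum continuous_on_mult continuous_on_prod continuous_on_const) auto
  qed
  define qf where "qf p = snd p \<bullet> (X (fst p) *v snd p)" for p :: "real \<times> (real^'k)"
  have contq: "continuous_on ({0..1} \<times> UNIV) qf"
  proof -
    have "continuous_on ({0..1} \<times> UNIV) (\<lambda>p :: real \<times> (real^'k). X (fst p) $ i $ j)" for i j
      by (rule continuous_on_compose2[OF contX]) (auto intro!: continuous_intros)
    then show ?thesis
      unfolding qf_def inner_vec_def matrix_vector_mult_def vec_lambda_beta inner_real_def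
      by (intro continuous_on_sum continuous_on_mult) (auto intro!: continuous_intros)
  qed
  \<comment> \<open>The pairs of a parameter and a unit vector that violate definiteness.\<close>
  define S where "S = {p \<in> {0..1} \<times> sphere 0 1. qf p \<le> 0}"
  have compS: "compact S"
  proof -
    have "closed S"
      unfolding S_def by (intro continuous_on_closed_Collect_le continuous_on_subset[OF contq])
        (auto intro!: closed_Times)
    moreover have "S = ({0..1} \<times> sphere 0 1) \<inter> S" by (auto simp: S_def)
    ultimately show ?thesis by (metis compact_Int_closed compact_Icc compact_Times compact_sphere)
  qed
  have S_empty: "S = {}"
  proof (rule ccontr)
    assume "S \<noteq> {}"
    then have "fst ` S \<noteq> {}" "compact (fst ` S)"
      using compact_continuous_image[OF continuous_on_fst[OF continuous_on_id] compS] by auto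
    then obtain t where tS: "t \<in> fst ` S" and tmax: "\<And>s. s \<in> fst ` S \<Longrightarrow> s \<le> t"
      using compact_attains_sup[of "fst ` S"] by blast
    then obtain x where x: "norm x = 1" "qf (t, x) \<le> 0" and t: "t \<in> {0..1}" by (auto simp: S_def)
    have "t \<noteq> 1"
    proof
      assume "t = 1"
      have mm: "(- mat 1) ** M = - M" "M ** (- mat 1) = - M" "transpose (- mat 1) = (- mat 1 :: real^'k^'k)" for M :: "real^'k^'k"
        by (simp_all add: vec_eq_iff matrix_matrix_mult_def mat_def transpose_def sum_negf eq_commute if_distrib[of "\<lambda>a. a * _"] if_distrib[of "\<lambda>a. _ * a"] cong: if_cong)
      have "- X 1 + - X 1 = - Q" using eq[of 1] mm by (simp add: B_def)
      then have "Q = 2 *\<^sub>R X 1" by (metis add_uminus_conv_diff minus_add_distrib neg_equal_iff_equal scaleR_2)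
      then have "x \<bullet> (Q *v x) = 2 * qf (1, x)" by (simp add: qf_def flip: scaleR_matrix_vector_assoc)
      moreover have "x \<bullet> (Q *v x) > 0" using x by (intro Qp) auto
      ultimately show False using x \<open>t = 1\<close> by simp
    qed
    then have t1: "t < 1" using t by simp
    have psd: "y \<bullet> (X t *v y) \<ge> 0" for y
    proof (cases "y = 0")
      case False
      define z where "z = (1 / norm y) *\<^sub>R y"
      have z: "norm z = 1" "y = norm y *\<^sub>R z" using False by (auto simp: z_def)
      have "continuous_on {0..1} (\<lambda>s. qf (s, z))"
        by (rule continuous_on_compose2[OF contq]) (auto intro!: continuous_intros)
      then have "closed {s \<in> {0..1}. 0 \<le> qf (s, z)}"
        by (rule continuous_on_closed_Collect_le[OF continuous_on_const _ closed_atLeastAtMost])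
      moreover have "{t<..1} \<subseteq> {s \<in> {0..1}. 0 \<le> qf (s, z)}"
      proof
        fix s assume s: "s \<in> {t<..1}"
        then have "(s, z) \<notin> S" using tmax[of s] by (force simp: image_iff)
        then show "s \<in> {s \<in> {0..1}. 0 \<le> qf (s, z)}" using s t z by (auto simp: S_def)
      qed
      ultimately have "closure {t<..1} \<subseteq> {s \<in> {0..1}. 0 \<le> qf (s, z)}" by (rule closure_minimal[rotated])
      moreover have "t \<in> closure {t<..1}" using t1 by simp
      ultimately have "0 \<le> qf (t, z)" by blast
      moreover have "y \<bullet> (X t *v y) = (norm y)\<^sup>2 * qf (t, z)"
        by (subst (1 2) z(2)) (simp add: qf_def matrix_vector_mult_scaleR power2_eq_square)
      ultimately show ?thesis by simp
    qed simp
    have "x \<bullet> (X t *v x) = 0" using psd[of x] x by (simp add: qf_def)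
    then have "X t *v x = 0" using psd_kernel[OF sym[OF t] psd] by blast
    then show False using nonsing[OF t] x by fastforce
  qed
  have X0: "X 0 = lyap_cramer A Q" by (simp add: X_def B_def)
  have "y \<bullet> (X 0 *v y) > 0" if "y \<noteq> 0" for y
  proof -
    define z where "z = (1 / norm y) *\<^sub>R y"
    have z: "norm z = 1" "y = norm y *\<^sub>R z" using that by (auto simp: z_def)
    have "qf (0, z) > 0" using S_empty z by (force simp: S_def)
    moreover have "y \<bullet> (X 0 *v y) = (norm y)\<^sup>2 * qf (0, z)"
      by (subst (1 2) z(2)) (simp add: qf_def matrix_vector_mult_scaleR power2_eq_square)
    ultimately show ?thesis using that by simp
  qed
  then show ?thesis using sym[of 0] unfolding pos_def_def X0[symmetric] by auto
qed

theorem lyap_sol_eq_cramer: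
  assumes A: "hurwitz A" and Q: "pos_def Q"
  shows "lyap_sol A Q = lyap_cramer A Q"
  unfolding lyap_sol_def
  by (rule the_equality) (use lyapunov_pos_def[OF A Q] lyapunov_iff_cramer[OF A] in auto)

section \<open>The spectral norm\<close>

lemma norm_matrix_vector_le_norm: "norm (M *v x) \<le> norm M * norm x" for M :: "real^'c^'r"
proof -
  have "norm (M *v x) = L2_set (\<lambda>i. \<bar>M $ i \<bullet> x\<bar>) UNIV"
    by (simp add: norm_vec_def matrix_vector_mul_component)
  also have "\<dots> \<le> L2_set (\<lambda>i. norm (M $ i) * norm x) UNIV"
    by (intro L2_set_mono) (auto simp: Cauchy_Schwarz_ineq2)
  also have "\<dots> = norm M * norm x"
    by (simp add: norm_vec_def[of M] L2_set_left_distrib)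
  finally show ?thesis .
qed

lemma norm_matrix_vector_le: "norm (M *v x) \<le> spec_norm M * norm x" for M :: "real^'c^'r"
  unfolding spec_norm_def by (rule onorm) (rule matrix_vector_mul_bounded_linear)

lemma spec_norm_le: "(\<And>x. norm (M *v x) \<le> b * norm x) \<Longrightarrow> spec_norm M \<le> b" for M :: "real^'c^'r"
  unfolding spec_norm_def by (rule onorm_le)

lemma spec_norm_nonneg: "spec_norm M \<ge> 0" for M :: "real^'c^'r"
  unfolding spec_norm_def by (rule onorm_pos_le) (rule matrix_vector_mul_bounded_linear)

lemma spec_norm_le_norm: "spec_norm M \<le> norm M" for M :: "real^'c^'r"
  by (rule spec_norm_le) (rule norm_matrix_vector_le_norm)

lemma spec_norm_triangle: "spec_norm (M + N) \<le> spec_norm M + spec_norm N" for M N :: "real^'c^'r"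
proof (rule spec_norm_le)
  fix x
  have "norm ((M + N) *v x) \<le> norm (M *v x) + norm (N *v x)"
    by (simp add: matrix_vector_mult_add_rdistrib norm_triangle_ineq)
  also have "\<dots> \<le> (spec_norm M + spec_norm N) * norm x"
    using norm_matrix_vector_le[of M x] norm_matrix_vector_le[of N x] by (simp add: distrib_right)
  finally show "norm ((M + N) *v x) \<le> (spec_norm M + spec_norm N) * norm x" .
qed

lemma spec_norm_scaleR: "spec_norm (c *\<^sub>R M) = \<bar>c\<bar> * spec_norm M" for M :: "real^'c^'r"
  unfolding spec_norm_def scaleR_matrix_vector_assoc[symmetric]
  by (rule onorm_scaleR) (rule matrix_vector_mul_bounded_linear)

lemma spec_norm_diff_le: "spec_norm M \<le> spec_norm N + norm (M - N)" for M N :: "real^'c^'r"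
  using spec_norm_triangle[of N "M - N"] spec_norm_le_norm[of "M - N"] by simp

lemma spec_norm_pos: "spec_norm M > 0" if nz: "M \<noteq> 0" for M :: "real^'c^'r"
proof -
  obtain x where x: "M *v x \<noteq> 0" using nz matrix_eq[of M 0] by auto
  then have "0 < spec_norm M * norm x"
    using norm_matrix_vector_le[of M x] by (simp add: less_le_trans[of 0 "norm (M *v x)"])
  then show ?thesis using spec_norm_nonneg[of M] by (simp add: zero_less_mult_iff)
qed

section \<open>Orthonormal eigenbases and the nuclear norm\<close>

definition orthonormal_basis :: "('n::finite \<Rightarrow> real^'n) \<Rightarrow> bool" where
  "orthonormal_basis q \<longleftrightarrow> (\<forall>i j. q i \<bullet> q j = (if i = j then 1 else 0))"

lemma orthonormal_norm: "orthonormal_basis q \<Longrightarrow> norm (q i) = 1"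
  by (simp add: orthonormal_basis_def norm_eq_1)

lemma parseval:
  fixes q :: "'n::finite \<Rightarrow> real^'n"
  assumes "orthonormal_basis q"
  shows "x \<bullet> y = (\<Sum>i\<in>UNIV. (q i \<bullet> x) * (q i \<bullet> y))"
proof -
  define M :: "real^'n^'n" where "M = (\<chi> i. q i)"
  have Mx: "M *v x = (\<chi> i. q i \<bullet> x)" for x by (simp add: M_def vec_eq_iff matrix_vector_mul_component)
  have "M ** transpose M = mat 1"
    using assms by (simp add: vec_eq_iff matrix_matrix_mult_def transpose_def M_def mat_def orthonormal_basis_def inner_vec_def)
  then have "transpose M ** M = mat 1" using matrix_left_right_inverse by blast
  then have "x \<bullet> y = x \<bullet> (transpose M *v (M *v y))" by (simp add: matrix_vector_mul_assoc)
  also have "\<dots> = (M *v x) \<bullet> (M *v y)" by (simp add: inner_matrix_transpose)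
  finally show ?thesis by (simp add: Mx inner_vec_def)
qed

lemma orthonormal_expansion:
  assumes q: "orthonormal_basis q"
  shows "x = (\<Sum>i\<in>UNIV. (q i \<bullet> x) *\<^sub>R q i)"
proof -
  have "y \<bullet> x = y \<bullet> (\<Sum>i\<in>UNIV. (q i \<bullet> x) *\<^sub>R q i)" for y
    by (subst parseval[OF q]) (simp add: inner_sum_right inner_commute mult.commute)
  then show ?thesis by (metis vector_eq_ldot)
qed

lemma inner_matrix_onb:
  fixes A B :: "real^'n^'r"
  assumes q: "orthonormal_basis q"
  shows "A \<bullet> B = (\<Sum>i\<in>UNIV. (A *v q i) \<bullet> (B *v q i))"
proof -
  have "A \<bullet> B = (\<Sum>r\<in>UNIV. \<Sum>i\<in>UNIV. (A $ r \<bullet> q i) * (B $ r \<bullet> q i))"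
    unfolding inner_vec_def[of A B] by (intro sum.cong refl) (subst parseval[OF q], simp add: inner_commute)
  also have "\<dots> = (\<Sum>i\<in>UNIV. \<Sum>r\<in>UNIV. (A $ r \<bullet> q i) * (B $ r \<bullet> q i))" by (rule sum.swap)
  finally show ?thesis by (simp add: inner_vec_def[of "_ *v _"] matrix_vector_mul_component)
qed

text \<open>A maximizer of the Rayleigh quotient on \<open>V\<close> is an eigenvector, and its orthogonal
  complement in \<open>V\<close> is again invariant.\<close>

lemma symmetric_eigenbasis_subspace:
  fixes S :: "real^'n^'n"
  assumes sym: "transpose S = S"
  shows "subspace V \<Longrightarrow> (\<And>y. y \<in> V \<Longrightarrow> S *v y \<in> V) \<Longrightarrow>
    \<exists>B. B \<subseteq> V \<and> pairwise orthogonal B \<and> (\<forall>b\<in>B. norm b = 1 \<and> (\<exists>c. S *v b = c *\<^sub>R b)) \<and> V \<subseteq> span B"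
proof (induction "dim V" arbitrary: V rule: less_induct)
  case less
  show ?case
  proof (cases "V \<subseteq> {0}")
    case True
    then show ?thesis by (intro exI[of _ "{}"]) auto
  next
    case False
    then obtain z where z: "z \<in> V" "z \<noteq> 0" by auto
    have "(1 / norm z) *\<^sub>R z \<in> V \<inter> sphere 0 1" using z less.prems(1) by (simp add: subspace_scale)
    moreover have "compact (V \<inter> sphere 0 1)" using less.prems(1) by (intro closed_Int_compact closed_subspace) auto
    moreover have "continuous_on (V \<inter> sphere 0 1) (\<lambda>y. y \<bullet> (S *v y))"
      by (intro continuous_intros)
    ultimately have "\<exists>x\<in>V \<inter> sphere 0 1. \<forall>y\<in>V \<inter> sphere 0 1. y \<bullet> (S *v y) \<le> x \<bullet> (S *v x)"
      by (intro continuous_attains_sup) auto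
    then obtain x where x: "x \<in> V" "norm x = 1" and mx: "\<And>y. y \<in> V \<Longrightarrow> norm y = 1 \<Longrightarrow> y \<bullet> (S *v y) \<le> x \<bullet> (S *v x)"
      by auto
    define l where "l = x \<bullet> (S *v x)"
    have le: "y \<bullet> (S *v y) \<le> l * (y \<bullet> y)" if y: "y \<in> V" for y
    proof (cases "y = 0")
      case False
      define w where "w = (1 / norm y) *\<^sub>R y"
      have w: "norm w = 1" "y = norm y *\<^sub>R w" "w \<in> V" using False y less.prems(1) by (auto simp: w_def subspace_scale)
      have "y \<bullet> (S *v y) = (norm y)\<^sup>2 * (w \<bullet> (S *v w))"
        by (subst (1 2) w(2)) (simp add: matrix_vector_mult_scaleR power2_eq_square)
      also have "\<dots> \<le> (norm y)\<^sup>2 * l" using mx[OF w(3,1)] by (simp add: l_def mult_left_mono)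
      finally show ?thesis by (simp add: power2_norm_eq_inner mult.commute)
    qed simp
    have xx: "x \<bullet> x = 1" using x(2) by (simp add: norm_eq_1)
    have Sx: "S *v x = l *\<^sub>R x"
      by (rule form_zero_kernel[OF less.prems sym le x(1)]) (simp_all add: l_def xx)
    define W where "W = {y \<in> V. x \<bullet> y = 0}"
    have W: "subspace W" using less.prems(1) by (auto simp: W_def subspace_def inner_add_right)
    have SW: "S *v y \<in> W" if "y \<in> W" for y
    proof -
      have "x \<bullet> (S *v y) = (S *v x) \<bullet> y" by (simp only: inner_matrix_transpose[of x] sym)
      then show ?thesis using that Sx less.prems(2) by (simp add: W_def)
    qed
    have "x \<notin> W" by (simp add: W_def xx)
    moreover have "W \<subseteq> V" by (auto simp: W_def)
    ultimately have "W \<subset> V" using x by blast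
    then have "dim W < dim V"
      using W less.prems(1) by (metis dim_psubset span_eq_iff)
    from less.hyps[OF this W SW] obtain B where B: "B \<subseteq> W" "pairwise orthogonal B"
      "\<forall>b\<in>B. norm b = 1 \<and> (\<exists>c. S *v b = c *\<^sub>R b)" "W \<subseteq> span B" by blast
    show ?thesis
    proof (intro exI[of _ "insert x B"] conjI)
      show "insert x B \<subseteq> V" using B(1) x by (auto simp: W_def)
      show "pairwise orthogonal (insert x B)"
        using B(1,2) by (auto simp: pairwise_insert W_def orthogonal_def inner_commute)
      show "\<forall>b\<in>insert x B. norm b = 1 \<and> (\<exists>c. S *v b = c *\<^sub>R b)" using B(3) x Sx by auto
      show "V \<subseteq> span (insert x B)"
      proof
        fix y assume y: "y \<in> V"
        have "y - (x \<bullet> y) *\<^sub>R x \<in> W"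
          using y x less.prems(1) xx by (simp add: W_def subspace_diff subspace_scale inner_diff_right)
        then have "y - (x \<bullet> y) *\<^sub>R x \<in> span B" using B(4) by blast
        then show "y \<in> span (insert x B)" unfolding span_insert by blast
      qed
    qed
  qed
qed

theorem symmetric_eigenbasis:
  fixes S :: "real^'n^'n"
  assumes sym: "transpose S = S"
  obtains q d where "orthonormal_basis q" "\<And>i. S *v q i = d i *\<^sub>R q i"
proof -
  obtain B where B: "pairwise orthogonal B" "\<And>b. b \<in> B \<Longrightarrow> norm b = 1" "\<And>b. b \<in> B \<Longrightarrow> \<exists>c. S *v b = c *\<^sub>R b"
    "UNIV \<subseteq> span B"
    using symmetric_eigenbasis_subspace[OF sym, of UNIV] by auto
  have "0 \<notin> B" using B(2) by force
  then have ind: "independent B" using B(1) pairwise_orthogonal_independent by blast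
  then have fin: "finite B" by (rule independent_imp_finite)
  have "card B = dim (UNIV :: (real^'n) set)" using ind B(4) by (metis basis_card_eq_dim top_greatest)
  then have "card B = CARD('n)" by simp
  then obtain q where q: "bij_betw q (UNIV :: 'n set) B" using fin by (metis finite_same_card_bij finite)
  have qB: "q i \<in> B" for i using q by (auto simp: bij_betw_def)
  have "q i \<bullet> q j = (if i = j then 1 else 0)" for i j
  proof (cases "i = j")
    case True then show ?thesis using B(2)[OF qB[of i]] by (simp add: norm_eq_1)
  next
    case False
    then have "q i \<noteq> q j" using q by (auto simp: bij_betw_def inj_on_def)
    then show ?thesis using B(1) qB False by (auto simp: pairwise_def orthogonal_def)
  qed
  then have "orthonormal_basis q" by (simp add: orthonormal_basis_def)
  moreover obtain d where "\<And>i. S *v q i = d i *\<^sub>R q i" using B(3)[OF qB] by metis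
  ultimately show thesis by (rule that)
qed

text \<open>An orthonormal basis of right singular vectors; the singular values, with multiplicity, are the
  norms of the images.\<close>

definition right_singular_basis :: "real^'n^'r \<Rightarrow> ('n::finite \<Rightarrow> real^'n) \<Rightarrow> bool" where
  "right_singular_basis Z q \<longleftrightarrow> orthonormal_basis q \<and>
     (\<forall>i. (transpose Z ** Z) *v q i = (norm (Z *v q i))\<^sup>2 *\<^sub>R q i)"

lemma inner_gram: "x \<bullet> ((transpose Z ** Z) *v y) = (Z *v x) \<bullet> (Z *v y)" for Z :: "real^'n^'r"
  by (simp add: inner_matrix_transpose flip: matrix_vector_mul_assoc)

lemma right_singular_basis_exists:
  fixes Z :: "real^'n^'r"
  obtains q where "right_singular_basis Z q"
proof -
  have "transpose (transpose Z ** Z) = transpose Z ** Z" by (simp add: matrix_transpose_mul)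
  then obtain q d where q: "orthonormal_basis q" and d: "\<And>i. (transpose Z ** Z) *v q i = d i *\<^sub>R q i"
    by (rule symmetric_eigenbasis) blast
  have "d i = (norm (Z *v q i))\<^sup>2" for i
  proof -
    have "q i \<bullet> q i = 1" using q by (simp add: orthonormal_basis_def)
    then have "d i = q i \<bullet> ((transpose Z ** Z) *v q i)" by (simp add: d)
    then show ?thesis by (simp add: inner_gram power2_norm_eq_inner)
  qed
  then show thesis using that q d unfolding right_singular_basis_def by metis
qed

lemma singular_images_orthogonal:
  assumes q: "right_singular_basis Z q"
  shows "(Z *v q i) \<bullet> (Z *v q j) = (if i = j then (norm (Z *v q i))\<^sup>2 else 0)"
proof -
  have "(Z *v q i) \<bullet> (Z *v q j) = q i \<bullet> ((norm (Z *v q j))\<^sup>2 *\<^sub>R q j)"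
    using q unfolding right_singular_basis_def by (metis inner_gram)
  then show ?thesis using q by (simp add: right_singular_basis_def orthonormal_basis_def)
qed

text \<open>An eigenvector of the Gram matrix has nonzero coordinates only at the basis vectors for the same
  singular value.\<close>

lemma eigenspace_gram:
  assumes q: "right_singular_basis Z q" and "\<sigma> \<ge> 0"
  shows "{v. (transpose Z ** Z) *v v = \<sigma>\<^sup>2 *\<^sub>R v} = span (q ` {i. norm (Z *v q i) = \<sigma>})"
proof
  have onb: "orthonormal_basis q" and ev: "\<And>i. (transpose Z ** Z) *v q i = (norm (Z *v q i))\<^sup>2 *\<^sub>R q i"
    using q by (auto simp: right_singular_basis_def)
  have sub: "subspace {v. (transpose Z ** Z) *v v = \<sigma>\<^sup>2 *\<^sub>R v}"
    by (auto simp: subspace_def matrix_vector_right_distrib matrix_vector_mult_scaleR scaleR_add_right)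
  show "span (q ` {i. norm (Z *v q i) = \<sigma>}) \<subseteq> {v. (transpose Z ** Z) *v v = \<sigma>\<^sup>2 *\<^sub>R v}"
    by (rule span_minimal[OF _ sub]) (use ev in auto)
  show "{v. (transpose Z ** Z) *v v = \<sigma>\<^sup>2 *\<^sub>R v} \<subseteq> span (q ` {i. norm (Z *v q i) = \<sigma>})"
  proof
    fix v assume "v \<in> {v. (transpose Z ** Z) *v v = \<sigma>\<^sup>2 *\<^sub>R v}"
    then have v: "(transpose Z ** Z) *v v = \<sigma>\<^sup>2 *\<^sub>R v" by simp
    have "q i \<bullet> v = 0" if "norm (Z *v q i) \<noteq> \<sigma>" for i
    proof -
      have "\<sigma>\<^sup>2 * (q i \<bullet> v) = q i \<bullet> ((transpose Z ** Z) *v v)" by (simp add: v)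
      also have "\<dots> = v \<bullet> ((transpose Z ** Z) *v q i)" by (simp add: inner_gram inner_commute)
      also have "\<dots> = (norm (Z *v q i))\<^sup>2 * (q i \<bullet> v)" by (simp add: ev inner_commute)
      finally have "(\<sigma>\<^sup>2 - (norm (Z *v q i))\<^sup>2) * (q i \<bullet> v) = 0" by (simp add: algebra_simps)
      moreover have "\<sigma>\<^sup>2 \<noteq> (norm (Z *v q i))\<^sup>2" using that \<open>\<sigma> \<ge> 0\<close> by (simp add: power2_eq_iff_nonneg)
      ultimately show ?thesis by simp
    qed
    then have "(q i \<bullet> v) *\<^sub>R q i \<in> span (q ` {i. norm (Z *v q i) = \<sigma>})" for i
      by (cases "norm (Z *v q i) = \<sigma>") (auto intro: span_scale span_base span_zero)
    then have "(\<Sum>i\<in>UNIV. (q i \<bullet> v) *\<^sub>R q i) \<in> span (q ` {i. norm (Z *v q i) = \<sigma>})"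
      by (intro span_sum)
    then show "v \<in> span (q ` {i. norm (Z *v q i) = \<sigma>})" using orthonormal_expansion[OF onb, of v] by simp
  qed
qed

lemma orthonormal_nonzero: "orthonormal_basis q \<Longrightarrow> q i \<noteq> 0"
  unfolding orthonormal_basis_def by (metis inner_zero_left zero_neq_one)

lemma orthonormal_inj: "orthonormal_basis q \<Longrightarrow> inj q"
  unfolding orthonormal_basis_def inj_def by (metis zero_neq_one)

lemma singular_mult_card:
  assumes q: "right_singular_basis Z q" and "\<sigma> \<ge> 0"
  shows "singular_mult Z \<sigma> = card {i. norm (Z *v q i) = \<sigma>}"
proof -
  have onb: "orthonormal_basis q" using q by (simp add: right_singular_basis_def)
  have "pairwise orthogonal (q ` {i. norm (Z *v q i) = \<sigma>})"
    using onb by (auto simp: pairwise_def orthogonal_def orthonormal_basis_def)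
  moreover have "0 \<notin> q ` {i. norm (Z *v q i) = \<sigma>}"
    using orthonormal_nonzero[OF onb] by force
  ultimately have "independent (q ` {i. norm (Z *v q i) = \<sigma>})" by (rule pairwise_orthogonal_independent)
  then show ?thesis
    unfolding singular_mult_def eigenspace_gram[OF assms]
    by (simp add: dim_eq_card_independent card_image inj_on_subset[OF orthonormal_inj[OF onb]])
qed

lemma singular_values_range:
  assumes q: "right_singular_basis Z q"
  shows "singular_values Z = range (\<lambda>i. norm (Z *v q i))"
proof (intro set_eqI iffI)
  have onb: "orthonormal_basis q" and ev: "\<And>i. (transpose Z ** Z) *v q i = (norm (Z *v q i))\<^sup>2 *\<^sub>R q i"
    using q by (auto simp: right_singular_basis_def)
  fix \<sigma>
  {
    assume "\<sigma> \<in> singular_values Z"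
    then obtain v where s: "\<sigma> \<ge> 0" and v: "v \<noteq> 0" "(transpose Z ** Z) *v v = \<sigma>\<^sup>2 *\<^sub>R v"
      by (auto simp: singular_values_def)
    have "v \<in> span (q ` {i. norm (Z *v q i) = \<sigma>})" using eigenspace_gram[OF q s] v by blast
    then have "{i. norm (Z *v q i) = \<sigma>} \<noteq> {}" using v(1) by (metis image_empty span_empty singletonD)
    then show "\<sigma> \<in> range (\<lambda>i. norm (Z *v q i))" by auto
  next
    assume "\<sigma> \<in> range (\<lambda>i. norm (Z *v q i))"
    then obtain i where "\<sigma> = norm (Z *v q i)" by auto
    moreover have "q i \<noteq> 0" by (rule orthonormal_nonzero[OF onb])
    ultimately show "\<sigma> \<in> singular_values Z" using ev[of i] unfolding singular_values_def by auto
  }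
qed

text \<open>Grouping the basis by singular value turns the sum with multiplicities into a sum over the basis.\<close>

lemma nuclear_norm_eq:
  assumes q: "right_singular_basis Z q"
  shows "nuclear_norm Z = (\<Sum>i\<in>UNIV. norm (Z *v q i))"
proof -
  have "(\<Sum>i\<in>UNIV. norm (Z *v q i)) = (\<Sum>\<sigma>\<in>range (\<lambda>i. norm (Z *v q i)). \<Sum>i | i \<in> UNIV \<and> norm (Z *v q i) = \<sigma>. norm (Z *v q i))"
    by (rule sum.image_gen) simp
  also have "\<dots> = (\<Sum>\<sigma>\<in>range (\<lambda>i. norm (Z *v q i)). real (singular_mult Z \<sigma>) * \<sigma>)"
    by (intro sum.cong refl) (auto simp: singular_mult_card[OF q])
  finally show ?thesis by (simp add: nuclear_norm_def singular_values_range[OF q])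
qed

lemma inner_le_nuclear_spec: "Z \<bullet> M \<le> nuclear_norm Z * spec_norm M" for Z M :: "real^'n^'r"
proof -
  obtain q where q: "right_singular_basis Z q" by (rule right_singular_basis_exists)
  have onb: "orthonormal_basis q" using q by (simp add: right_singular_basis_def)
  have "Z \<bullet> M = (\<Sum>i\<in>UNIV. (Z *v q i) \<bullet> (M *v q i))" by (rule inner_matrix_onb[OF onb])
  also have "\<dots> \<le> (\<Sum>i\<in>UNIV. norm (Z *v q i) * spec_norm M)"
  proof (rule sum_mono)
    fix i
    have "norm (M *v q i) \<le> spec_norm M"
      using norm_matrix_vector_le[of M "q i"] by (simp add: orthonormal_norm[OF onb])
    then show "(Z *v q i) \<bullet> (M *v q i) \<le> norm (Z *v q i) * spec_norm M"
      using norm_cauchy_schwarz[of "Z *v q i" "M *v q i"] by (meson mult_left_mono norm_ge_zero order_trans)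
  qed
  finally show ?thesis by (simp add: nuclear_norm_eq[OF q] sum_distrib_right)
qed

lemma outer_vector: "outer u v *v x = (v \<bullet> x) *\<^sub>R u" for u :: "real^'r" and v :: "real^'c"
  by (simp add: vec_eq_iff outer_def matrix_vector_mult_def inner_vec_def sum_distrib_left mult_ac)

lemma matrix_vector_mult_sum_left: "(\<Sum>i\<in>I. M i) *v x = (\<Sum>i\<in>I. M i *v x)" for M :: "'i \<Rightarrow> real^'c^'r"
  by (induction I rule: infinite_finite_induct) (auto simp: matrix_vector_mult_add_rdistrib)

text \<open>The polar factor \<open>W = \<Sum> u\<^sub>i q\<^sub>i\<^sup>T\<close>, with the left singular vectors \<open>u\<^sub>i\<close>, is a partial isometry.\<close>

lemma nuclear_norm_attained:
  fixes Z :: "real^'n^'r"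
  obtains W where "spec_norm W \<le> 1" "Z \<bullet> W = nuclear_norm Z"
proof -
  obtain q where q: "right_singular_basis Z q" by (rule right_singular_basis_exists)
  have onb: "orthonormal_basis q" using q by (simp add: right_singular_basis_def)
  \<comment> \<open>For \<open>Z *v q i = 0\<close> division by zero makes \<open>u i = 0\<close>.\<close>
  define u where "u i = (1 / norm (Z *v q i)) *\<^sub>R (Z *v q i)" for i
  define W where "W = (\<Sum>i\<in>UNIV. outer (u i) (q i))"
  have uu: "u i \<bullet> u j = (if i = j \<and> Z *v q i \<noteq> 0 then 1 else 0)" for i j
    using singular_images_orthogonal[OF q, of i j] by (auto simp: u_def power2_eq_square)
  have Wx: "W *v x = (\<Sum>i\<in>UNIV. (q i \<bullet> x) *\<^sub>R u i)" for x
    by (simp add: W_def matrix_vector_mult_sum_left outer_vector)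
  have Wq: "W *v q i = u i" for i
    using onb by (simp add: Wx orthonormal_basis_def if_distrib[of "\<lambda>c. c *\<^sub>R _"] cong: if_cong)
  have "norm (W *v x) \<le> 1 * norm x" for x
  proof -
    have "(norm (W *v x))\<^sup>2 = (\<Sum>i\<in>UNIV. \<Sum>j\<in>UNIV. (q i \<bullet> x) * (q j \<bullet> x) * (u i \<bullet> u j))"
      unfolding power2_norm_eq_inner Wx inner_sum_left inner_sum_right
      by (simp add: mult_ac, intro sum.cong refl, simp add: inner_commute)
    also have "\<dots> = (\<Sum>i\<in>UNIV. (q i \<bullet> x)\<^sup>2 * (if Z *v q i \<noteq> 0 then 1 else 0))"
    proof (intro sum.cong refl)
      fix i
      have "(\<Sum>j\<in>UNIV. (q i \<bullet> x) * (q j \<bullet> x) * (u i \<bullet> u j)) = (\<Sum>j\<in>UNIV. if i = j then (q i \<bullet> x)\<^sup>2 * (if Z *v q i \<noteq> 0 then 1 else 0) else 0)"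
        by (intro sum.cong refl) (auto simp: uu power2_eq_square)
      then show "(\<Sum>j\<in>UNIV. (q i \<bullet> x) * (q j \<bullet> x) * (u i \<bullet> u j)) = (q i \<bullet> x)\<^sup>2 * (if Z *v q i \<noteq> 0 then 1 else 0)"
        by simp
    qed
    also have "\<dots> \<le> (\<Sum>i\<in>UNIV. (q i \<bullet> x)\<^sup>2)" by (intro sum_mono) auto
    also have "\<dots> = (norm x)\<^sup>2" 
      unfolding power2_norm_eq_inner parseval[OF onb, of x x] by (simp add: power2_eq_square)
    finally show ?thesis by (simp add: power2_le_iff_abs_le)
  qed
  then have "spec_norm W \<le> 1" by (rule spec_norm_le)
  moreover have "Z \<bullet> W = nuclear_norm Z"
  proof -
    have "(Z *v q i) \<bullet> u i = norm (Z *v q i)" for i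
      by (simp add: u_def flip: power2_norm_eq_inner) (simp add: power2_eq_square)
    then show ?thesis by (simp add: inner_matrix_onb[OF onb] Wq nuclear_norm_eq[OF q])
  qed
  ultimately show thesis by (rule that)
qed

text \<open>The nuclear norm is dual to the spectral norm.\<close>

lemma nuclear_norm_le_iff: "nuclear_norm Z \<le> b \<longleftrightarrow> (\<forall>M. Z \<bullet> M \<le> b * spec_norm M)" for Z :: "real^'n^'r"
proof
  assume b: "nuclear_norm Z \<le> b"
  show "\<forall>M. Z \<bullet> M \<le> b * spec_norm M"
    using inner_le_nuclear_spec[of Z] mult_right_mono[OF b spec_norm_nonneg] order_trans by blast
next
  assume a: "\<forall>M. Z \<bullet> M \<le> b * spec_norm M"
  obtain W where W: "spec_norm W \<le> 1" "Z \<bullet> W = nuclear_norm Z" by (rule nuclear_norm_attained)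
  obtain q where q: "right_singular_basis Z q" by (rule right_singular_basis_exists)
  have "nuclear_norm Z \<ge> 0" by (simp add: nuclear_norm_eq[OF q] sum_nonneg)
  have "nuclear_norm Z \<le> b * spec_norm W" using a W by metis
  show "nuclear_norm Z \<le> b"
  proof (cases "b \<ge> 0")
    case True
    then have "b * spec_norm W \<le> b" using W(1) by (simp add: mult_left_le)
    then show ?thesis using \<open>nuclear_norm Z \<le> b * spec_norm W\<close> by simp
  next
    case False
    then have "b * spec_norm W \<le> 0" using spec_norm_nonneg[of W] by (simp add: mult_nonpos_nonneg)
    moreover obtain M :: "real^'n^'r" where "M \<noteq> 0" by (metis zero_neq_one zero_index one_index vec_eq_iff)
    have "Z \<bullet> M \<le> b * spec_norm M" "Z \<bullet> (- M) \<le> b * spec_norm M"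
      using a spec_norm_scaleR[of "-1" M] by (auto dest: spec[of _ "- M"])
    moreover have "b * spec_norm M < 0" using False spec_norm_pos[OF \<open>M \<noteq> 0\<close>] by (simp add: mult_neg_pos)
    ultimately show ?thesis by simp
  qed
qed

text \<open>Distribute the square roots of the singular values to both sides of the decomposition
  \<open>Z = \<Sum> s\<^sub>i u\<^sub>i q\<^sub>i\<^sup>T\<close>.\<close>

lemma nuclear_factorization:
  fixes Z :: "real^'n^'r"
  obtains L :: "real^'n^'r" and R :: "real^'n^'n" where "L ** transpose R = Z" "L \<bullet> L = nuclear_norm Z" "R \<bullet> R = nuclear_norm Z"
proof -
  obtain q where q: "right_singular_basis Z q" by (rule right_singular_basis_exists)
  have onb: "orthonormal_basis q" using q by (simp add: right_singular_basis_def)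
  define s where "s i = norm (Z *v q i)" for i
  define L :: "real^'n^'r" where "L = (\<chi> r i. (1 / sqrt (s i)) * (Z *v q i) $ r)"
  define R :: "real^'n^'n" where "R = (\<chi> a i. sqrt (s i) * q i $ a)"
  have s0: "s i \<ge> 0" "s i = 0 \<Longrightarrow> Z *v q i = 0" for i by (auto simp: s_def)
  have inner_cols: "A \<bullet> A = (\<Sum>i\<in>UNIV. column i A \<bullet> column i A)" for A :: "real^'n^'a"
    unfolding inner_vec_def column_def by (simp add: sum.swap[of _ "UNIV :: 'n set"])
  have "column i L = (1 / sqrt (s i)) *\<^sub>R (Z *v q i)" for i by (simp add: L_def column_def vec_eq_iff)
  then have "column i L \<bullet> column i L = s i" for i
    using s0[of i] by (simp flip: power2_norm_eq_inner s_def) (simp add: power2_eq_square real_div_sqrt divide_simps)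
  then have 1: "L \<bullet> L = nuclear_norm Z" unfolding inner_cols[of L] by (simp add: nuclear_norm_eq[OF q] s_def)
  have "column i R = sqrt (s i) *\<^sub>R q i" for i by (simp add: R_def column_def vec_eq_iff)
  then have "column i R \<bullet> column i R = s i" for i
    using s0[of i] onb by (simp add: orthonormal_basis_def)
  then have 2: "R \<bullet> R = nuclear_norm Z" unfolding inner_cols[of R] by (simp add: nuclear_norm_eq[OF q] s_def)
  have 3: "L ** transpose R = Z"
  proof -
    have "(L ** transpose R) $ r $ a = Z $ r $ a" for r a
    proof -
      have "(L ** transpose R) $ r $ a = (\<Sum>i\<in>UNIV. (Z *v q i) $ r * q i $ a)"
        unfolding matrix_matrix_mult_def L_def R_def transpose_def vec_lambda_beta
        by (intro sum.cong refl) (use s0 in \<open>auto simp: divide_simps\<close>)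
      also have "\<dots> = (\<Sum>i\<in>UNIV. (q i \<bullet> Z $ r) * (q i \<bullet> axis a 1))"
        by (simp add: matrix_vector_mul_component inner_commute inner_axis)
      also have "\<dots> = Z $ r \<bullet> axis a 1" by (rule parseval[OF onb, symmetric])
      finally show ?thesis by (simp add: inner_axis)
    qed
    then show ?thesis by (simp add: vec_eq_iff)
  qed
  show thesis by (rule that[OF 3 1 2])
qed

lemma pos_semidef_factorization:
  fixes Y :: "real^'n^'n"
  assumes Y: "pos_semidef Y"
  obtains B :: "real^'n^'n" where "Y = B ** transpose B"
proof -
  obtain q d where onb: "orthonormal_basis q" and ev: "\<And>i. Y *v q i = d i *\<^sub>R q i"
    using Y symmetric_eigenbasis unfolding pos_semidef_def by metis
  have d: "d i \<ge> 0" for i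
  proof -
    have "0 \<le> q i \<bullet> (Y *v q i)" using Y by (simp add: pos_semidef_def)
    then show ?thesis using onb by (simp add: ev orthonormal_basis_def)
  qed
  define B :: "real^'n^'n" where "B = (\<chi> a i. sqrt (d i) * q i $ a)"
  have "(B ** transpose B) $ a $ b = Y $ a $ b" for a b
  proof -
    have "(B ** transpose B) $ a $ b = (\<Sum>i\<in>UNIV. (Y *v q i) $ a * q i $ b)"
      unfolding matrix_matrix_mult_def B_def transpose_def vec_lambda_beta
      by (intro sum.cong refl) (use d in \<open>simp add: ev mult_ac flip: real_sqrt_mult\<close>)
    also have "\<dots> = (\<Sum>i\<in>UNIV. (q i \<bullet> Y $ a) * (q i \<bullet> axis b 1))"
      by (simp add: matrix_vector_mul_component inner_commute inner_axis)
    also have "\<dots> = Y $ a \<bullet> axis b 1" by (rule parseval[OF onb, symmetric])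
    finally show ?thesis by (simp add: inner_axis)
  qed
  then have "Y = B ** transpose B" by (simp add: vec_eq_iff)
  then show thesis by (rule that)
qed

lemma norm_image_onb:
  assumes q: "right_singular_basis Z q"
  shows "(norm (Z *v x))\<^sup>2 = (\<Sum>i\<in>UNIV. (norm (Z *v q i))\<^sup>2 * (q i \<bullet> x)\<^sup>2)"
proof -
  have onb: "orthonormal_basis q" and ev: "\<And>i. (transpose Z ** Z) *v q i = (norm (Z *v q i))\<^sup>2 *\<^sub>R q i"
    using q by (auto simp: right_singular_basis_def)
  have "(norm (Z *v x))\<^sup>2 = x \<bullet> ((transpose Z ** Z) *v x)" by (simp add: inner_gram power2_norm_eq_inner)
  also have "\<dots> = (\<Sum>i\<in>UNIV. (q i \<bullet> x) * (q i \<bullet> ((transpose Z ** Z) *v x)))" by (rule parseval[OF onb])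
  also have "\<dots> = (\<Sum>i\<in>UNIV. (norm (Z *v q i))\<^sup>2 * (q i \<bullet> x)\<^sup>2)"
  proof (intro sum.cong refl)
    fix i
    have "q i \<bullet> ((transpose Z ** Z) *v x) = x \<bullet> ((transpose Z ** Z) *v q i)" by (simp add: inner_gram inner_commute)
    then show "(q i \<bullet> x) * (q i \<bullet> ((transpose Z ** Z) *v x)) = (norm (Z *v q i))\<^sup>2 * (q i \<bullet> x)\<^sup>2"
      by (simp add: ev power2_eq_square inner_commute)
  qed
  finally show ?thesis .
qed

lemma finite_singular_values: "finite (singular_values Z)" "singular_values Z \<noteq> {}" for Z :: "real^'n^'r"
proof -
  obtain q where q: "right_singular_basis Z q" by (rule right_singular_basis_exists)
  show "finite (singular_values Z)" "singular_values Z \<noteq> {}" by (simp_all add: singular_values_range[OF q])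
qed

lemma Max_singular_values: "Max (singular_values Z) = spec_norm Z" for Z :: "real^'n^'r"
proof (rule antisym)
  obtain q where q: "right_singular_basis Z q" by (rule right_singular_basis_exists)
  have onb: "orthonormal_basis q" using q by (simp add: right_singular_basis_def)
  have mx: "norm (Z *v q i) \<le> Max (singular_values Z)" for i
    unfolding singular_values_range[OF q] by (rule Max_ge) auto
  have mx0: "0 \<le> Max (singular_values Z)" using mx norm_ge_zero order_trans by blast
  show "spec_norm Z \<le> Max (singular_values Z)"
  proof (rule spec_norm_le)
    fix x
    have "(norm (Z *v x))\<^sup>2 \<le> (\<Sum>i\<in>UNIV. (Max (singular_values Z))\<^sup>2 * (q i \<bullet> x)\<^sup>2)"
      by (subst norm_image_onb[OF q], intro sum_mono mult_right_mono power_mono mx; auto)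
    also have "\<dots> = (Max (singular_values Z) * norm x)\<^sup>2"
      unfolding power_mult_distrib power2_norm_eq_inner
      by (subst parseval[OF onb, of x x]) (simp add: sum_distrib_left power2_eq_square)
    finally show "norm (Z *v x) \<le> Max (singular_values Z) * norm x"
      using mx0 by (simp add: power2_le_iff_abs_le)
  qed
  show "Max (singular_values Z) \<le> spec_norm Z"
  proof (subst Max_le_iff)
    show "\<forall>a\<in>singular_values Z. a \<le> spec_norm Z"
      unfolding singular_values_range[OF q]
      using norm_matrix_vector_le[of Z "q _"] by (auto simp: orthonormal_norm[OF onb])
  qed (auto simp: finite_singular_values)
qed

text \<open>Simplicity separates the largest singular value from the others, and \<open>v\<close> is up to sign the only
  basis vector for it; the other singular values bound \<open>Z\<close> on the complement of \<open>v\<close>.\<close>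

lemma singular_gap:
  fixes Z :: "real^'n^'r"
  assumes simple: "singular_mult Z (spec_norm Z) = 1" and v: "norm v = 1" "(transpose Z ** Z) *v v = (spec_norm Z)\<^sup>2 *\<^sub>R v"
    and pos: "spec_norm Z > 0"
  obtains s2 where "s2 < (spec_norm Z)\<^sup>2" "\<And>w. v \<bullet> w = 0 \<Longrightarrow> (norm (Z *v w))\<^sup>2 \<le> s2 * (norm w)\<^sup>2"
proof -
  obtain q where q: "right_singular_basis Z q" by (rule right_singular_basis_exists)
  have onb: "orthonormal_basis q" and ev: "\<And>i. (transpose Z ** Z) *v q i = (norm (Z *v q i))\<^sup>2 *\<^sub>R q i"
    using q by (auto simp: right_singular_basis_def)
  have "card {i. norm (Z *v q i) = spec_norm Z} = 1"
    using simple singular_mult_card[OF q spec_norm_nonneg[of Z]] by simp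
  then obtain k where k: "{i. norm (Z *v q i) = spec_norm Z} = {k}" by (rule card_1_singletonE)
  have "v \<in> {v. (transpose Z ** Z) *v v = (spec_norm Z)\<^sup>2 *\<^sub>R v}" using v(2) by simp
  then have "v \<in> span (q ` {k})" by (simp only: eigenspace_gram[OF q spec_norm_nonneg[of Z]] k)
  then obtain c where c: "v = c *\<^sub>R q k" by (auto simp: span_singleton)
  then have c0: "c \<noteq> 0" using v(1) by auto
  define s2 where "s2 = Max (insert 0 ((\<lambda>i. (norm (Z *v q i))\<^sup>2) ` (UNIV - {k})))"
  have "(norm (Z *v q i))\<^sup>2 < (spec_norm Z)\<^sup>2" if "i \<noteq> k" for i
  proof -
    have "norm (Z *v q i) \<le> spec_norm Z"
      using norm_matrix_vector_le[of Z "q i"] by (simp add: orthonormal_norm[OF onb])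
    moreover have "norm (Z *v q i) \<noteq> spec_norm Z" using k that by blast
    ultimately show ?thesis by (intro power_strict_mono) auto
  qed
  then have "s2 < (spec_norm Z)\<^sup>2" using pos by (auto simp: s2_def)
  moreover have "(norm (Z *v w))\<^sup>2 \<le> s2 * (norm w)\<^sup>2" if "v \<bullet> w = 0" for w
  proof -
    have qk: "q k \<bullet> w = 0" using that c c0 by simp
    have "(norm (Z *v w))\<^sup>2 \<le> (\<Sum>i\<in>UNIV. s2 * (q i \<bullet> w)\<^sup>2)"
    proof (subst norm_image_onb[OF q], rule sum_mono)
      fix i
      show "(norm (Z *v q i))\<^sup>2 * (q i \<bullet> w)\<^sup>2 \<le> s2 * (q i \<bullet> w)\<^sup>2"
        by (cases "i = k") (auto simp: qk s2_def intro!: mult_right_mono Max_ge)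
    qed
    also have "\<dots> = s2 * (norm w)\<^sup>2"
      unfolding power2_norm_eq_inner
      by (subst parseval[OF onb, of w w]) (simp add: sum_distrib_left power2_eq_square)
    finally show ?thesis .
  qed
  ultimately show thesis by (rule that)
qed

text \<open>Write a unit vector as \<open>x = c v + w\<close> with \<open>w\<close> orthogonal to \<open>v\<close>. By the gap, \<open>\<parallel>Z x\<parallel>\<^sup>2\<close> drops by
  \<open>\<delta> \<parallel>w\<parallel>\<^sup>2\<close>, while the cross terms of \<open>\<parallel>(Z + E) x\<parallel>\<^sup>2\<close> that involve \<open>w\<close> are at most a constant times
  \<open>\<parallel>E\<parallel> \<parallel>w\<parallel>\<close>. Completing the square leaves an error of order \<open>\<parallel>E\<parallel>\<^sup>2\<close>.\<close>

lemma spec_norm_sq_upper: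
  fixes Z :: "real^'n^'r"
  assumes simple: "singular_mult Z (spec_norm Z) = 1" and v: "norm v = 1" "(transpose Z ** Z) *v v = (spec_norm Z)\<^sup>2 *\<^sub>R v"
    and pos: "spec_norm Z > 0"
  obtains C where "\<And>E. (spec_norm (Z + E))\<^sup>2 \<le> (spec_norm Z)\<^sup>2 + 2 * ((Z *v v) \<bullet> (E *v v)) + C * (norm E)\<^sup>2"
proof -
  define \<sigma> where "\<sigma> = spec_norm Z"
  obtain s2 where s2: "s2 < \<sigma>\<^sup>2" and gap: "\<And>w. v \<bullet> w = 0 \<Longrightarrow> (norm (Z *v w))\<^sup>2 \<le> s2 * (norm w)\<^sup>2"
    using singular_gap[OF simple v pos] unfolding \<sigma>_def by blast
  define \<delta> where "\<delta> = \<sigma>\<^sup>2 - s2"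
  have \<delta>: "\<delta> > 0" using s2 by (simp add: \<delta>_def)
  have \<sigma>0: "\<sigma> \<ge> 0" by (simp add: \<sigma>_def spec_norm_nonneg)
  have vv: "v \<bullet> v = 1" using v by (simp add: norm_eq_1)
  define C where "C = 16 * \<sigma>\<^sup>2 / \<delta> + 1"
  show thesis
  proof (rule that[of C])
    fix E :: "real^'n^'r"
    define e where "e = norm E"
    have e0: "e \<ge> 0" by (simp add: e_def)
    define T where "T = \<sigma>\<^sup>2 + 2 * ((Z *v v) \<bullet> (E *v v)) + C * e\<^sup>2"
    have unit: "(norm ((Z + E) *v x))\<^sup>2 \<le> T" if x: "norm x = 1" for x
    proof -
      define c w where "c = v \<bullet> x" and "w = x - c *\<^sub>R v"
      have xw: "x = c *\<^sub>R v + w" by (simp add: w_def)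
      have vw: "v \<bullet> w = 0" by (simp add: w_def c_def inner_diff_right vv)
      have pyth: "c\<^sup>2 + (norm w)\<^sup>2 = 1"
      proof -
        have "x \<bullet> x = c\<^sup>2 + w \<bullet> w"
          by (subst (1 2) xw) (simp add: inner_add_left inner_add_right vv vw inner_commute power2_eq_square)
        then show ?thesis using x by (simp add: power2_norm_eq_inner norm_eq_1)
      qed
      define n where "n = norm w"
      have n: "0 \<le> n" "n \<le> 1" "\<bar>c\<bar> \<le> 1"
      proof -
        have "(norm w)\<^sup>2 \<le> 1\<^sup>2" "\<bar>c\<bar>\<^sup>2 \<le> 1\<^sup>2"
          using pyth zero_le_power2[of c] zero_le_power2[of "norm w"]
          unfolding power2_abs one_power2 by linarith+
        then show "n \<le> 1" "\<bar>c\<bar> \<le> 1" by (auto simp: n_def intro: power2_le_imp_le)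
      qed (simp add: n_def)
      have Zv: "norm (Z *v v) \<le> \<sigma>" using norm_matrix_vector_le[of Z v] v by (simp add: \<sigma>_def)
      have Zw: "norm (Z *v w) \<le> \<sigma> * n" using norm_matrix_vector_le[of Z w] by (simp add: \<sigma>_def n_def)
      have Ev: "norm (E *v v) \<le> e" using norm_matrix_vector_le_norm[of E v] v by (simp add: e_def)
      have Ew: "norm (E *v w) \<le> e * n" using norm_matrix_vector_le_norm[of E w] by (simp add: e_def n_def)
      have Ex: "norm (E *v x) \<le> e" using norm_matrix_vector_le_norm[of E x] x by (simp add: e_def)
      have ZvZw: "(Z *v v) \<bullet> (Z *v w) = 0"
        using inner_gram[of w Z v] v(2) vw by (simp add: inner_commute)
      have A1: "(norm (Z *v x))\<^sup>2 \<le> \<sigma>\<^sup>2 - \<delta> * n\<^sup>2"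
      proof -
        have "(norm (Z *v x))\<^sup>2 = c\<^sup>2 * (norm (Z *v v))\<^sup>2 + (norm (Z *v w))\<^sup>2"
          unfolding power2_norm_eq_inner
          by (subst (1 2) xw) (simp add: matrix_vector_right_distrib matrix_vector_mult_scaleR
              inner_add_left inner_add_right ZvZw inner_commute power2_eq_square)
        also have "\<dots> \<le> c\<^sup>2 * \<sigma>\<^sup>2 + s2 * n\<^sup>2"
          using gap[OF vw] Zv by (intro add_mono mult_left_mono power_mono) (auto simp: n_def)
        also have "c\<^sup>2 = 1 - n\<^sup>2" using pyth by (simp add: n_def)
        finally show ?thesis by (simp add: \<delta>_def algebra_simps)
      qed
      have cs: "p \<bullet> q \<le> P * Q" if "norm p \<le> P" "norm q \<le> Q" for p q :: "real^'r" and P Q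
        using norm_cauchy_schwarz[of p q] mult_mono[OF that] that norm_ge_zero[of p] norm_ge_zero[of q] by linarith
      have "(Z *v x) \<bullet> (E *v x) = c\<^sup>2 * ((Z *v v) \<bullet> (E *v v)) + (c *\<^sub>R (Z *v v)) \<bullet> (E *v w)
          + (Z *v w) \<bullet> (c *\<^sub>R (E *v v)) + (Z *v w) \<bullet> (E *v w)"
        by (subst (1 2) xw) (simp add: matrix_vector_right_distrib matrix_vector_mult_scaleR
            inner_add_left inner_add_right power2_eq_square distrib_left)
      moreover have "c\<^sup>2 * ((Z *v v) \<bullet> (E *v v)) \<le> (Z *v v) \<bullet> (E *v v) + \<sigma> * e * n"
      proof -
        have "- ((Z *v v) \<bullet> (E *v v)) \<le> \<sigma> * e" using cs[of "- (Z *v v)" \<sigma> "E *v v" e] Zv Ev by simp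
        then have "n\<^sup>2 * (- ((Z *v v) \<bullet> (E *v v))) \<le> n\<^sup>2 * (\<sigma> * e)" by (intro mult_left_mono) auto
        also have "\<dots> \<le> n * (\<sigma> * e)"
          using n \<sigma>0 e0 by (intro mult_right_mono) (auto simp: power2_eq_square mult_left_le)
        finally have "n\<^sup>2 * (- ((Z *v v) \<bullet> (E *v v))) \<le> \<sigma> * e * n" by (simp add: mult_ac)
        moreover have "c\<^sup>2 = 1 - n\<^sup>2" using pyth by (simp add: n_def)
        ultimately show ?thesis by (simp add: left_diff_distrib)
      qed
      moreover have "(c *\<^sub>R (Z *v v)) \<bullet> (E *v w) \<le> \<sigma> * (e * n)"
        using n Zv mult_mono[of "\<bar>c\<bar>" 1 "norm (Z *v v)" \<sigma>] \<sigma>0 by (intro cs Ew) auto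
      moreover have "(Z *v w) \<bullet> (c *\<^sub>R (E *v v)) \<le> (\<sigma> * n) * e"
        using n Ev mult_mono[of "\<bar>c\<bar>" 1 "norm (E *v v)" e] e0 by (intro cs Zw) auto
      moreover have "(Z *v w) \<bullet> (E *v w) \<le> \<sigma> * (e * n)"
      proof (rule cs[OF _ Ew])
        have "\<sigma> * n \<le> \<sigma>" using n \<sigma>0 by (simp add: mult_left_le)
        then show "norm (Z *v w) \<le> \<sigma>" using Zw by simp
      qed
      ultimately have A2: "(Z *v x) \<bullet> (E *v x) \<le> (Z *v v) \<bullet> (E *v v) + 4 * (\<sigma> * e * n)"
        by (simp add: mult_ac)
      have A3: "8 * (\<sigma> * e * n) \<le> \<delta> * n\<^sup>2 + 16 * \<sigma>\<^sup>2 / \<delta> * e\<^sup>2"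
      proof -
        have "0 \<le> (\<delta> * n - 4 * \<sigma> * e)\<^sup>2 / \<delta>" using \<delta> by simp
        also have "\<dots> = \<delta> * n\<^sup>2 + 16 * \<sigma>\<^sup>2 / \<delta> * e\<^sup>2 - 8 * (\<sigma> * e * n)"
          using \<delta> by (simp add: power2_diff field_simps power2_eq_square)
        finally show ?thesis by simp
      qed
      have "(norm ((Z + E) *v x))\<^sup>2 = (norm (Z *v x))\<^sup>2 + 2 * ((Z *v x) \<bullet> (E *v x)) + (norm (E *v x))\<^sup>2"
        by (simp add: power2_norm_eq_inner matrix_vector_mult_add_rdistrib inner_add_left inner_add_right inner_commute)
      also have "\<dots> \<le> T"
        using A1 A2 A3 power_mono[OF Ex, of 2] by (simp add: T_def C_def distrib_right)
      finally show ?thesis .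
    qed
    have "T \<ge> 0" using unit[OF v(1)] zero_le_power2 order_trans by blast
    have "spec_norm (Z + E) \<le> sqrt T"
    proof (rule spec_norm_le)
      fix x
      show "norm ((Z + E) *v x) \<le> sqrt T * norm x"
      proof (cases "x = 0")
        case False
        define z where "z = (1 / norm x) *\<^sub>R x"
        have z: "norm z = 1" "x = norm x *\<^sub>R z" using False by (auto simp: z_def)
        have "norm ((Z + E) *v x) = norm x * norm ((Z + E) *v z)"
          by (subst z(2)) (simp add: matrix_vector_mult_scaleR)
        also have "\<dots> \<le> norm x * sqrt T" using unit[OF z(1)] by (intro mult_left_mono real_le_rsqrt) auto
        finally show ?thesis by (simp add: mult.commute)
      qed simp
    qed
    then have "(spec_norm (Z + E))\<^sup>2 \<le> (sqrt T)\<^sup>2" by (intro power_mono spec_norm_nonneg)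
    then show "(spec_norm (Z + E))\<^sup>2 \<le> (spec_norm Z)\<^sup>2 + 2 * ((Z *v v) \<bullet> (E *v v)) + C * (norm E)\<^sup>2"
      using \<open>T \<ge> 0\<close> by (simp add: T_def \<sigma>_def e_def)
  qed
qed

section \<open>Inverses and Cholesky factors of analytic families\<close>

lemma analytic_at_uminus:
  fixes x :: "real^'p::finite"
  assumes x: "x \<in> coord_space I" and f: "analytic_at I f x"
  shows "analytic_at I (\<lambda>y. - f y) x"
  using analytic_at_mult[OF x analytic_at_const[OF x, of "-1"] f] by simp

lemma analytic_at_diff:
  fixes x :: "real^'p::finite"
  assumes x: "x \<in> coord_space I" and f: "analytic_at I f x" and g: "analytic_at I g x"
  shows "analytic_at I (\<lambda>y. f y - g y) x"
  using analytic_at_add[OF x f analytic_at_uminus[OF x g]] by simp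

lemma analytic_at_divide:
  fixes x :: "real^'p::finite"
  assumes x: "x \<in> coord_space I" and f: "analytic_at I f x" and g: "analytic_at I g x" "g x \<noteq> 0"
  shows "analytic_at I (\<lambda>y. f y / g y) x"
  using analytic_at_mult[OF x f analytic_at_inverse[OF x g]] by (simp add: divide_inverse)

lemma analytic_at_sum:
  fixes x :: "real^'p::finite"
  assumes x: "x \<in> coord_space I" and f: "\<And>a. a \<in> A \<Longrightarrow> analytic_at I (f a) x"
  shows "analytic_at I (\<lambda>y. \<Sum>a\<in>A. f a y) x"
  using f by (induction A rule: infinite_finite_induct)
    (auto intro: analytic_at_const[OF x] analytic_at_add[OF x])

lemma analytic_at_prod:
  fixes x :: "real^'p::finite"
  assumes x: "x \<in> coord_space I" and f: "\<And>a. a \<in> A \<Longrightarrow> analytic_at I (f a) x"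
  shows "analytic_at I (\<lambda>y. \<Prod>a\<in>A. f a y) x"
  using f by (induction A rule: infinite_finite_induct)
    (auto intro: analytic_at_const[OF x] analytic_at_mult[OF x])

lemma analytic_at_det:
  fixes x :: "real^'p::finite" and F :: "real^'p \<Rightarrow> real^'n^'n"
  assumes x: "x \<in> coord_space I" and F: "\<And>i j. analytic_at I (\<lambda>y. F y $ i $ j) x"
  shows "analytic_at I (\<lambda>y. det (F y)) x"
  unfolding det_def
  by (intro analytic_at_sum analytic_at_mult analytic_at_prod analytic_at_const x F)

lemma matrix_inv_mult:
  fixes A :: "'a::field^'n^'n"
  assumes "invertible A"
  shows "A ** matrix_inv A = mat 1" "matrix_inv A ** A = mat 1"
  using someI_ex[OF assms[unfolded invertible_def]] by (auto simp: matrix_inv_def)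

lemma matrix_inv_cramer:
  fixes A :: "'a::field^'n^'n"
  assumes "invertible A"
  shows "matrix_inv A $ k $ j = det (\<chi> i l. if l = k then axis j 1 $ i else A $ i $ l) / det A"
proof -
  have "A *v column j (matrix_inv A) = axis j 1"
    using matrix_inv_mult(1)[OF assms]
    by (auto simp: vec_eq_iff matrix_vector_mult_def matrix_matrix_mult_def column_def mat_def axis_def)
  then have "column j (matrix_inv A) = (\<chi> k. det (\<chi> i l. if l = k then axis j 1 $ i else A $ i $ l) / det A)"
    using assms by (subst (asm) cramer) (auto simp: invertible_det_nz)
  then show ?thesis by (simp add: vec_eq_iff column_def)
qed

text \<open>The columns of the inverse solve linear systems, so Cramer's rule applies.\<close>

lemma analytic_at_matrix_inv:
  fixes x :: "real^'p::finite" and F :: "real^'p \<Rightarrow> real^'n^'n"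
  assumes U: "openin (top_of_set (coord_space I)) U" "x \<in> U" and inv: "\<And>y. y \<in> U \<Longrightarrow> invertible (F y)"
    and F: "\<And>i j. analytic_at I (\<lambda>y. F y $ i $ j) x"
  shows "analytic_at I (\<lambda>y. matrix_inv (F y) $ k $ j) x"
proof (rule analytic_at_cong[OF U])
  have x: "x \<in> coord_space I" using U openin_imp_subset by blast
  show "det (\<chi> i l. if l = k then axis j 1 $ i else F y $ i $ l) / det (F y) = matrix_inv (F y) $ k $ j" if "y \<in> U" for y
    using matrix_inv_cramer[OF inv[OF that]] by simp
  have "analytic_at I (\<lambda>y. (if l = k then axis j 1 $ i else F y $ i $ l)) x" for i l
    by (cases "l = k") (simp_all add: F analytic_at_const x)
  then show "analytic_at I (\<lambda>y. det (\<chi> i l. if l = k then axis j 1 $ i else F y $ i $ l) / det (F y)) x"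
    using inv[OF U(2)] by (intro analytic_at_divide analytic_at_det x F) (auto simp: invertible_det_nz)
qed

definition is_cholesky :: "('k::{finite,linorder}, 'k) rmat \<Rightarrow> ('k, 'k) rmat \<Rightarrow> bool" where
  "is_cholesky P R \<longleftrightarrow> (\<forall>i j. j < i \<longrightarrow> R $ i $ j = 0) \<and> (\<forall>i. R $ i $ i > 0) \<and> P = transpose R ** R"

text \<open>Row \<open>i\<close> of \<open>P = R\<^sup>T R\<close> determines row \<open>i\<close> of \<open>R\<close> from the earlier ones: first the diagonal entry,
  which is positive, then the rest by division.\<close>

lemma is_cholesky_unique:
  fixes P :: "('k::{finite,linorder}, 'k) rmat"
  assumes R: "is_cholesky P R" and T: "is_cholesky P T"
  shows "R = T"
proof -
  have "R $ i = T $ i" for i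
  proof (induction i rule: measure_induct_rule[where f = "\<lambda>i. card {..<i}"])
    case (less i)
    have IH: "R $ k = T $ k" if "k < i" for k
      by (rule less.IH, rule psubset_card_mono) (use that in auto)
    have P: "P $ i $ j = (\<Sum>k\<in>{..<i}. M $ k $ i * M $ k $ j) + M $ i $ i * M $ i $ j" if "is_cholesky P M" for M j
    proof -
      have up: "\<And>a b. b < a \<Longrightarrow> M $ a $ b = 0" and PM: "P = transpose M ** M" using that by (auto simp: is_cholesky_def)
      have "P $ i $ j = (\<Sum>k\<in>UNIV. M $ k $ i * M $ k $ j)"
        unfolding PM by (simp add: matrix_matrix_mult_def transpose_def)
      also have "\<dots> = (\<Sum>k\<in>insert i {..<i}. M $ k $ i * M $ k $ j)"
        by (rule sum.mono_neutral_right) (auto intro!: up simp: not_less less_le)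
      finally show ?thesis by (simp add: add.commute)
    qed
    have eq: "R $ i $ i * R $ i $ j = T $ i $ i * T $ i $ j" for j
      using P[OF R, of j] P[OF T, of j] IH by simp
    have pos: "R $ i $ i > 0" "T $ i $ i > 0" using R T by (auto simp: is_cholesky_def)
    have "(R $ i $ i)\<^sup>2 = (T $ i $ i)\<^sup>2" using eq[of i] by (simp add: power2_eq_square)
    then have "R $ i $ i = T $ i $ i" using pos by (simp add: power2_eq_iff_nonneg)
    then show ?case using eq pos by (simp add: vec_eq_iff)
  qed
  then show ?thesis by (simp add: vec_eq_iff)
qed

definition supported_off :: "'k set \<Rightarrow> real^'k \<Rightarrow> bool" where
  "supported_off A v \<longleftrightarrow> (\<forall>a\<in>A. v $ a = 0)"

text \<open>Minimizing the form over the line \<open>v + \<real> e\<^sub>b\<close> gives the form of the Schur complement.\<close>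

lemma quadratic_form_shift:
  fixes S :: "real^'k^'k" and v :: "real^'k"
  assumes sym: "transpose S = S" and s: "S $ b $ b > 0"
  defines "t \<equiv> (S *v v) $ b"
  shows "(v - (t / S $ b $ b) *\<^sub>R axis b 1) \<bullet> (S *v (v - (t / S $ b $ b) *\<^sub>R axis b 1)) = v \<bullet> (S *v v) - t\<^sup>2 / S $ b $ b"
proof -
  have e: "axis b 1 \<bullet> y = y $ b" for y :: "real^'k" by (simp add: inner_axis')
  have "v \<bullet> (S *v axis b 1) = axis b 1 \<bullet> (transpose S *v v)"
    by (simp only: transpose_matrix_vector dot_lmul_matrix[symmetric] inner_commute)
  then have ve: "v \<bullet> (S *v axis b 1) = t" unfolding sym e t_def .
  have ee: "axis b 1 \<bullet> (S *v axis b 1) = S $ b $ b"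
    unfolding e matrix_vector_mul_component by (simp add: inner_axis)
  have "(v - c *\<^sub>R axis b 1) \<bullet> (S *v (v - c *\<^sub>R axis b 1)) = v \<bullet> (S *v v) - 2 * c * t + c\<^sup>2 * S $ b $ b" for c
    by (simp add: matrix_vector_mult_diff_distrib matrix_vector_mult_scaleR inner_diff_left inner_diff_right ve ee)
      (simp add: e t_def[symmetric] power2_eq_square algebra_simps)
  then show ?thesis using s by (simp add: power2_eq_square)
qed

text \<open>Elimination in increasing order of the index. After the rows in \<open>A\<close> have been split off, the
  remainder \<open>S\<close> vanishes on \<open>A\<close> and is still positive definite on the vectors supported off \<open>A\<close>; in
  particular its next diagonal entry is positive and the next row \<open>S e\<^sub>b / \<surd>S\<^sub>b\<^sub>b\<close> is analytic.\<close>

lemma analytic_cholesky_partial: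
  fixes P :: "real^'p::finite \<Rightarrow> ('k::{finite,linorder}, 'k) rmat"
  assumes U: "U \<subseteq> coord_space I"
    and an: "\<And>x i j. x \<in> U \<Longrightarrow> analytic_at I (\<lambda>y. P y $ i $ j) x"
    and pd: "\<And>x. x \<in> U \<Longrightarrow> pos_def (P x)" and "finite A"
  shows "(\<forall>a\<in>A. \<forall>b<a. b \<in> A) \<Longrightarrow> \<exists>S (R :: 'k \<Rightarrow> real^'p \<Rightarrow> (real,'k) vec). \<forall>x\<in>U.
     (\<forall>i j. analytic_at I (\<lambda>y. S y $ i $ j) x) \<and> (\<forall>i j. analytic_at I (\<lambda>y. R i y $ j) x) \<and>
     P x = S x + (\<Sum>i\<in>A. outer (R i x) (R i x)) \<and> transpose (S x) = S x \<and>
     (\<forall>a\<in>A. \<forall>b. S x $ a $ b = 0) \<and>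
     (\<forall>v. v \<noteq> 0 \<longrightarrow> supported_off A v \<longrightarrow> v \<bullet> (S x *v v) > 0) \<and>
     (\<forall>a\<in>A. R a x $ a > 0 \<and> (\<forall>j<a. R a x $ j = 0))"
  using \<open>finite A\<close>
proof (induction A rule: finite_linorder_max_induct)
  case empty
  show ?case
    by (rule exI[of _ P], rule exI[of _ "\<lambda>_ _. 0"])
      (use an pd U in \<open>auto simp: pos_def_def intro!: analytic_at_const\<close>)
next
  case (insert b A)
  have bA: "b \<notin> A" using insert.hyps by auto
  have low: "\<forall>a\<in>A. \<forall>c<a. c \<in> A"
    using insert.prems insert.hyps by (metis insert_iff less_asym less_trans)
  have ltA: "j \<in> A" if "j < b" for j using insert.prems that by auto
  obtain S R where SR: "\<forall>x\<in>U.
     (\<forall>i j. analytic_at I (\<lambda>y. S y $ i $ j) x) \<and> (\<forall>i j. analytic_at I (\<lambda>y. R i y $ j) x) \<and>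
     P x = S x + (\<Sum>i\<in>A. outer (R i x) (R i x)) \<and> transpose (S x) = S x \<and>
     (\<forall>a\<in>A. \<forall>b. S x $ a $ b = 0) \<and>
     (\<forall>v. v \<noteq> 0 \<longrightarrow> supported_off A v \<longrightarrow> v \<bullet> (S x *v v) > 0) \<and>
     (\<forall>a\<in>A. R a x $ a > 0 \<and> (\<forall>j<a. R a x $ j = 0))"
    using insert.IH[OF low] by (elim exE)
  define r :: "real^'p \<Rightarrow> (real,'k) vec" where "r y = (\<chi> j. S y $ j $ b * inverse (sqrt (S y $ b $ b)))" for y
  define R' where "R' = R(b := r)"
  define S' where "S' y = S y - outer (r y) (r y)" for y
  show ?case
  proof (rule exI[of _ S'], rule exI[of _ R'], rule ballI, intro conjI)
    fix x assume xU: "x \<in> U"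
    have x: "x \<in> coord_space I" using U xU by blast
    have anS: "analytic_at I (\<lambda>y. S y $ i $ j) x" and anR: "analytic_at I (\<lambda>y. R i y $ j) x"
      and PS: "P x = S x + (\<Sum>i\<in>A. outer (R i x) (R i x))" and sym: "transpose (S x) = S x"
      and S0: "a \<in> A \<Longrightarrow> S x $ a $ c = 0" and Spos: "v \<noteq> 0 \<Longrightarrow> supported_off A v \<Longrightarrow> v \<bullet> (S x *v v) > 0"
      and Rpos: "a \<in> A \<Longrightarrow> R a x $ a > 0" and Rup: "a \<in> A \<Longrightarrow> j < a \<Longrightarrow> R a x $ j = 0" for i j a c v
      using bspec[OF SR xU] by blast+
    have symS: "S x $ i $ j = S x $ j $ i" for i j
      using arg_cong[OF sym, of "\<lambda>M. M $ j $ i"] by (simp add: transpose_def)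
    define s where "s = S x $ b $ b"
    have s: "s > 0"
    proof -
      have "supported_off A (axis b 1)" using bA by (auto simp: supported_off_def axis_def)
      then have "axis b 1 \<bullet> (S x *v axis b 1) > 0" by (intro Spos) (auto simp: axis_eq_0_iff)
      then show ?thesis
        by (simp add: s_def inner_axis' matrix_vector_mul_component) (simp add: inner_axis)
    qed
    have anr: "analytic_at I (\<lambda>y. r y $ j) x" for j
      unfolding r_def vec_lambda_beta using s
      by (intro analytic_at_mult analytic_at_inverse analytic_at_sqrt anS x) (auto simp: s_def)
    show "\<forall>i j. analytic_at I (\<lambda>y. R' i y $ j) x"
    proof (intro allI)
      fix i j show "analytic_at I (\<lambda>y. R' i y $ j) x" by (cases "i = b") (auto simp: R'_def anr anR)
    qed
    show "\<forall>i j. analytic_at I (\<lambda>y. S' y $ i $ j) x"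
      unfolding S'_def outer_def
      by (auto intro!: analytic_at_diff analytic_at_mult anr anS x)
    show "P x = S' x + (\<Sum>i\<in>insert b A. outer (R' i x) (R' i x))"
    proof -
      have "(\<Sum>i\<in>A. outer (R' i x) (R' i x)) = (\<Sum>i\<in>A. outer (R i x) (R i x))"
        by (rule sum.cong) (use bA in \<open>auto simp: R'_def\<close>)
      then show ?thesis using bA insert.hyps(1) by (simp add: PS S'_def R'_def)
    qed
    have rr: "r x $ i * r x $ j = S x $ i $ b * S x $ j $ b / s" for i j
      using s by (simp add: r_def s_def[symmetric] divide_inverse flip: power2_eq_square)
        (simp add: power2_eq_square mult_ac flip: inverse_mult_distrib)
    have S'e: "S' x $ i $ j = S x $ i $ j - S x $ i $ b * S x $ j $ b / s" for i j
      by (simp add: S'_def outer_def rr)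
    show "transpose (S' x) = S' x"
      unfolding vec_eq_iff
    proof (intro allI)
      fix i j show "transpose (S' x) $ i $ j = S' x $ i $ j"
        using symS[of i j] by (simp add: transpose_def S'e mult.commute)
    qed
    show "\<forall>a\<in>insert b A. \<forall>c. S' x $ a $ c = 0"
    proof (intro ballI allI)
      fix a c assume "a \<in> insert b A"
      then show "S' x $ a $ c = 0"
      proof
        assume "a = b"
        then show ?thesis using s symS[of b c] by (simp add: S'e s_def[symmetric])
      qed (simp add: S'e S0)
    qed
    show "\<forall>v. v \<noteq> 0 \<longrightarrow> supported_off (insert b A) v \<longrightarrow> v \<bullet> (S' x *v v) > 0"
    proof (intro allI impI)
      fix v :: "(real,'k) vec" assume v: "v \<noteq> 0" "supported_off (insert b A) v"
      define t where "t = (S x *v v) $ b"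
      define w where "w = v - (t / S x $ b $ b) *\<^sub>R axis b 1"
      have "v \<bullet> (outer (r x) (r x) *v v) = (r x \<bullet> v)\<^sup>2"
        by (simp add: outer_def matrix_vector_mult_def inner_vec_def power2_eq_square sum_distrib_left sum_distrib_right mult_ac)
      also have "r x \<bullet> v = t * inverse (sqrt s)"
        unfolding r_def t_def inner_vec_def matrix_vector_mult_def s_def[symmetric] vec_lambda_beta sum_distrib_right
        by (intro sum.cong refl) (use symS in \<open>simp add: mult_ac\<close>)
      finally have "v \<bullet> (S' x *v v) = v \<bullet> (S x *v v) - t\<^sup>2 / s"
        using s by (simp add: S'_def matrix_vector_mult_diff_rdistrib inner_diff_right power_mult_distrib divide_inverse power_inverse)
      also have "\<dots> = w \<bullet> (S x *v w)"
        unfolding w_def t_def s_def by (rule quadratic_form_shift[OF sym, symmetric]) (use s in \<open>simp add: s_def\<close>)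
      also have "\<dots> > 0"
      proof (rule Spos)
        have wv: "w $ a = v $ a" if "a \<noteq> b" for a using that by (simp add: w_def axis_def)
        show "supported_off A w" using v(2) bA wv by (metis insert_iff supported_off_def)
        obtain a where a: "v $ a \<noteq> 0" using v(1) by (auto simp: vec_eq_iff)
        then have "a \<noteq> b" using v(2) by (auto simp: supported_off_def)
        then show "w \<noteq> 0" using wv[of a] a by auto
      qed
      finally show "v \<bullet> (S' x *v v) > 0" .
    qed
    show "\<forall>a\<in>insert b A. R' a x $ a > 0 \<and> (\<forall>j<a. R' a x $ j = 0)"
      using Rpos Rup bA s ltA S0 by (auto simp: R'_def r_def s_def[symmetric])
  qed
qed

theorem cholesky_analytic:
  fixes P :: "real^'p::finite \<Rightarrow> ('k::{finite,linorder}, 'k) rmat"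
  assumes U: "openin (top_of_set (coord_space I)) U"
    and an: "\<And>x i j. x \<in> U \<Longrightarrow> analytic_at I (\<lambda>y. P y $ i $ j) x"
    and pd: "\<And>x. x \<in> U \<Longrightarrow> pos_def (P x)" and x: "x \<in> U"
  shows "is_cholesky (P x) (cholesky (P x))" "analytic_at I (\<lambda>y. cholesky (P y) $ i $ j) x"
proof -
  have "U \<subseteq> coord_space I" using U by (rule openin_imp_subset)
  from analytic_cholesky_partial[OF this an pd finite, of UNIV]
  obtain S R where SR: "\<forall>x\<in>U.
     (\<forall>i j. analytic_at I (\<lambda>y. S y $ i $ j) x) \<and> (\<forall>i j. analytic_at I (\<lambda>y. R i y $ j) x) \<and>
     P x = S x + (\<Sum>i\<in>UNIV. outer (R i x) (R i x)) \<and> transpose (S x) = S x \<and>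
     (\<forall>a\<in>UNIV. \<forall>b. S x $ a $ b = 0) \<and>
     (\<forall>v. v \<noteq> 0 \<longrightarrow> supported_off UNIV v \<longrightarrow> v \<bullet> (S x *v v) > 0) \<and>
     (\<forall>a\<in>UNIV. R a x $ a > 0 \<and> (\<forall>j<a. R a x $ j = 0))"
    by auto
  have ch: "is_cholesky (P y) (\<chi> i. R i y)" if y: "y \<in> U" for y
  proof -
    have "P y = S y + (\<Sum>i\<in>UNIV. outer (R i y) (R i y))" "\<forall>a b. S y $ a $ b = 0" using bspec[OF SR y] by blast+
    then have "P y = transpose (\<chi> i. R i y) ** (\<chi> i. R i y)"
      by (simp add: vec_eq_iff outer_def matrix_matrix_mult_def transpose_def)
    then show ?thesis using bspec[OF SR y] by (simp add: is_cholesky_def)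
  qed
  have eq: "cholesky (P y) = (\<chi> i. R i y)" if y: "y \<in> U" for y
    unfolding cholesky_def is_cholesky_def[symmetric]
    by (rule the_equality) (use ch[OF y] is_cholesky_unique in blast)+
  show "is_cholesky (P x) (cholesky (P x))" using ch x eq by simp
  show "analytic_at I (\<lambda>y. cholesky (P y) $ i $ j) x"
  proof (rule analytic_at_cong[OF U x])
    show "R i y $ j = cholesky (P y) $ i $ j" if "y \<in> U" for y using eq[OF that] by simp
    show "analytic_at I (\<lambda>y. R i y $ j) x" using bspec[OF SR x] by blast
  qed
qed

section \<open>Gauge freedom and cyclic symmetric families\<close>

lemma matrix_scaleR_left: "(c *\<^sub>R A) ** B = c *\<^sub>R (A ** B)" for A :: "real^'b^'a" and B :: "real^'c^'b"
  by (simp add: matrix_matrix_mult_def vec_eq_iff sum_distrib_left mult.assoc)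

lemma matrix_scaleR_right: "A ** (c *\<^sub>R B) = c *\<^sub>R (A ** B)" for A :: "real^'b^'a" and B :: "real^'c^'b"
  by (simp add: matrix_matrix_mult_def vec_eq_iff sum_distrib_left mult_ac)

lemma matrix_add_rdistrib: "(A + B) ** C = A ** C + B ** C" for A :: "real^'b^'a" and C :: "real^'c^'b"
  by (simp add: matrix_matrix_mult_def vec_eq_iff distrib_right sum.distrib)

lemma matrix_sum_right: "A ** (\<Sum>i\<in>S. f i) = (\<Sum>i\<in>S. A ** f i)" for A :: "real^'b^'a" and f :: "'i \<Rightarrow> real^'c^'b"
  by (induction S rule: infinite_finite_induct) (auto simp: matrix_add_ldistrib)

lemma col_add: "col (A + B) = col A + col B" by (simp add: col_def vec_eq_iff)
lemma col_scaleR: "col (c *\<^sub>R A) = c *\<^sub>R col A" by (simp add: col_def vec_eq_iff)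
lemma col_sum: "col (\<Sum>i\<in>S. f i) = (\<Sum>i\<in>S. col (f i))"
  by (simp add: col_def vec_eq_iff)

lemma basis_family_coords:
  assumes "basis_family b d V"
  shows "v \<in> V \<longleftrightarrow> (\<exists>\<mu>. v = (\<Sum>l=1..d. \<mu> l *\<^sub>R b l))"
proof
  have inj: "inj_on b {1..d}" and V: "V = span (b ` {1..d})" using assms by (auto simp: basis_family_def)
  { assume "v \<in> V"
    then have "v \<in> range (\<lambda>u. \<Sum>w\<in>b ` {1..d}. u w *\<^sub>R w)" unfolding V by (subst (asm) span_finite) auto
    then obtain u where "v = (\<Sum>w\<in>b ` {1..d}. u w *\<^sub>R w)" by auto
    then have "v = (\<Sum>l=1..d. u (b l) *\<^sub>R b l)" by (simp only: sum.reindex[OF inj] o_def)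
    then show "\<exists>\<mu>. v = (\<Sum>l=1..d. \<mu> l *\<^sub>R b l)" by (intro exI[of _ "\<lambda>l. u (b l)"]) }
  { assume "\<exists>\<mu>. v = (\<Sum>l=1..d. \<mu> l *\<^sub>R b l)"
    then show "v \<in> V" unfolding V
      by (elim exE, simp only:) (intro span_sum span_scale span_base imageI) }
qed

lemma basis_family_range: "basis_family b d V \<Longrightarrow> range (\<lambda>\<mu>. \<Sum>l=1..d. \<mu> l *\<^sub>R b l) = V"
  using basis_family_coords by blast

text \<open>A quadratic form vanishes identically if and only if its matrix is antisymmetric.\<close>

lemma gauge_space_iff: "K \<in> gauge_space \<longleftrightarrow> (\<forall>r i j. K $ r $ (i, j) = - K $ r $ (j, i))"
proof -
  define M where "M r = (\<chi> i j. K $ r $ (i, j))" for r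
  have eq: "(K *v vkron w w) $ r = w \<bullet> (M r *v w)" for w r
    by (simp add: matrix_vector_mult_def vkron_def sum_UNIV_pair inner_vec_def M_def sum_distrib_left mult_ac)
  show ?thesis
  proof
    assume "K \<in> gauge_space"
    then have z: "w \<bullet> (M r *v w) = 0" for w r unfolding gauge_space_def eq[symmetric] by simp
    have ax: "axis a 1 \<bullet> (M r *v axis b 1) = K $ r $ (a, b)" for a b r
      by (simp add: inner_axis' matrix_vector_mul_component) (simp add: inner_axis M_def)
    show "\<forall>r i j. K $ r $ (i, j) = - K $ r $ (j, i)"
    proof (intro allI)
      fix r i j
      have "0 = (axis i 1 + axis j 1) \<bullet> (M r *v (axis i 1 + axis j 1))" by (simp only: z)
      also have "\<dots> = K $ r $ (i, j) + K $ r $ (j, i)"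
        using z[of "axis i 1" r] z[of "axis j 1" r]
        by (simp add: matrix_vector_right_distrib inner_add_left inner_add_right ax)
      finally show "K $ r $ (i, j) = - K $ r $ (j, i)" by simp
    qed
  next
    assume a: "\<forall>r i j. K $ r $ (i, j) = - K $ r $ (j, i)"
    have "(K *v vkron w w) $ r = 0" for w r
    proof -
      have "(K *v vkron w w) $ r = (\<Sum>i\<in>UNIV. \<Sum>j\<in>UNIV. K $ r $ (i, j) * (w $ i * w $ j))"
        by (simp add: matrix_vector_mult_def vkron_def sum_UNIV_pair)
      also have "\<dots> = (\<Sum>j\<in>UNIV. \<Sum>i\<in>UNIV. K $ r $ (i, j) * (w $ i * w $ j))" by (rule sum.swap)
      also have "\<dots> = (\<Sum>j\<in>UNIV. \<Sum>i\<in>UNIV. - (K $ r $ (j, i) * (w $ j * w $ i)))"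
        using a by (intro sum.cong refl) (metis mult.commute mult_minus_left)
      also have "\<dots> = - (K *v vkron w w) $ r"
        by (simp add: matrix_vector_mult_def vkron_def sum_UNIV_pair sum_negf)
      finally show ?thesis by simp
    qed
    then show "K \<in> gauge_space" by (simp add: gauge_space_def vec_eq_iff)
  qed
qed

definition sym_blocks :: "real^'k^'k \<Rightarrow> real^('k \<times> 'k)^'k \<Rightarrow> real^'k^'k^'k" where
  "sym_blocks P K = (\<chi> i. transpose (Mblock K i) ** P + P ** Mblock K i)"

lemma sym_blocks_add: "sym_blocks P (K + L) = sym_blocks P K + sym_blocks P L"
  by (simp add: sym_blocks_def Mblock_def vec_eq_iff matrix_matrix_mult_def transpose_def distrib_right distrib_left sum.distrib)

text \<open>Put \<open>T\<^sub>k\<^sub>i\<^sub>j = (P M\<^sub>i)\<^sub>k\<^sub>j\<close>, which is antisymmetric in \<open>i, j\<close> for a gauge matrix. The symmetrized blocks are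
  \<open>B\<^sub>i\<^sub>j\<^sub>k = T\<^sub>k\<^sub>i\<^sub>j + T\<^sub>j\<^sub>i\<^sub>k\<close>, and the cyclic sum cancels in pairs. Conversely \<open>T\<^sub>k\<^sub>i\<^sub>j = (B\<^sub>i\<^sub>j\<^sub>k - B\<^sub>j\<^sub>i\<^sub>k) / 3\<close>
  is antisymmetric and recovers a cyclic \<open>B\<close>; since \<open>P\<close> is invertible, it comes from a gauge matrix.\<close>

lemma sym_blocks_gauge:
  fixes P :: "real^'k^'k"
  assumes sym: "transpose P = P" and inv: "invertible P"
  shows "sym_blocks P ` gauge_space = cyclic_space"
proof
  have symP: "P $ a $ b = P $ b $ a" for a b
    using arg_cong[OF sym, of "\<lambda>M. M $ b $ a"] by (simp add: transpose_def)
  have comp: "sym_blocks P K $ i $ j $ k = (P ** Mblock K i) $ k $ j + (P ** Mblock K i) $ j $ k" for K i j k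
  proof -
    have "(transpose (Mblock K i) ** P) $ j $ k = (P ** Mblock K i) $ k $ j"
      unfolding matrix_matrix_mult_def transpose_def vec_lambda_beta
      by (intro sum.cong refl) (metis symP mult.commute)
    then show ?thesis by (simp add: sym_blocks_def)
  qed
  show "sym_blocks P ` gauge_space \<subseteq> cyclic_space"
  proof clarify
    fix K :: "real^('k \<times> 'k)^'k" assume "K \<in> gauge_space"
    then have K: "K $ r $ (i, j) = - K $ r $ (j, i)" for r i j unfolding gauge_space_iff by blast
    define T where "T k i j = (P ** Mblock K i) $ k $ j" for k i j
    have anti: "T k i j = - T k j i" for k i j
      unfolding T_def matrix_matrix_mult_def Mblock_def vec_lambda_beta sum_negf[symmetric]
      by (intro sum.cong refl) (subst K, rule mult_minus_right)
    have B: "sym_blocks P K $ i $ j $ k = T k i j + T j i k" for i j k by (simp add: comp T_def)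
    have "transpose (sym_blocks P K $ i) = sym_blocks P K $ i" for i
      by (simp add: vec_eq_iff transpose_def B)
    moreover have "sym_blocks P K $ i $ j $ k + sym_blocks P K $ j $ k $ i + sym_blocks P K $ k $ i $ j = 0" for i j k
      unfolding B using anti[of k i j] anti[of j i k] anti[of i j k] by simp
    ultimately show "sym_blocks P K \<in> cyclic_space" by (simp add: cyclic_space_def)
  qed
  show "cyclic_space \<subseteq> sym_blocks P ` gauge_space"
  proof
    fix B :: "real^'k^'k^'k" assume B: "B \<in> cyclic_space"
    have Bs: "B $ i $ j $ k = B $ i $ k $ j" for i j k
    proof -
      have "transpose (B $ i) = B $ i" using B by (simp add: cyclic_space_def)
      from arg_cong[OF this, of "\<lambda>M. M $ k $ j"] show ?thesis by (simp add: transpose_def)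
    qed
    have Bc: "B $ i $ j $ k + B $ j $ k $ i + B $ k $ i $ j = 0" for i j k
      using B by (simp add: cyclic_space_def)
    define T :: "'k \<Rightarrow> real^'k^'k" where "T i = (\<chi> k j. (B $ i $ j $ k - B $ j $ i $ k) / 3)" for i
    define M where "M i = matrix_inv P ** T i" for i
    define K :: "real^('k \<times> 'k)^'k" where "K = (\<chi> r p. M (fst p) $ r $ snd p)"
    have MK: "Mblock K i = M i" for i by (simp add: Mblock_def K_def vec_eq_iff)
    have PM: "P ** M i = T i" for i
      by (simp add: M_def matrix_mul_assoc matrix_inv_mult[OF inv])
    have "K $ r $ (i, j) = - K $ r $ (j, i)" for r i j
      by (simp add: K_def M_def matrix_matrix_mult_def T_def flip: sum_negf) (simp add: algebra_simps diff_divide_distrib)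
    then have "K \<in> gauge_space" unfolding gauge_space_iff by blast
    moreover have "sym_blocks P K = B"
    proof -
      have "sym_blocks P K $ i $ j $ k = B $ i $ j $ k" for i j k
        unfolding comp MK PM using Bs[of i j k] Bs[of j i k] Bs[of k i j] Bc[of i j k]
        by (simp add: T_def field_simps)
      then show ?thesis by (simp add: vec_eq_iff)
    qed
    ultimately show "B \<in> sym_blocks P ` gauge_space" by blast
  qed
qed

lemma pos_def_invertible: "pos_def P \<Longrightarrow> invertible P" for P :: "real^'k^'k"
  unfolding pos_def_def invertible_left_inverse matrix_left_invertible_ker
  by (metis inner_zero_right less_irrefl)

lemma kron_mult: "kron A B ** kron C D = kron (A ** C) (B ** D)"
  for A :: "real^'b^'a" and B :: "real^'e^'d" and C :: "real^'c^'b" and D :: "real^'f^'e"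
proof -
  have "(\<Sum>q\<in>UNIV. (A $ a $ fst q * B $ b $ snd q) * (C $ fst q $ c * D $ snd q $ d))
     = (\<Sum>x\<in>UNIV. A $ a $ x * C $ x $ c) * (\<Sum>y\<in>UNIV. B $ b $ y * D $ y $ d)" for a b c d
    unfolding sum_UNIV_pair sum_product by (intro sum.cong refl) (simp add: mult_ac)
  then show ?thesis by (simp add: kron_def matrix_matrix_mult_def vec_eq_iff)
qed

lemma kron_transpose: "transpose (kron A B) = kron (transpose A) (transpose B)"
  by (simp add: kron_def transpose_def vec_eq_iff)

lemma kron_mat_1: "kron (mat 1) (mat 1) = mat 1"
  by (auto simp: kron_def mat_def vec_eq_iff prod_eq_iff)

lemma kron_invertible:
  fixes A :: "real^'a^'a"
  assumes "invertible A" shows "invertible (kron A (mat 1 :: real^'b^'b))"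
  unfolding invertible_def
  using matrix_inv_mult[OF assms]
  by (intro exI[of _ "kron (matrix_inv A) (mat 1)"]) (simp add: kron_mult kron_mat_1)

lemma is_cholesky_invertible:
  assumes "is_cholesky P R" "pos_def P" shows "invertible R"
proof -
  have "invertible (transpose R ** R)" using assms pos_def_invertible by (auto simp: is_cholesky_def)
  then have "det (transpose R ** R) \<noteq> 0" unfolding invertible_det_nz .
  then have "det R \<noteq> 0" by (metis det_mul mult_zero_right)
  then show ?thesis unfolding invertible_det_nz .
qed

section \<open>Analytic dependence on the gain\<close>

locale stabilized_family =
  fixes S :: "('n::{finite,linorder}, 'k::{finite,linorder}) lifted_system"
    and U :: "'k rvec set"
  assumes lift: "inner_quadratic_lift S"
    and U_open: "openin (top_of_set (gain_space S)) U"
    and U_sub: "U \<subseteq> hurwitz_gains S"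
begin

abbreviation "I \<equiv> lift_idx S"

lemma U_openin: "openin (top_of_set (coord_space I)) U"
  using U_open by (simp add: gain_space_def)

lemma U_coord: "\<Lambda> \<in> U \<Longrightarrow> \<Lambda> \<in> coord_space I"
  using U_openin openin_imp_subset by blast

lemma gain_hurwitz: "\<Lambda> \<in> U \<Longrightarrow> hurwitz (gain_A S \<Lambda>)"
  using U_sub by (auto simp: hurwitz_gains_def)

lemma lyapQ_cramer: "\<Lambda> \<in> U \<Longrightarrow> pos_def Q \<Longrightarrow> lyapQ S Q \<Lambda> = lyap_cramer (gain_A S \<Lambda>) Q"
  unfolding lyapQ_def by (rule lyap_sol_eq_cramer[OF gain_hurwitz])

lemma lyapQ_pos_def: "\<Lambda> \<in> U \<Longrightarrow> pos_def Q \<Longrightarrow> pos_def (lyapQ S Q \<Lambda>)"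
  by (simp add: lyapQ_cramer lyapunov_pos_def[OF gain_hurwitz])

lemma lyapQ_equation:
  "\<Lambda> \<in> U \<Longrightarrow> pos_def Q \<Longrightarrow> transpose (gain_A S \<Lambda>) ** lyapQ S Q \<Lambda> + lyapQ S Q \<Lambda> ** gain_A S \<Lambda> = - Q"
  using lyapunov_iff_cramer[OF gain_hurwitz] lyapQ_cramer by blast

lemma pos_def_mat_1: "pos_def (mat 1 :: real^'a^'a)"
  by (simp add: pos_def_def)

lemma gain_A_component: "gain_A S \<Lambda> $ i $ j = A0 S $ i $ j - (\<Sum>k\<in>I. \<Lambda> $ k * (outer (axis k 1) (axis k 1) :: ('k, 'k) rmat) $ i $ j)"
  by (simp add: gain_A_def)

lemma analytic_gain_A: "\<Lambda> \<in> coord_space I \<Longrightarrow> analytic_at I (\<lambda>\<Lambda>. gain_A S \<Lambda> $ i $ j) \<Lambda>"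
  unfolding gain_A_component
  by (intro analytic_at_diff analytic_at_sum analytic_at_mult analytic_at_const analytic_at_coord)

lemma analytic_lyapQ:
  assumes L: "\<Lambda> \<in> U" and Q: "pos_def Q"
  shows "analytic_at I (\<lambda>\<Lambda>. lyapQ S Q \<Lambda> $ i $ j) \<Lambda>"
proof (rule analytic_at_cong[OF U_openin L])
  show "lyap_cramer (gain_A S \<Lambda>) Q $ i $ j = lyapQ S Q \<Lambda> $ i $ j" if "\<Lambda> \<in> U" for \<Lambda>
    using lyapQ_cramer[OF that Q] by simp
  note c = U_coord[OF L]
  have m: "analytic_at I (\<lambda>\<Lambda>. lyap_matrix (gain_A S \<Lambda>) $ p $ q) \<Lambda>" for p q
    unfolding lyap_matrix_def vec_lambda_beta
    by (intro analytic_at_add c; cases "snd p = snd q"; cases "fst p = fst q")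
      (simp_all add: analytic_gain_A analytic_at_const c)
  have "analytic_at I (\<lambda>\<Lambda>. if q = (i, j) then - Q $ fst p $ snd p else lyap_matrix (gain_A S \<Lambda>) $ p $ q) \<Lambda>" for p q
    by (cases "q = (i, j)") (simp_all add: m analytic_at_const c)
  then show "analytic_at I (\<lambda>\<Lambda>. lyap_cramer (gain_A S \<Lambda>) Q $ i $ j) \<Lambda>"
    unfolding lyap_cramer_def vec_lambda_beta
    using lyap_matrix_det_nz[OF gain_hurwitz[OF L]]
    by (intro analytic_at_divide analytic_at_det c m) auto
qed

lemmas lyapP_pos_def = lyapQ_pos_def[OF _ pos_def_mat_1]
lemmas analytic_lyapP = analytic_lyapQ[OF _ pos_def_mat_1]

lemma Pf_cholesky: "\<Lambda> \<in> U \<Longrightarrow> is_cholesky (lyapP S \<Lambda>) (Pf S \<Lambda>)"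
  unfolding Pf_def by (rule cholesky_analytic(1)[OF U_openin analytic_lyapP lyapP_pos_def])

lemma analytic_Pf: "\<Lambda> \<in> U \<Longrightarrow> analytic_at I (\<lambda>\<Lambda>. Pf S \<Lambda> $ i $ j) \<Lambda>"
  unfolding Pf_def by (rule cholesky_analytic(2)[OF U_openin analytic_lyapP lyapP_pos_def])

lemma Xmat_invertible: "\<Lambda> \<in> U \<Longrightarrow> invertible (Xmat S \<Lambda>)"
  unfolding Xmat_def using Pf_cholesky lyapP_pos_def
  by (intro kron_invertible transpose_invertible is_cholesky_invertible)

text \<open>This congruence links the block \<open>P \<otimes> 1\<close> of the semidefinite program to \<open>J = X\<^bsup>-1\<^esup> G\<close>.\<close>

lemma Xmat_gram: "\<Lambda> \<in> U \<Longrightarrow> Xmat S \<Lambda> ** transpose (Xmat S \<Lambda>) = kron (lyapP S \<Lambda>) (mat 1)"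
  using Pf_cholesky[of \<Lambda>] by (simp add: Xmat_def kron_transpose kron_mult is_cholesky_def)

lemma analytic_Xmat: "\<Lambda> \<in> U \<Longrightarrow> analytic_at I (\<lambda>\<Lambda>. Xmat S \<Lambda> $ i $ j) \<Lambda>"
  unfolding Xmat_def kron_def transpose_def vec_lambda_beta
  by (intro analytic_at_mult analytic_at_const U_coord analytic_Pf)

lemma analytic_Xinv: "\<Lambda> \<in> U \<Longrightarrow> analytic_at I (\<lambda>\<Lambda>. matrix_inv (Xmat S \<Lambda>) $ i $ j) \<Lambda>"
  by (rule analytic_at_matrix_inv[OF U_openin _ Xmat_invertible analytic_Xmat])

lemma analytic_matrix_mult:
  fixes x :: "real^'p::finite"
  assumes "x \<in> coord_space J" "\<And>i j. analytic_at J (\<lambda>y. F y $ i $ j) x" "\<And>i j. analytic_at J (\<lambda>y. G y $ i $ j) x"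
  shows "analytic_at J (\<lambda>y. (F y ** G y) $ i $ j) x"
  unfolding matrix_matrix_mult_def vec_lambda_beta
  by (intro analytic_at_sum analytic_at_mult assms)

lemma analytic_Gmat: assumes L: "\<Lambda> \<in> U" shows "analytic_at I (\<lambda>\<Lambda>. Gmat S \<Lambda> \<mu> $ i $ j) \<Lambda>"
proof -
  note c = U_coord[OF L]
  have "analytic_at I (\<lambda>\<Lambda>. gain_H S \<Lambda> \<mu> $ a $ b) \<Lambda>" for a b
    unfolding gain_H_def plus_vec_def sum_component vector_scaleR_component vec_lambda_beta real_scaleR_def
    by (intro analytic_at_add analytic_at_sum analytic_at_mult analytic_at_const analytic_at_coord c)
  then show ?thesis
    unfolding Gmat_def col_def vec_lambda_beta plus_vec_def
    by (intro analytic_at_add analytic_matrix_mult c analytic_lyapP L) (simp_all add: transpose_def Mblock_def)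
qed

lemma analytic_Jr: assumes L: "\<Lambda> \<in> U" shows "analytic_at I (\<lambda>\<Lambda>. Jr S \<Lambda> \<nu> $ i $ j) \<Lambda>"
proof -
  note c = U_coord[OF L]
  have "analytic_at I (\<lambda>\<Lambda>. Gr S \<Lambda> \<nu> $ a $ b) \<Lambda>" for a b
    unfolding Gr_def plus_vec_def vec_lambda_beta
    by (intro analytic_at_add analytic_at_const c analytic_Gmat L)
  then show ?thesis unfolding Jr_def by (intro analytic_matrix_mult c analytic_Xinv L)
qed

lemma real_analytic_on_matrix:
  fixes F :: "'k rvec \<Rightarrow> real^'c^'r"
  assumes "\<And>\<Lambda> i j. \<Lambda> \<in> U \<Longrightarrow> analytic_at I (\<lambda>\<Lambda>. F \<Lambda> $ i $ j) \<Lambda>"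
  shows "real_analytic_on I U F"
  by (intro real_analytic_on_vec real_analytic_on_real assms)

section \<open>The value function\<close>

lemma Gmat_split: "Gmat S \<Lambda> \<mu> = Gmat S \<Lambda> (\<lambda>_. 0) + col (sym_blocks (lyapP S \<Lambda>) (\<Sum>l=1..gdim S. \<mu> l *\<^sub>R gbasis S l))"
proof -
  have G: "Gmat S \<Lambda> \<mu> = col (sym_blocks (lyapP S \<Lambda>) (gain_H S \<Lambda> \<mu>))" for \<mu>
    by (simp add: Gmat_def sym_blocks_def)
  have "gain_H S \<Lambda> \<mu> = gain_H S \<Lambda> (\<lambda>_. 0) + (\<Sum>l=1..gdim S. \<mu> l *\<^sub>R gbasis S l)"
    by (simp add: gain_H_def)
  then show ?thesis by (simp only: G sym_blocks_add col_add)
qed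

lemma Gmat_range:
  assumes "\<Lambda> \<in> U" shows "range (Gmat S \<Lambda>) = range (Gr S \<Lambda>)"
proof -
  have gb: "basis_family (gbasis S) (gdim S) gauge_space" and rb: "basis_family (rbasis S) (rdim S) cyclic_space"
    using lift by (auto simp: inner_quadratic_lift_def)
  have sg: "sym_blocks (lyapP S \<Lambda>) ` gauge_space = cyclic_space"
    using lyapP_pos_def[OF assms] by (intro sym_blocks_gauge pos_def_invertible) (auto simp: pos_def_def)
  have "range (Gmat S \<Lambda>) = (\<lambda>K. Gmat S \<Lambda> (\<lambda>_. 0) + col (sym_blocks (lyapP S \<Lambda>) K)) ` gauge_space"
    unfolding basis_family_range[OF gb, symmetric] image_image by (rule image_cong[OF refl]) (rule Gmat_split)
  also have "\<dots> = (\<lambda>B. Gmat S \<Lambda> (\<lambda>_. 0) + col B) ` cyclic_space" unfolding sg[symmetric] by (simp add: image_image)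
  also have "\<dots> = range (Gr S \<Lambda>)"
    unfolding basis_family_range[OF rb, symmetric] image_image
    by (rule image_cong[OF refl]) (simp add: Gr_def col_sum col_scaleR)
  finally show ?thesis .
qed

lemma Jmat_range: assumes "\<Lambda> \<in> U" shows "range (Jmat S \<Lambda>) = range (Jr S \<Lambda>)"
proof -
  have "range (Jmat S \<Lambda>) = (\<lambda>G. matrix_inv (Xmat S \<Lambda>) ** G) ` range (Gmat S \<Lambda>)"
    by (auto simp: Jmat_def)
  also have "\<dots> = range (Jr S \<Lambda>)" unfolding Gmat_range[OF assms] by (auto simp: Jr_def)
  finally show ?thesis .
qed

text \<open>The gauge problem and the reduced problem minimize over the same set of matrices.\<close>

lemma phi_eq: assumes "\<Lambda> \<in> U" shows "phi S \<Lambda> = (INF \<nu>. spec_norm (Jr S \<Lambda> \<nu>))"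
proof -
  have "range (\<lambda>\<mu>. spec_norm (Jmat S \<Lambda> \<mu>)) = spec_norm ` range (Jmat S \<Lambda>)" by (simp add: image_image)
  also have "\<dots> = range (\<lambda>\<nu>. spec_norm (Jr S \<Lambda> \<nu>))" unfolding Jmat_range[OF assms] by (simp add: image_image)
  finally show ?thesis by (simp add: phi_def)
qed

lemma phi_bdd: "bdd_below (range (\<lambda>\<nu>. spec_norm (Jr S \<Lambda> \<nu>)))"
  by (rule bdd_belowI[of _ 0]) (auto simp: spec_norm_nonneg)

lemma phi_le: "\<Lambda> \<in> U \<Longrightarrow> phi S \<Lambda> \<le> spec_norm (Jr S \<Lambda> \<nu>)"
  unfolding phi_eq by (rule cINF_lower[OF phi_bdd]) simp

lemma phi_nonneg: "\<Lambda> \<in> U \<Longrightarrow> phi S \<Lambda> \<ge> 0"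
  unfolding phi_eq by (rule cINF_greatest) (auto simp: spec_norm_nonneg)

lemma phi_approx: "\<Lambda> \<in> U \<Longrightarrow> e > 0 \<Longrightarrow> \<exists>\<nu>. spec_norm (Jr S \<Lambda> \<nu>) < phi S \<Lambda> + e"
  using cINF_less_iff[OF _ phi_bdd[of \<Lambda>], of "phi S \<Lambda> + e"] by (simp add: phi_eq)

text \<open>The definition of a minimizer compares reduced points, the value is an infimum over gauge points.\<close>

lemma reduced_minimizer_iff: assumes L: "\<Lambda> \<in> U" shows "reduced_minimizer S \<Lambda> \<nu> \<longleftrightarrow> spec_norm (Jr S \<Lambda> \<nu>) = phi S \<Lambda>"
proof
  assume "reduced_minimizer S \<Lambda> \<nu>"
  then have "spec_norm (Jr S \<Lambda> \<nu>) \<le> phi S \<Lambda>"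
    unfolding phi_eq[OF L] reduced_minimizer_def by (intro cINF_greatest) auto
  then show "spec_norm (Jr S \<Lambda> \<nu>) = phi S \<Lambda>" using phi_le[OF L] by (simp add: antisym)
qed (use phi_le[OF L] in \<open>simp add: reduced_minimizer_def\<close>)

lemma Jr_split: "Jr S \<Lambda> \<nu> = Jmat S \<Lambda> (\<lambda>_. 0) + (\<Sum>l=1..rdim S. \<nu> l *\<^sub>R Jbasis S \<Lambda> l)"
  by (simp add: Jr_def Gr_def Jmat_def Jbasis_def matrix_add_ldistrib matrix_sum_right matrix_scaleR_right)

lemma Wspace_eq: assumes L: "\<Lambda> \<in> U" shows "Wspace S \<Lambda> = range (\<lambda>\<nu>. \<Sum>l=1..rdim S. \<nu> l *\<^sub>R Jbasis S \<Lambda> l)"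
proof -
  have "Wspace S \<Lambda> = (\<lambda>J. J - Jmat S \<Lambda> (\<lambda>_. 0)) ` range (Jmat S \<Lambda>)" by (auto simp: Wspace_def)
  also have "\<dots> = range (\<lambda>\<nu>. \<Sum>l=1..rdim S. \<nu> l *\<^sub>R Jbasis S \<Lambda> l)"
    unfolding Jmat_range[OF L] by (auto simp: Jr_split image_iff)
  finally show ?thesis .
qed

lemma Wspace_orthogonal_iff: assumes L: "\<Lambda> \<in> U"
  shows "Z \<in> (Wspace S \<Lambda>)\<^sup>\<bottom> \<longleftrightarrow> (\<forall>l\<in>{1..rdim S}. Z \<bullet> Jbasis S \<Lambda> l = 0)"
proof
  assume Z: "Z \<in> (Wspace S \<Lambda>)\<^sup>\<bottom>"
  show "\<forall>l\<in>{1..rdim S}. Z \<bullet> Jbasis S \<Lambda> l = 0"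
  proof
    fix l assume l: "l \<in> {1..rdim S}"
    have "(\<Sum>j=1..rdim S. (if j = l then 1 else 0) *\<^sub>R Jbasis S \<Lambda> j) \<in> Wspace S \<Lambda>"
      unfolding Wspace_eq[OF L] by (rule rangeI)
    then have "Jbasis S \<Lambda> l \<in> Wspace S \<Lambda>" using l by (simp add: if_distrib[of "\<lambda>c. c *\<^sub>R _"] cong: if_cong)
    then have "Jbasis S \<Lambda> l \<bullet> Z = 0" using Z by (simp add: orthogonal_comp_def orthogonal_def)
    then show "Z \<bullet> Jbasis S \<Lambda> l = 0" by (simp add: inner_commute)
  qed
next
  assume "\<forall>l\<in>{1..rdim S}. Z \<bullet> Jbasis S \<Lambda> l = 0"
  then show "Z \<in> (Wspace S \<Lambda>)\<^sup>\<bottom>"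
    by (auto simp: orthogonal_comp_def orthogonal_def Wspace_eq[OF L] inner_sum_left inner_commute[of _ Z])
qed

end

section \<open>Derivatives along a coordinate subspace\<close>

lemma inner_transpose: "transpose A \<bullet> transpose B = A \<bullet> B" for A B :: "real^'c^'r"
  unfolding inner_vec_def transpose_def vec_lambda_beta by (rule sum.swap)

lemma norm_transpose: "norm (transpose A) = norm A" for A :: "real^'c^'r"
  by (simp add: norm_eq_sqrt_inner inner_transpose)

text \<open>The columns of \<open>J ** q\<close> are the images of the columns of \<open>q\<close>.\<close>

lemma norm_matrix_mult_le_spec: "norm (J ** q) \<le> spec_norm J * norm q" for J :: "real^'b^'a" and q :: "real^'c^'b"
proof -
  have "transpose (J ** q) $ c = J *v (transpose q $ c)" for c
    by (simp add: vec_eq_iff matrix_vector_mult_def matrix_matrix_mult_def transpose_def)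
  then have "norm (transpose (J ** q)) = L2_set (\<lambda>c. norm (J *v (transpose q $ c))) UNIV"
    by (simp add: norm_vec_def)
  also have "\<dots> \<le> L2_set (\<lambda>c. spec_norm J * norm (transpose q $ c)) UNIV"
    by (intro L2_set_mono norm_matrix_vector_le) auto
  also have "\<dots> = spec_norm J * norm (transpose q)"
    by (simp add: norm_vec_def[of "transpose q"] L2_set_right_distrib spec_norm_nonneg)
  finally show ?thesis by (simp add: norm_transpose)
qed

lemma norm_matrix_mult_le: "norm (A ** B) \<le> norm A * norm B" for A :: "real^'b^'a" and B :: "real^'c^'b"
  using norm_matrix_mult_le_spec[of A B] mult_right_mono[OF spec_norm_le_norm[of A], of "norm B"] by simp

lemma norm_le_spec: "norm M \<le> norm (mat 1 :: real^'c^'c) * spec_norm M" for M :: "real^'c^'r"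
  using norm_matrix_mult_le_spec[of M "mat 1"] by (simp add: mult.commute)

lemma matrix_mult_bounded_bilinear: "bounded_bilinear ((**) :: real^'b^'a \<Rightarrow> real^'c^'b \<Rightarrow> real^'c^'a)"
  by (rule bounded_bilinear.intro)
    (auto simp: matrix_add_rdistrib matrix_add_ldistrib matrix_scaleR_left matrix_scaleR_right
      intro!: exI[of _ 1] norm_matrix_mult_le)

lemma transpose_bounded_linear: "bounded_linear (transpose :: real^'c^'r \<Rightarrow> real^'r^'c)"
  by (rule bounded_linear_intro[of _ 1]) (auto simp: transpose_add transpose_scalar norm_transpose)

lemma linear_kron_left: "linear (\<lambda>A :: real^'a^'a. kron A (mat 1 :: real^'b^'b))"
  by (rule linearI) (auto simp: kron_def vec_eq_iff distrib_right)

lemma has_derivative_vec: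
  fixes f :: "'a::real_normed_vector \<Rightarrow> 'b::euclidean_space^'n"
  assumes "\<And>i. ((\<lambda>x. f x $ i) has_derivative (\<lambda>h. f' h $ i)) (at a within S)"
  shows "(f has_derivative f') (at a within S)"
proof (subst has_derivative_componentwise_within, rule ballI)
  fix b :: "'b^'n" assume "b \<in> Basis"
  then obtain i u where "b = axis i u" by (auto simp: Basis_vec_def)
  then show "((\<lambda>x. f x \<bullet> b) has_derivative (\<lambda>x. f' x \<bullet> b)) (at a within S)"
    using has_derivative_inner_left[OF assms[of i], of u] by (simp add: inner_axis)
qed

lemma analytic_matrix_derivative:
  fixes F :: "real^'p::finite \<Rightarrow> real^'c^'r"
  assumes x: "x \<in> coord_space I" and F: "\<And>i j. analytic_at I (\<lambda>y. F y $ i $ j) x"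
  obtains F' where "(F has_derivative F') (at x within coord_space I)"
proof -
  have "\<exists>D. ((\<lambda>y. F y $ i $ j) has_derivative (\<lambda>h. D \<bullet> h)) (at x within coord_space I)" for i j
    using analytic_at_has_derivative[OF x F[of i j]] by blast
  then obtain D where D: "\<And>i j. ((\<lambda>y. F y $ i $ j) has_derivative (\<lambda>h. D i j \<bullet> h)) (at x within coord_space I)"
    by metis
  have "(F has_derivative (\<lambda>h. \<chi> i j. D i j \<bullet> h)) (at x within coord_space I)"
    by (intro has_derivative_vec) (simp add: D)
  then show thesis by (rule that)
qed

lemma axis_in_coord_space: "i \<in> I \<Longrightarrow> axis i 1 \<in> coord_space I"
  by (auto simp: coord_space_def axis_def)

lemma subspace_coord_space: "subspace (coord_space I)"
  by (auto simp: coord_space_def subspace_def)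

lemma has_derivative_along_line:
  assumes F: "(F has_derivative F') (at x within V)" and V: "subspace V" "x \<in> V" and h: "h \<in> V"
  shows "((\<lambda>t. F (x + t *\<^sub>R h)) has_vector_derivative F' h) (at 0)"
proof -
  let ?g = "\<lambda>t::real. x + t *\<^sub>R h"
  have g: "(?g has_derivative (\<lambda>t. t *\<^sub>R h)) (at 0)"
    by (auto intro!: derivative_eq_intros)
  have "range ?g \<subseteq> V"
    using V(2) h by (auto intro!: subspace_add[OF V(1)] subspace_scale[OF V(1)])
  then have "(F has_derivative F') (at (?g 0) within range ?g)"
    using F by (auto intro: has_derivative_subset)
  from has_derivative_in_compose[OF g this]
  have "((\<lambda>t. F (?g t)) has_derivative (\<lambda>t. F' (t *\<^sub>R h))) (at 0)" by simp
  moreover have "F' (t *\<^sub>R h) = t *\<^sub>R F' h" for t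
    using has_derivative_bounded_linear[OF F] by (simp add: bounded_linear.linear linear_scale)
  ultimately show ?thesis by (simp add: has_vector_derivative_def)
qed

lemma has_derivative_along_axis:
  assumes F: "(F has_derivative F') (at x within coord_space I)" and x: "x \<in> coord_space I" and i: "i \<in> I"
  shows "((\<lambda>t. F (x + t *\<^sub>R axis i 1)) has_vector_derivative F' (axis i 1)) (at 0)"
  by (rule has_derivative_along_line[OF F subspace_coord_space x axis_in_coord_space[OF i]])

lemma partial_eq_derivative:
  assumes "(F has_derivative F') (at x within coord_space I)" "x \<in> coord_space I" "i \<in> I"
  shows "partial F x i = F' (axis i 1)"
  unfolding partial_def by (rule vector_derivative_at) (rule has_derivative_along_axis[OF assms])

lemma analytic_has_partial:
  fixes F :: "real^'p::finite \<Rightarrow> real^'c^'r"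
  assumes x: "x \<in> coord_space I" and F: "\<And>i j. analytic_at I (\<lambda>y. F y $ i $ j) x" and i: "i \<in> I"
  shows "((\<lambda>t. F (x + t *\<^sub>R axis i 1)) has_vector_derivative partial F x i) (at 0)"
proof -
  obtain F' where F': "(F has_derivative F') (at x within coord_space I)"
    using x F by (rule analytic_matrix_derivative)
  show ?thesis using has_derivative_along_axis[OF F' x i] partial_eq_derivative[OF F' x i] by simp
qed

lemma coord_space_expansion: "h \<in> coord_space I \<Longrightarrow> h = (\<Sum>i\<in>I. h $ i *\<^sub>R axis i 1)"
  by (auto simp: vec_eq_iff coord_space_def axis_def if_distrib[of "\<lambda>x. _ * x"] cong: if_cong)

lemma derivative_coord_expansion:
  assumes F: "(F has_derivative F') (at x within coord_space I)" and x: "x \<in> coord_space I" and h: "h \<in> coord_space I"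
  shows "F' h = (\<Sum>i\<in>I. h $ i *\<^sub>R partial F x i)"
proof -
  have lin: "linear F'" using F has_derivative_linear by blast
  have "F' h = (\<Sum>i\<in>I. h $ i *\<^sub>R F' (axis i 1))"
    by (subst coord_space_expansion[OF h]) (simp add: linear_sum[OF lin] linear_scale[OF lin])
  then show ?thesis using partial_eq_derivative[OF F x] by simp
qed

definition locally_lipschitz_at :: "'k::finite set \<Rightarrow> (real^'k \<Rightarrow> 'b::real_normed_vector) \<Rightarrow> real^'k \<Rightarrow> bool" where
  "locally_lipschitz_at I f x \<longleftrightarrow> (\<exists>d>0. \<exists>L\<ge>0. \<forall>y\<in>coord_space I \<inter> ball x d. \<forall>z\<in>coord_space I \<inter> ball x d.
     norm (f y - f z) \<le> L * norm (y - z))"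

lemma norm_vec_le_sum: "norm v \<le> (\<Sum>i\<in>UNIV. norm (v $ i))"
  unfolding norm_vec_def by (rule L2_set_le_sum) simp

lemma locally_lipschitz_at_vec:
  fixes f :: "real^'k::finite \<Rightarrow> 'b::real_normed_vector^'n"
  assumes "\<And>j. locally_lipschitz_at I (\<lambda>y. f y $ j) x"
  shows "locally_lipschitz_at I f x"
proof -
  define Pr where "Pr j d L \<longleftrightarrow> (\<forall>y\<in>coord_space I \<inter> ball x d. \<forall>z\<in>coord_space I \<inter> ball x d.
     norm (f y $ j - f z $ j) \<le> L * norm (y - z))" for j d L
  have "\<exists>d>0. \<exists>L\<ge>0. Pr j d L" for j
    using assms[of j] unfolding locally_lipschitz_at_def Pr_def .
  then obtain d L where d: "\<And>j. d j > (0::real)" and L: "\<And>j. L j \<ge> (0::real)" and P: "\<And>j. Pr j (d j) (L j)"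
    by metis
  have "norm (f y - f z) \<le> (\<Sum>j\<in>UNIV. L j) * norm (y - z)"
    if y: "y \<in> coord_space I \<inter> ball x (Min (range d))" and z: "z \<in> coord_space I \<inter> ball x (Min (range d))" for y z
  proof -
    have "norm (f y $ j - f z $ j) \<le> L j * norm (y - z)" for j
      using P[of j] y z unfolding Pr_def by auto
    then have "(\<Sum>j\<in>UNIV. norm ((f y - f z) $ j)) \<le> (\<Sum>j\<in>UNIV. L j * norm (y - z))"
      by (intro sum_mono) simp
    then show ?thesis using norm_vec_le_sum[of "f y - f z"] by (simp add: sum_distrib_right)
  qed
  moreover have "Min (range d) > 0" using d by simp
  moreover have "(\<Sum>j\<in>UNIV. L j) \<ge> 0" using L by (simp add: sum_nonneg)
  ultimately show ?thesis unfolding locally_lipschitz_at_def by blast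
qed

lemma analytic_matrix_lipschitz:
  fixes F :: "real^'p::finite \<Rightarrow> real^'c^'r"
  assumes x: "x \<in> coord_space I" and F: "\<And>i j. analytic_at I (\<lambda>y. F y $ i $ j) x"
  shows "locally_lipschitz_at I F x"
proof (intro locally_lipschitz_at_vec)
  fix i j show "locally_lipschitz_at I (\<lambda>y. F y $ i $ j) x"
    unfolding locally_lipschitz_at_def real_norm_def by (rule analytic_at_lipschitz[OF x F])
qed

text \<open>The coordinates with respect to independent vectors are given by linear functionals.\<close>

lemma basis_family_coefficient_bound:
  fixes b :: "nat \<Rightarrow> 'v::euclidean_space"
  assumes "basis_family b d V"
  obtains C where "C \<ge> 0" "\<And>\<nu>. L2_set \<nu> {1..d} \<le> C * norm (\<Sum>l=1..d. \<nu> l *\<^sub>R b l)"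
proof -
  have inj: "inj_on b {1..d}" and ind: "independent (b ` {1..d})" using assms by (auto simp: basis_family_def)
  have "\<exists>g. linear g \<and> (\<forall>j\<in>{1..d}. g (b j) = (if j = l then 1 else 0 :: real))" for l
  proof -
    obtain g where g: "linear g" "\<forall>x\<in>b ` {1..d}. g x = (if the_inv_into {1..d} b x = l then 1 else 0 :: real)"
      using linear_independent_extend[OF ind, of "\<lambda>x. if the_inv_into {1..d} b x = l then 1 else 0 :: real"] by blast
    then show ?thesis using the_inv_into_f_f[OF inj] by (intro exI[of _ g]) auto
  qed
  then obtain g where g: "\<And>l. linear (g l)" and gb: "\<And>l j. j \<in> {1..d} \<Longrightarrow> g l (b j) = (if j = l then 1 else 0 :: real)"
    by metis
  define C where "C = (\<Sum>l=1..d. onorm (g l))"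
  have bl: "bounded_linear (g l)" for l using g linear_conv_bounded_linear by blast
  show thesis
  proof (rule that[of C])
    show "C \<ge> 0" unfolding C_def by (intro sum_nonneg onorm_pos_le bl)
    fix \<nu> :: "nat \<Rightarrow> real"
    define v where "v = (\<Sum>l=1..d. \<nu> l *\<^sub>R b l)"
    have co: "\<nu> l = g l v" if "l \<in> {1..d}" for l
    proof -
      have "g l v = (\<Sum>j=1..d. \<nu> j * g l (b j))"
        unfolding v_def by (simp add: linear_sum[OF g] linear_scale[OF g])
      also have "\<dots> = (\<Sum>j=1..d. if j = l then \<nu> l else 0)" by (intro sum.cong refl) (auto simp: gb)
      finally show ?thesis using that by simp
    qed
    have "L2_set \<nu> {1..d} \<le> (\<Sum>l=1..d. \<bar>\<nu> l\<bar>)" by (rule L2_set_le_sum_abs)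
    also have "\<dots> \<le> (\<Sum>l=1..d. onorm (g l) * norm v)"
    proof (rule sum_mono)
      fix l assume "l \<in> {1..d}"
      then show "\<bar>\<nu> l\<bar> \<le> onorm (g l) * norm v" using co onorm[OF bl[of l], of v] by simp
    qed
    finally show "L2_set \<nu> {1..d} \<le> C * norm (\<Sum>l=1..d. \<nu> l *\<^sub>R b l)" by (simp add: C_def v_def sum_distrib_right)
  qed
qed

lemma norm_col: "norm (col B) = norm B"
  by (simp add: norm_eq_sqrt_inner inner_vec_def col_def sum_UNIV_pair)

context stabilized_family begin

lemma eventually_line_in_U:
  assumes L: "\<Lambda> \<in> U" and i: "h \<in> coord_space I"
  shows "\<forall>\<^sub>F t in at (0::real). \<Lambda> + t *\<^sub>R h \<in> U"
proof -
  obtain r where r: "r > 0" "ball \<Lambda> r \<inter> coord_space I \<subseteq> U"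
    using U_openin L by (auto simp: openin_contains_ball)
  have "((\<lambda>t. \<Lambda> + t *\<^sub>R h) \<longlongrightarrow> \<Lambda> + 0 *\<^sub>R h) (at (0::real))" by (intro tendsto_intros)
  then have "\<forall>\<^sub>F t in at (0::real). dist (\<Lambda> + t *\<^sub>R h) \<Lambda> < r"
    using r(1) by (simp add: tendsto_iff)
  then show ?thesis
  proof eventually_elim
    case (elim t)
    have "\<Lambda> + t *\<^sub>R h \<in> coord_space I"
      using U_coord[OF L] i by (intro subspace_add subspace_scale subspace_coord_space)
    then show ?case using r(2) elim by (auto simp: dist_commute)
  qed
qed

lemma line_derivative_unique:
  assumes L: "\<Lambda> \<in> U" and i: "i \<in> I" and eq: "\<And>\<Lambda>. \<Lambda> \<in> U \<Longrightarrow> f \<Lambda> = g \<Lambda>"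
    and f: "((\<lambda>t. f (\<Lambda> + t *\<^sub>R axis i 1)) has_vector_derivative a) (at 0)"
    and g: "((\<lambda>t. g (\<Lambda> + t *\<^sub>R axis i 1)) has_vector_derivative b) (at 0)"
  shows "a = b"
proof -
  have ev: "\<forall>\<^sub>F t in at (0::real). f (\<Lambda> + t *\<^sub>R axis i 1) = g (\<Lambda> + t *\<^sub>R axis i 1)"
    using eventually_line_in_U[OF L axis_in_coord_space[OF i]] by eventually_elim (rule eq)
  have "((\<lambda>t. g (\<Lambda> + t *\<^sub>R axis i 1)) has_vector_derivative a) (at 0)"
    using f unfolding has_vector_derivative_def
    by (rule has_derivative_transform_eventually) (use ev eq[OF L] in auto)
  then show ?thesis using g by (rule vector_derivative_unique_at)
qed

lemma partial_gain_A: "i \<in> I \<Longrightarrow> \<Lambda> \<in> U \<Longrightarrow>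
    ((\<lambda>t. gain_A S (\<Lambda> + t *\<^sub>R axis i 1)) has_vector_derivative partial (gain_A S) \<Lambda> i) (at 0)"
  by (rule analytic_has_partial[OF U_coord analytic_gain_A[OF U_coord]])

text \<open>Differentiate the Lyapunov equation, which holds identically near the gain.\<close>

lemma lyapQ_derivative_equation:
  assumes L: "\<Lambda> \<in> U" and i: "i \<in> I" and Q: "pos_def Q"
  shows "transpose (gain_A S \<Lambda>) ** partial (lyapQ S Q) \<Lambda> i + partial (lyapQ S Q) \<Lambda> i ** gain_A S \<Lambda>
     = - (transpose (partial (gain_A S) \<Lambda> i) ** lyapQ S Q \<Lambda> + lyapQ S Q \<Lambda> ** partial (gain_A S) \<Lambda> i)"
proof -
  note bb = bounded_bilinear.has_vector_derivative[OF matrix_mult_bounded_bilinear]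
  note A = partial_gain_A[OF i L]
  note At = bounded_linear.has_vector_derivative[OF transpose_bounded_linear A]
  note P = analytic_has_partial[OF U_coord[OF L] analytic_lyapQ[OF L Q] i]
  have "transpose (gain_A S \<Lambda>) ** partial (lyapQ S Q) \<Lambda> i + transpose (partial (gain_A S) \<Lambda> i) ** lyapQ S Q \<Lambda>
     + (lyapQ S Q \<Lambda> ** partial (gain_A S) \<Lambda> i + partial (lyapQ S Q) \<Lambda> i ** gain_A S \<Lambda>) = 0"
    by (rule line_derivative_unique[OF L i lyapQ_equation[OF _ Q]])
      (use has_vector_derivative_add[OF bb[OF At P] bb[OF P A]] in simp_all)
  then show ?thesis by (simp only: eq_neg_iff_add_eq_0 add_ac)
qed

text \<open>Differentiate \<open>X X\<^sup>T = P \<otimes> 1\<close>.\<close>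

lemma Xmat_gram_derivative:
  assumes L: "\<Lambda> \<in> U" and i: "i \<in> I"
  shows "Xmat S \<Lambda> ** transpose (partial (Xmat S) \<Lambda> i) + partial (Xmat S) \<Lambda> i ** transpose (Xmat S \<Lambda>)
    = kron (partial (lyapP S) \<Lambda> i) (mat 1)"
proof -
  note bb = bounded_bilinear.has_vector_derivative[OF matrix_mult_bounded_bilinear]
  note X = analytic_has_partial[OF U_coord[OF L] analytic_Xmat[OF L] i]
  note Xt = bounded_linear.has_vector_derivative[OF transpose_bounded_linear X]
  note P = analytic_has_partial[OF U_coord[OF L] analytic_lyapP[OF L] i]
  have "bounded_linear (\<lambda>A :: ('k, 'k) rmat. kron A (mat 1 :: ('k, 'k) rmat))"
    using linear_kron_left linear_conv_bounded_linear by blast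
  note K = bounded_linear.has_vector_derivative[OF this P]
  show ?thesis
    by (rule line_derivative_unique[OF L i Xmat_gram]) (use bb[OF X Xt] K in simp_all)
qed

lemma Xmat_Jr: "\<Lambda> \<in> U \<Longrightarrow> Xmat S \<Lambda> ** Jr S \<Lambda> \<nu> = Gr S \<Lambda> \<nu>"
  by (simp add: Jr_def matrix_mul_assoc matrix_inv_mult[OF Xmat_invertible])

text \<open>Differentiate \<open>X J = G\<close>; with \<open>\<nu>\<close> held fixed, the reduced shift of \<open>G\<close> is constant.\<close>

lemma Jr_derivative:
  assumes L: "\<Lambda> \<in> U" and i: "i \<in> I"
  shows "Xmat S \<Lambda> ** partial (\<lambda>\<Lambda>'. Jr S \<Lambda>' \<nu>) \<Lambda> i + partial (Xmat S) \<Lambda> i ** Jr S \<Lambda> \<nu>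
    = partial (\<lambda>\<Lambda>'. Gmat S \<Lambda>' (\<lambda>_. 0)) \<Lambda> i"
proof -
  note bb = bounded_bilinear.has_vector_derivative[OF matrix_mult_bounded_bilinear]
  note X = analytic_has_partial[OF U_coord[OF L] analytic_Xmat[OF L] i]
  note J = analytic_has_partial[OF U_coord[OF L] analytic_Jr[OF L] i]
  note G = analytic_has_partial[OF U_coord[OF L] analytic_Gmat[OF L] i]
  have "((\<lambda>t. Gr S (\<Lambda> + t *\<^sub>R axis i 1) \<nu>) has_vector_derivative partial (\<lambda>\<Lambda>'. Gmat S \<Lambda>' (\<lambda>_. 0)) \<Lambda> i) (at 0)"
    unfolding Gr_def using has_vector_derivative_add[OF G has_vector_derivative_const] by simp
  then show ?thesis
    by (intro line_derivative_unique[OF L i Xmat_Jr]) (use bb[OF X J] in simp_all)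
qed

section \<open>Local Lipschitz continuity of the value\<close>

definition reduced_shift :: "(nat \<Rightarrow> real) \<Rightarrow> ('k \<times> 'k, 'k) rmat" where
  "reduced_shift \<nu> = (\<Sum>l=1..rdim S. \<nu> l *\<^sub>R col (rbasis S l))"

lemma Jr_shift: "Jr S \<Lambda> \<nu> = Jr S \<Lambda> (\<lambda>_. 0) + matrix_inv (Xmat S \<Lambda>) ** reduced_shift \<nu>"
  by (simp add: Jr_def Gr_def reduced_shift_def matrix_add_ldistrib)

lemma reduced_shift_eq: "\<Lambda> \<in> U \<Longrightarrow> reduced_shift \<nu> = Xmat S \<Lambda> ** (Jr S \<Lambda> \<nu> - Jr S \<Lambda> (\<lambda>_. 0))"
  by (simp add: Jr_shift[of \<Lambda> \<nu>] matrix_mul_assoc matrix_inv_mult[OF Xmat_invertible])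

text \<open>Near a gain, \<open>X\<close>, its inverse and \<open>J\<^sub>r(\<cdot>, 0)\<close> are bounded and Lipschitz. A near minimizer satisfies
  \<open>\<parallel>J\<^sub>r\<parallel> \<le> \<phi> + 1 \<le> \<parallel>J\<^sub>r(\<cdot>, 0)\<parallel> + 1\<close>, and its shift is \<open>X (J\<^sub>r - J\<^sub>r(\<cdot>, 0))\<close>, hence bounded; on bounded shifts
  \<open>J\<^sub>r\<close> is uniformly Lipschitz in the gain.\<close>

lemma local_bounds:
  assumes L0: "\<Lambda>\<^sub>0 \<in> U"
  obtains \<epsilon> L R where "\<epsilon> > 0" "L \<ge> 0"
    "\<And>\<Lambda> \<nu>. \<Lambda> \<in> U \<inter> ball \<Lambda>\<^sub>0 \<epsilon> \<Longrightarrow> spec_norm (Jr S \<Lambda> \<nu>) \<le> phi S \<Lambda> + 1 \<Longrightarrow> norm (reduced_shift \<nu>) \<le> R"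
    "\<And>\<Lambda> \<Lambda>' \<nu>. \<Lambda> \<in> U \<inter> ball \<Lambda>\<^sub>0 \<epsilon> \<Longrightarrow> \<Lambda>' \<in> U \<inter> ball \<Lambda>\<^sub>0 \<epsilon> \<Longrightarrow> norm (reduced_shift \<nu>) \<le> R \<Longrightarrow>
       norm (Jr S \<Lambda>' \<nu> - Jr S \<Lambda> \<nu>) \<le> L * norm (\<Lambda>' - \<Lambda>)"
proof -
  note c = U_coord[OF L0]
  have "locally_lipschitz_at I (Xmat S) \<Lambda>\<^sub>0"
    by (rule analytic_matrix_lipschitz[OF c analytic_Xmat[OF L0]])
  then obtain d1 L1 where d1: "d1 > 0" "L1 \<ge> 0" and X: "\<And>y z. y \<in> coord_space I \<inter> ball \<Lambda>\<^sub>0 d1 \<Longrightarrow> z \<in> coord_space I \<inter> ball \<Lambda>\<^sub>0 d1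
     \<Longrightarrow> norm (Xmat S y - Xmat S z) \<le> L1 * norm (y - z)" unfolding locally_lipschitz_at_def by blast
  have "locally_lipschitz_at I (\<lambda>\<Lambda>. matrix_inv (Xmat S \<Lambda>)) \<Lambda>\<^sub>0"
    by (rule analytic_matrix_lipschitz[OF c analytic_Xinv[OF L0]])
  then obtain d2 L2 where d2: "d2 > 0" "L2 \<ge> 0" and Xi: "\<And>y z. y \<in> coord_space I \<inter> ball \<Lambda>\<^sub>0 d2 \<Longrightarrow> z \<in> coord_space I \<inter> ball \<Lambda>\<^sub>0 d2
     \<Longrightarrow> norm (matrix_inv (Xmat S y) - matrix_inv (Xmat S z)) \<le> L2 * norm (y - z)" unfolding locally_lipschitz_at_def by blast
  have "locally_lipschitz_at I (\<lambda>\<Lambda>. Jr S \<Lambda> (\<lambda>_. 0)) \<Lambda>\<^sub>0"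
    by (rule analytic_matrix_lipschitz[OF c analytic_Jr[OF L0]])
  then obtain d3 L3 where d3: "d3 > 0" "L3 \<ge> 0" and J: "\<And>y z. y \<in> coord_space I \<inter> ball \<Lambda>\<^sub>0 d3 \<Longrightarrow> z \<in> coord_space I \<inter> ball \<Lambda>\<^sub>0 d3
     \<Longrightarrow> norm (Jr S y (\<lambda>_. 0) - Jr S z (\<lambda>_. 0)) \<le> L3 * norm (y - z)" unfolding locally_lipschitz_at_def by blast
  define \<epsilon> where "\<epsilon> = min 1 (min d1 (min d2 d3))"
  define CX where "CX = norm (Xmat S \<Lambda>\<^sub>0) + L1"
  define CJ where "CJ = norm (Jr S \<Lambda>\<^sub>0 (\<lambda>_. 0)) + L3"
  \<comment> \<open>The Frobenius norm is at most \<open>s\<close> times the spectral norm.\<close>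
  define s where "s = norm (mat 1 :: ('k, 'k) rmat)"
  define R where "R = CX * (s * (2 * CJ + 1))"
  have \<epsilon>: "\<epsilon> > 0" "\<epsilon> \<le> 1" "\<epsilon> \<le> d1" "\<epsilon> \<le> d2" "\<epsilon> \<le> d3" using d1 d2 d3 by (auto simp: \<epsilon>_def)
  have dom: "\<Lambda> \<in> coord_space I \<inter> ball \<Lambda>\<^sub>0 d1" "\<Lambda> \<in> coord_space I \<inter> ball \<Lambda>\<^sub>0 d2" "\<Lambda> \<in> coord_space I \<inter> ball \<Lambda>\<^sub>0 d3"
    "norm (\<Lambda> - \<Lambda>\<^sub>0) \<le> 1" if "\<Lambda> \<in> U \<inter> ball \<Lambda>\<^sub>0 \<epsilon>" for \<Lambda>
    using that U_coord \<epsilon> by (auto simp: dist_norm norm_minus_commute)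
  have z: "\<Lambda>\<^sub>0 \<in> U \<inter> ball \<Lambda>\<^sub>0 \<epsilon>" using L0 \<epsilon> by simp
  have bX: "norm (Xmat S \<Lambda>) \<le> CX" and bJ: "norm (Jr S \<Lambda> (\<lambda>_. 0)) \<le> CJ" if L: "\<Lambda> \<in> U \<inter> ball \<Lambda>\<^sub>0 \<epsilon>" for \<Lambda>
  proof -
    have "norm (Xmat S \<Lambda> - Xmat S \<Lambda>\<^sub>0) \<le> L1 * norm (\<Lambda> - \<Lambda>\<^sub>0)" by (rule X[OF dom(1)[OF L] dom(1)[OF z]])
    also have "\<dots> \<le> L1" using dom(4)[OF L] d1 by (simp add: mult_left_le)
    finally show "norm (Xmat S \<Lambda>) \<le> CX" using norm_triangle_sub[of "Xmat S \<Lambda>" "Xmat S \<Lambda>\<^sub>0"] by (simp add: CX_def)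
    have "norm (Jr S \<Lambda> (\<lambda>_. 0) - Jr S \<Lambda>\<^sub>0 (\<lambda>_. 0)) \<le> L3 * norm (\<Lambda> - \<Lambda>\<^sub>0)" by (rule J[OF dom(3)[OF L] dom(3)[OF z]])
    also have "\<dots> \<le> L3" using dom(4)[OF L] d3 by (simp add: mult_left_le)
    finally show "norm (Jr S \<Lambda> (\<lambda>_. 0)) \<le> CJ" using norm_triangle_sub[of "Jr S \<Lambda> (\<lambda>_. 0)" "Jr S \<Lambda>\<^sub>0 (\<lambda>_. 0)"] by (simp add: CJ_def)
  qed
  have CJ: "CJ \<ge> 0" and CX: "CX \<ge> 0" using d1 d3 by (auto simp: CJ_def CX_def)
  have R0: "R \<ge> 0" using CJ CX by (simp add: R_def s_def)
  show thesis
  proof (rule that[of \<epsilon> "L3 + L2 * R" R])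
    show "\<epsilon> > 0" by fact
    show "L3 + L2 * R \<ge> 0" using d2 d3 R0 by simp
  next
    fix \<Lambda> \<nu> assume L: "\<Lambda> \<in> U \<inter> ball \<Lambda>\<^sub>0 \<epsilon>" and le: "spec_norm (Jr S \<Lambda> \<nu>) \<le> phi S \<Lambda> + 1"
    have LU: "\<Lambda> \<in> U" using L by simp
    define D where "D = Jr S \<Lambda> \<nu> - Jr S \<Lambda> (\<lambda>_. 0)"
    have J0: "spec_norm (Jr S \<Lambda> (\<lambda>_. 0)) \<le> CJ" using spec_norm_le_norm bJ[OF L] order_trans by blast
    have "spec_norm D \<le> spec_norm (Jr S \<Lambda> \<nu>) + spec_norm (Jr S \<Lambda> (\<lambda>_. 0))"
      using spec_norm_triangle[of "Jr S \<Lambda> \<nu>" "(-1) *\<^sub>R Jr S \<Lambda> (\<lambda>_. 0)"] by (simp only: spec_norm_scaleR) (simp add: D_def)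
    also have "\<dots> \<le> 2 * CJ + 1" using le phi_le[OF LU, of "\<lambda>_. 0"] J0 by simp
    finally have "norm D \<le> s * (2 * CJ + 1)"
      using norm_le_spec[of D] mult_left_mono[of "spec_norm D" "2 * CJ + 1" s] by (simp add: s_def)
    then have "norm (Xmat S \<Lambda>) * norm D \<le> R"
      unfolding R_def using bX[OF L] CX by (intro mult_mono) auto
    then show "norm (reduced_shift \<nu>) \<le> R"
      using norm_matrix_mult_le[of "Xmat S \<Lambda>" D] unfolding reduced_shift_eq[OF LU, of \<nu>] D_def by simp
  next
    fix \<Lambda> \<Lambda>' \<nu> assume L: "\<Lambda> \<in> U \<inter> ball \<Lambda>\<^sub>0 \<epsilon>" and L': "\<Lambda>' \<in> U \<inter> ball \<Lambda>\<^sub>0 \<epsilon>" and r: "norm (reduced_shift \<nu>) \<le> R"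
    have "Jr S \<Lambda>' \<nu> - Jr S \<Lambda> \<nu> = (Jr S \<Lambda>' (\<lambda>_. 0) - Jr S \<Lambda> (\<lambda>_. 0))
        + (matrix_inv (Xmat S \<Lambda>') - matrix_inv (Xmat S \<Lambda>)) ** reduced_shift \<nu>"
      using matrix_add_rdistrib[of "matrix_inv (Xmat S \<Lambda>') - matrix_inv (Xmat S \<Lambda>)" "matrix_inv (Xmat S \<Lambda>)" "reduced_shift \<nu>"]
      by (subst (1 2) Jr_shift) simp
    then have "norm (Jr S \<Lambda>' \<nu> - Jr S \<Lambda> \<nu>) \<le> norm (Jr S \<Lambda>' (\<lambda>_. 0) - Jr S \<Lambda> (\<lambda>_. 0))
        + norm ((matrix_inv (Xmat S \<Lambda>') - matrix_inv (Xmat S \<Lambda>)) ** reduced_shift \<nu>)"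
      by (simp only: norm_triangle_ineq)
    also have "\<dots> \<le> norm (Jr S \<Lambda>' (\<lambda>_. 0) - Jr S \<Lambda> (\<lambda>_. 0))
        + norm (matrix_inv (Xmat S \<Lambda>') - matrix_inv (Xmat S \<Lambda>)) * norm (reduced_shift \<nu>)"
      by (rule add_left_mono) (rule norm_matrix_mult_le)
    also have "\<dots> \<le> L3 * norm (\<Lambda>' - \<Lambda>) + (L2 * norm (\<Lambda>' - \<Lambda>)) * R"
      using r d2 by (intro add_mono mult_mono J Xi dom L L') auto
    finally show "norm (Jr S \<Lambda>' \<nu> - Jr S \<Lambda> \<nu>) \<le> (L3 + L2 * R) * norm (\<Lambda>' - \<Lambda>)" by (simp add: algebra_simps)
  qed
qed

text \<open>Evaluate \<open>J\<^sub>r\<close> at the gain \<open>\<Lambda>'\<close> with an \<open>e\<close>-minimizer for \<open>\<Lambda>\<close>, and let \<open>e\<close> tend to 0.\<close>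

lemma phi_locally_lipschitz: "locally_lipschitz_on U (phi S)"
  unfolding locally_lipschitz_on_def
proof
  fix \<Lambda>\<^sub>0 assume "\<Lambda>\<^sub>0 \<in> U"
  then obtain \<epsilon> L R where \<epsilon>: "\<epsilon> > 0" "L \<ge> 0" and
    R: "\<And>\<Lambda> \<nu>. \<Lambda> \<in> U \<inter> ball \<Lambda>\<^sub>0 \<epsilon> \<Longrightarrow> spec_norm (Jr S \<Lambda> \<nu>) \<le> phi S \<Lambda> + 1 \<Longrightarrow> norm (reduced_shift \<nu>) \<le> R" and
    Lp: "\<And>\<Lambda> \<Lambda>' \<nu>. \<Lambda> \<in> U \<inter> ball \<Lambda>\<^sub>0 \<epsilon> \<Longrightarrow> \<Lambda>' \<in> U \<inter> ball \<Lambda>\<^sub>0 \<epsilon> \<Longrightarrow> norm (reduced_shift \<nu>) \<le> R \<Longrightarrow>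
       norm (Jr S \<Lambda>' \<nu> - Jr S \<Lambda> \<nu>) \<le> L * norm (\<Lambda>' - \<Lambda>)"
    by (rule local_bounds) blast
  have one: "phi S \<Lambda>' \<le> phi S \<Lambda> + L * norm (\<Lambda>' - \<Lambda>)"
    if L: "\<Lambda> \<in> U \<inter> ball \<Lambda>\<^sub>0 \<epsilon>" and L': "\<Lambda>' \<in> U \<inter> ball \<Lambda>\<^sub>0 \<epsilon>" for \<Lambda> \<Lambda>'
  proof (rule field_le_epsilon)
    fix e :: real assume e: "e > 0"
    obtain \<nu> where \<nu>: "spec_norm (Jr S \<Lambda> \<nu>) < phi S \<Lambda> + min e 1"
      using phi_approx[of \<Lambda> "min e 1"] L e by auto
    have "norm (reduced_shift \<nu>) \<le> R" using \<nu> by (intro R[OF L]) simp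
    then have "norm (Jr S \<Lambda>' \<nu> - Jr S \<Lambda> \<nu>) \<le> L * norm (\<Lambda>' - \<Lambda>)" by (rule Lp[OF L L'])
    moreover have "phi S \<Lambda>' \<le> spec_norm (Jr S \<Lambda>' \<nu>)" using L' by (intro phi_le) simp
    ultimately show "phi S \<Lambda>' \<le> phi S \<Lambda> + L * norm (\<Lambda>' - \<Lambda>) + e"
      using spec_norm_diff_le[of "Jr S \<Lambda>' \<nu>" "Jr S \<Lambda> \<nu>"] \<nu> by linarith
  qed
  have "L-lipschitz_on (U \<inter> ball \<Lambda>\<^sub>0 \<epsilon>) (phi S)"
  proof (rule lipschitz_onI[OF _ \<epsilon>(2)])
    fix x y assume xy: "x \<in> U \<inter> ball \<Lambda>\<^sub>0 \<epsilon>" "y \<in> U \<inter> ball \<Lambda>\<^sub>0 \<epsilon>"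
    show "dist (phi S x) (phi S y) \<le> L * dist x y"
      using one[OF xy] one[OF xy(2,1)] unfolding dist_norm real_norm_def norm_minus_commute[of y x] by linarith
  qed
  then show "\<exists>\<epsilon>>0. \<exists>L. L-lipschitz_on (U \<inter> ball \<Lambda>\<^sub>0 \<epsilon>) (phi S)" using \<epsilon>(1) by blast
qed

lemma phi_continuous: "continuous_on U (phi S)"
  unfolding continuous_on_eq_continuous_within
proof
  fix x assume x: "x \<in> U"
  then obtain \<epsilon> L where \<epsilon>: "\<epsilon> > 0" "L-lipschitz_on (U \<inter> ball x \<epsilon>) (phi S)"
    using phi_locally_lipschitz unfolding locally_lipschitz_on_def by blast
  have "continuous (at x within U \<inter> ball x \<epsilon>) (phi S)"
    using lipschitz_on_continuous_within[OF \<epsilon>(2)] x \<epsilon>(1) by simp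
  moreover have "at x within U \<inter> ball x \<epsilon> = at x within U"
    using at_within_nhd[of x "ball x \<epsilon>" "U \<inter> ball x \<epsilon>" U] \<epsilon>(1) by auto
  ultimately show "continuous (at x within U) (phi S)" by simp
qed

lemma reduced_minimizers_locally_bounded:
  assumes "\<Lambda>\<^sub>0 \<in> U"
  shows "\<exists>\<epsilon>>0. \<exists>R. \<forall>\<Lambda>\<in>U \<inter> ball \<Lambda>\<^sub>0 \<epsilon>. \<forall>\<nu>. reduced_minimizer S \<Lambda> \<nu> \<longrightarrow> L2_set \<nu> {1..rdim S} \<le> R"
proof -
  have "basis_family (rbasis S) (rdim S) cyclic_space" using lift by (simp add: inner_quadratic_lift_def)
  then obtain C where C: "C \<ge> 0" "\<And>\<nu>. L2_set \<nu> {1..rdim S} \<le> C * norm (\<Sum>l=1..rdim S. \<nu> l *\<^sub>R rbasis S l)"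
    by (rule basis_family_coefficient_bound) blast
  have nb: "norm (reduced_shift \<nu>) = norm (\<Sum>l=1..rdim S. \<nu> l *\<^sub>R rbasis S l)" for \<nu>
    unfolding reduced_shift_def col_scaleR[symmetric] col_sum[symmetric] by (rule norm_col)
  show ?thesis
  proof (rule local_bounds[OF assms])
    fix \<epsilon> L R :: real
    assume \<epsilon>: "\<epsilon> > 0" and
      R: "\<And>\<Lambda> \<nu>. \<Lambda> \<in> U \<inter> ball \<Lambda>\<^sub>0 \<epsilon> \<Longrightarrow> spec_norm (Jr S \<Lambda> \<nu>) \<le> phi S \<Lambda> + 1 \<Longrightarrow> norm (reduced_shift \<nu>) \<le> R"
    have "L2_set \<nu> {1..rdim S} \<le> C * R" if L: "\<Lambda> \<in> U \<inter> ball \<Lambda>\<^sub>0 \<epsilon>" and m: "reduced_minimizer S \<Lambda> \<nu>" for \<Lambda> \<nu>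
    proof -
      have "spec_norm (Jr S \<Lambda> \<nu>) \<le> phi S \<Lambda> + 1" using m L reduced_minimizer_iff[of \<Lambda> \<nu>] by simp
      then have "norm (reduced_shift \<nu>) \<le> R" by (rule R[OF L])
      then have "C * norm (reduced_shift \<nu>) \<le> C * R" using C(1) by (rule mult_left_mono)
      then show ?thesis using C(2)[of \<nu>] by (simp add: nb)
    qed
    then show ?thesis using \<epsilon> by blast
  qed
qed

end

section \<open>Semidefinite duality\<close>

lemma sum_UNIV_Plus: "(\<Sum>i\<in>UNIV. f i) = (\<Sum>a\<in>UNIV. f (Inl a)) + (\<Sum>b\<in>UNIV. f (Inr b))"
  for f :: "'a::finite + 'b::finite \<Rightarrow> 'c::comm_monoid_add"
  unfolding UNIV_Plus_UNIV[symmetric] by (subst sum.Plus) auto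

lemma inner_factor: "(p ** transpose q) \<bullet> M = p \<bullet> (M ** q)"
  for p :: "real^'c^'a" and q :: "real^'c^'b" and M :: "real^'b^'a"
proof -
  have "(\<Sum>b\<in>UNIV. (\<Sum>c\<in>UNIV. p $ a $ c * q $ b $ c) * M $ a $ b)
      = (\<Sum>c\<in>UNIV. p $ a $ c * (\<Sum>b\<in>UNIV. M $ a $ b * q $ b $ c))" for a
    unfolding sum_distrib_left sum_distrib_right
    by (subst sum.swap) (simp add: mult_ac)
  then show ?thesis by (simp add: inner_vec_def matrix_matrix_mult_def transpose_def)
qed

lemma inner_mult_left: "p \<bullet> (X ** r) = (transpose X ** p) \<bullet> r"
  for p :: "real^'c^'a" and r :: "real^'c^'b" and X :: "real^'b^'a"
proof -
  have "p \<bullet> (X ** r) = transpose p \<bullet> (transpose r ** transpose X)"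
    by (simp add: inner_transpose flip: matrix_transpose_mul)
  also have "\<dots> = (transpose p ** X) \<bullet> transpose r"
    using inner_factor[of "transpose r" X "transpose p"] by (simp add: inner_commute)
  also have "\<dots> = (transpose X ** p) \<bullet> r"
    by (metis inner_transpose matrix_transpose_mul transpose_transpose)
  finally show ?thesis .
qed

lemma trace_eq_inner: "trace M = M \<bullet> mat 1" for M :: "real^'n^'n"
  by (simp add: trace_def inner_vec_def mat_def if_distrib[of "\<lambda>x. _ * x"] cong: if_cong)

lemma inner_block22:
  fixes Y :: "real^('a::finite + 'b::finite)^('a + 'b)"
  assumes "transpose Y = Y"
  shows "Y \<bullet> block22 A G (transpose G) D = blk11 Y \<bullet> A + 2 * (blk12 Y \<bullet> G) + blk22 Y \<bullet> D"
proof -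
  have sym: "Y $ Inr b $ Inl a = Y $ Inl a $ Inr b" for a b
    using arg_cong[OF assms, of "\<lambda>M. M $ Inl a $ Inr b"] by (simp add: transpose_def)
  have "(\<Sum>b\<in>UNIV. \<Sum>a\<in>UNIV. Y $ Inl a $ Inr b * G $ a $ b) = (\<Sum>a\<in>UNIV. \<Sum>b\<in>UNIV. Y $ Inl a $ Inr b * G $ a $ b)"
    by (rule sum.swap)
  then show ?thesis
    by (simp add: inner_vec_def sum_UNIV_Plus block22_def blk11_def blk12_def blk22_def transpose_def sym sum.distrib)
qed

definition upper_rows :: "real^'c^('a::finite + 'b::finite) \<Rightarrow> real^'c^'a" where
  "upper_rows B = (\<chi> a. B $ Inl a)"

definition lower_rows :: "real^'c^('a::finite + 'b::finite) \<Rightarrow> real^'c^'b" where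
  "lower_rows B = (\<chi> b. B $ Inr b)"

lemma blocks_of_gram:
  fixes B :: "real^'c^('a::finite + 'b::finite)"
  shows "blk11 (B ** transpose B) = upper_rows B ** transpose (upper_rows B)"
    "blk12 (B ** transpose B) = upper_rows B ** transpose (lower_rows B)"
    "blk22 (B ** transpose B) = lower_rows B ** transpose (lower_rows B)"
  by (simp_all add: vec_eq_iff blk11_def blk12_def blk22_def upper_rows_def lower_rows_def
      matrix_matrix_mult_def transpose_def)

lemma gram_symmetric: "transpose (B ** transpose B) = B ** transpose B" for B :: "real^'c^'r"
  by (simp add: matrix_transpose_mul)

lemma gram_pos_semidef: "pos_semidef (B ** transpose B)" for B :: "real^'c^'r"
proof -
  have "x \<bullet> ((B ** transpose B) *v x) = (transpose B *v x) \<bullet> (transpose B *v x)" for x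
    by (simp only: matrix_vector_mul_assoc[symmetric] inner_matrix_transpose[of x])
  then show ?thesis unfolding pos_semidef_def by (simp add: gram_symmetric)
qed

lemma trace_blk22_gram: "trace (blk22 (B ** transpose B)) = (norm (lower_rows B))\<^sup>2"
  for B :: "real^'c^('a::finite + 'b::finite)"
  by (simp only: blocks_of_gram trace_eq_inner inner_factor matrix_mul_lid power2_norm_eq_inner)

lemma inner_blk12_gram: "blk12 (B ** transpose B) \<bullet> (X ** M) = (transpose X ** upper_rows B) \<bullet> (M ** lower_rows B)"
  for B :: "real^'c^('a::finite + 'b::finite)" and X :: "real^'a^'a"
  unfolding blocks_of_gram inner_factor
  unfolding matrix_mul_assoc[symmetric] inner_mult_left[of "upper_rows B" X] by (rule refl)

lemma inner_blk11_gram: "blk11 (B ** transpose B) \<bullet> (X ** transpose X) = (norm (transpose X ** upper_rows B))\<^sup>2"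
  for B :: "real^'c^('a::finite + 'b::finite)" and X :: "real^'a^'a"
  unfolding blocks_of_gram inner_factor power2_norm_eq_inner
  unfolding matrix_mul_assoc[symmetric] inner_mult_left[of "upper_rows B" X] by (rule refl)

text \<open>All terms are Frobenius products of \<open>p\<close>, \<open>J ** q\<close> and \<open>q\<close>; complete the square in \<open>p\<close>.\<close>

lemma sdp_pairing:
  fixes B :: "real^'c^('a::finite + 'b::finite)" and X :: "real^'a^'a" and J :: "real^'b^'a"
  defines "p \<equiv> transpose X ** upper_rows B" and "q \<equiv> lower_rows B"
  shows "(B ** transpose B) \<bullet> block22 (X ** transpose X) (X ** J) (transpose (X ** J)) (\<tau> *\<^sub>R mat 1)
     = (norm (p + J ** q))\<^sup>2 + \<tau> * (norm q)\<^sup>2 - (norm (J ** q))\<^sup>2"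
proof -
  have "(B ** transpose B) \<bullet> block22 (X ** transpose X) (X ** J) (transpose (X ** J)) (\<tau> *\<^sub>R mat 1)
     = (norm p)\<^sup>2 + 2 * (p \<bullet> (J ** q)) + \<tau> * (norm q)\<^sup>2"
    unfolding inner_block22[OF gram_symmetric] inner_blk11_gram inner_blk12_gram p_def q_def
    using trace_blk22_gram[of B] by (simp add: trace_eq_inner)
  then show ?thesis
    by (simp add: power2_norm_eq_inner inner_add_left inner_add_right inner_commute)
qed

abbreviation column_of :: "real^'n \<Rightarrow> real^1^'n" where "column_of \<equiv> columnvector"

lemma norm_columnvector: "norm (column_of v) = norm v"
  by (simp add: norm_vec_def columnvector_def L2_set_def)

lemma quadratic_form_gram: "z \<bullet> (F *v z) = (column_of z ** transpose (column_of z)) \<bullet> F" for F :: "real^'n^'n"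
proof -
  have "(column_of z ** transpose (column_of z)) \<bullet> F = column_of z \<bullet> column_of (F *v z)"
    unfolding inner_factor by (simp only: dot_rowvector_columnvector)
  also have "\<dots> = z \<bullet> (F *v z)" by (simp add: inner_vec_def columnvector_def)
  finally show ?thesis ..
qed

text \<open>A vector \<open>z = (a, b)\<close> gives the rank-one dual point \<open>z z\<^sup>T\<close>, so the form of the block matrix is
  \<open>\<parallel>X\<^sup>T a + J b\<parallel>\<^sup>2 + \<tau> \<parallel>b\<parallel>\<^sup>2 - \<parallel>J b\<parallel>\<^sup>2\<close>. Since \<open>X\<close> is invertible, \<open>a\<close> can be chosen to cancel the first term.\<close>

lemma schur_pos_semidef:
  fixes X :: "real^'a^'a" and J :: "real^'b^'a"
  assumes X: "invertible X"
  shows "pos_semidef (block22 (X ** transpose X) (X ** J) (transpose (X ** J)) (\<tau> *\<^sub>R mat 1)) \<longleftrightarrow> (spec_norm J)\<^sup>2 \<le> \<tau>"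
    (is "pos_semidef ?F \<longleftrightarrow> _")
proof
  assume psd: "pos_semidef ?F"
  have inv: "invertible (transpose X)" using X by (rule transpose_invertible)
  have key: "(norm (J *v b))\<^sup>2 \<le> \<tau> * (norm b)\<^sup>2" for b
  proof -
    define a where "a = matrix_inv (transpose X) *v (- (J *v b))"
    have Xa: "transpose X *v a = - (J *v b)"
      by (simp add: a_def matrix_vector_mul_assoc matrix_inv_mult[OF inv])
    define z :: "real^('a + 'b)" where "z = (\<chi> i. case i of Inl i \<Rightarrow> a $ i | Inr i \<Rightarrow> b $ i)"
    have u: "upper_rows (column_of z) = column_of a" and l: "lower_rows (column_of z) = column_of b"
      by (simp_all add: upper_rows_def lower_rows_def columnvector_def z_def vec_eq_iff)
    have "0 \<le> z \<bullet> (?F *v z)" using psd by (simp add: pos_semidef_def)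
    also have "\<dots> = (norm (column_of (transpose X *v a) + column_of (J *v b)))\<^sup>2
         + \<tau> * (norm b)\<^sup>2 - (norm (J *v b))\<^sup>2"
      unfolding quadratic_form_gram sdp_pairing u l dot_rowvector_columnvector[symmetric] norm_columnvector by (rule refl)
    also have "column_of (transpose X *v a) + column_of (J *v b) = 0"
      unfolding Xa by (simp add: columnvector_def vec_eq_iff)
    finally show ?thesis by simp
  qed
  obtain b :: "real^'b" where b: "norm b = 1" using vector_choose_size[of 1] by auto
  have t0: "0 \<le> \<tau>" using key[of b] b zero_le_power2 order_trans by (metis mult.right_neutral one_power2)
  have "spec_norm J \<le> sqrt \<tau>"
  proof (rule spec_norm_le)
    fix x show "norm (J *v x) \<le> sqrt \<tau> * norm x"
      using real_le_rsqrt[OF key[of x]] by (simp add: real_sqrt_mult)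
  qed
  then have "(spec_norm J)\<^sup>2 \<le> (sqrt \<tau>)\<^sup>2" by (intro power_mono spec_norm_nonneg)
  then show "(spec_norm J)\<^sup>2 \<le> \<tau>" using t0 by simp
next
  assume le: "(spec_norm J)\<^sup>2 \<le> \<tau>"
  have "z \<bullet> (?F *v z) \<ge> 0" for z
  proof -
    define q where "q = lower_rows (column_of z)"
    have "(norm (J ** q))\<^sup>2 \<le> (spec_norm J * norm q)\<^sup>2"
      by (intro power_mono norm_matrix_mult_le_spec norm_ge_zero)
    also have "\<dots> \<le> \<tau> * (norm q)\<^sup>2" unfolding power_mult_distrib using le by (rule mult_right_mono) simp
    finally have "0 \<le> (norm (transpose X ** upper_rows (column_of z) + J ** q))\<^sup>2 + \<tau> * (norm q)\<^sup>2 - (norm (J ** q))\<^sup>2"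
      by (simp add: add_increasing)
    then show ?thesis unfolding quadratic_form_gram sdp_pairing q_def .
  qed
  moreover have "transpose ?F = ?F"
  proof -
    have "?F $ j $ i = ?F $ i $ j" for i j
      using gram_symmetric[of X] by (cases i; cases j)
        (auto simp: block22_def transpose_def mat_def vec_eq_iff matrix_matrix_mult_def)
    then show ?thesis by (simp add: transpose_def vec_eq_iff)
  qed
  ultimately show "pos_semidef ?F" by (simp add: pos_semidef_def)
qed

lemma nuclear_norm_scaleR_le: "c > 0 \<Longrightarrow> nuclear_norm (c *\<^sub>R Z) \<le> c * nuclear_norm Z" for Z :: "real^'n^'r"
  unfolding nuclear_norm_le_iff using inner_le_nuclear_spec[of Z] by (simp add: mult.assoc)

lemma nuclear_norm_scaleR:
  fixes Z :: "real^'n^'r"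
  assumes "c > 0"
  shows "nuclear_norm (c *\<^sub>R Z) = c * nuclear_norm Z"
proof (rule antisym[OF nuclear_norm_scaleR_le[OF assms]])
  have "nuclear_norm ((1 / c) *\<^sub>R (c *\<^sub>R Z)) \<le> (1 / c) * nuclear_norm (c *\<^sub>R Z)"
    using assms by (intro nuclear_norm_scaleR_le) simp
  then show "c * nuclear_norm Z \<le> nuclear_norm (c *\<^sub>R Z)" using assms by (simp add: field_simps)
qed

lemma nuclear_norm_pos: "nuclear_norm Z > 0" if "Z \<noteq> 0" for Z :: "real^'n^'r"
proof -
  have "0 < Z \<bullet> Z" using that by simp
  also have "\<dots> \<le> nuclear_norm Z * spec_norm Z" by (rule inner_le_nuclear_spec)
  finally show ?thesis using spec_norm_nonneg[of Z] by (simp add: zero_less_mult_iff)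
qed

context stabilized_family begin

lemma Fsdp_factored: "\<Lambda> \<in> U \<Longrightarrow> Fsdp S \<Lambda> \<nu> \<tau> =
   block22 (Xmat S \<Lambda> ** transpose (Xmat S \<Lambda>)) (Xmat S \<Lambda> ** Jr S \<Lambda> \<nu>) (transpose (Xmat S \<Lambda> ** Jr S \<Lambda> \<nu>)) (\<tau> *\<^sub>R mat 1)"
  by (simp add: Fsdp_def Xmat_Jr Xmat_gram)

lemma Fsdp_pos_semidef_iff: "\<Lambda> \<in> U \<Longrightarrow> pos_semidef (Fsdp S \<Lambda> \<nu> \<tau>) \<longleftrightarrow> (spec_norm (Jr S \<Lambda> \<nu>))\<^sup>2 \<le> \<tau>"
  by (simp only: Fsdp_factored schur_pos_semidef Xmat_invertible)

lemma primal_optimum_value: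
  assumes L: "\<Lambda> \<in> U" and po: "primal_optimum S \<Lambda> \<nu> \<tau>"
  shows "spec_norm (Jr S \<Lambda> \<nu>) = phi S \<Lambda>" "\<tau> = (phi S \<Lambda>)\<^sup>2"
proof -
  have le: "(spec_norm (Jr S \<Lambda> \<nu>))\<^sup>2 \<le> \<tau>" and opt: "\<tau> \<le> (spec_norm (Jr S \<Lambda> \<nu>'))\<^sup>2" for \<nu>'
    using po unfolding primal_optimum_def Fsdp_pos_semidef_iff[OF L] by auto
  have "spec_norm (Jr S \<Lambda> \<nu>) \<le> spec_norm (Jr S \<Lambda> \<nu>')" for \<nu>'
    using order_trans[OF le opt[of \<nu>']] spec_norm_nonneg by (rule power2_le_imp_le)
  then have "reduced_minimizer S \<Lambda> \<nu>" by (simp add: reduced_minimizer_def)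
  then show 1: "spec_norm (Jr S \<Lambda> \<nu>) = phi S \<Lambda>" by (simp add: reduced_minimizer_iff[OF L])
  show "\<tau> = (phi S \<Lambda>)\<^sup>2" using le opt[of \<nu>] 1 by simp
qed

lemma Xmat_Jbasis: "\<Lambda> \<in> U \<Longrightarrow> Xmat S \<Lambda> ** Jbasis S \<Lambda> l = col (rbasis S l)"
  by (simp add: Jbasis_def matrix_mul_assoc matrix_inv_mult[OF Xmat_invertible])

lemma Xmat_Jmat0: "\<Lambda> \<in> U \<Longrightarrow> Xmat S \<Lambda> ** Jmat S \<Lambda> \<mu> = Gmat S \<Lambda> \<mu>"
  by (simp add: Jmat_def matrix_mul_assoc matrix_inv_mult[OF Xmat_invertible])

lemma dual_objective_pairing:
  assumes Y: "transpose Y = Y" "trace (blk22 Y) = 1" "\<forall>l\<in>{1..rdim S}. blk12 Y \<bullet> col (rbasis S l) = 0"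
  shows "Y \<bullet> Fsdp S \<Lambda> \<nu> \<tau> = \<tau> - dual_objective S \<Lambda> Y"
proof -
  have "blk12 Y \<bullet> Gr S \<Lambda> \<nu> = blk12 Y \<bullet> Gmat S \<Lambda> (\<lambda>_. 0)"
    unfolding Gr_def inner_add_right inner_sum_right inner_scaleR_right using Y(3) by simp
  moreover have "blk22 Y \<bullet> (\<tau> *\<^sub>R mat 1) = \<tau>" using Y(2) by (simp add: trace_eq_inner)
  ultimately show ?thesis
    unfolding Fsdp_def inner_block22[OF Y(1)] dual_objective_def by simp
qed

lemma weak_duality:
  assumes L: "\<Lambda> \<in> U" and Y: "dual_feasible S Y"
  shows "dual_objective S \<Lambda> Y \<le> (spec_norm (Jr S \<Lambda> \<nu>))\<^sup>2"
proof -
  have psd: "pos_semidef Y" using Y by (simp add: dual_feasible_def)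
  then obtain B :: "('k \<times> 'k + 'k, 'k \<times> 'k + 'k) rmat" where B: "Y = B ** transpose B" by (rule pos_semidef_factorization)
  define q where "q = lower_rows B"
  have "(norm (Jr S \<Lambda> \<nu> ** q))\<^sup>2 \<le> (spec_norm (Jr S \<Lambda> \<nu>) * norm q)\<^sup>2"
    by (intro power_mono norm_matrix_mult_le_spec norm_ge_zero)
  then have "0 \<le> Y \<bullet> Fsdp S \<Lambda> \<nu> ((spec_norm (Jr S \<Lambda> \<nu>))\<^sup>2)"
    unfolding Fsdp_factored[OF L] B sdp_pairing q_def[symmetric] by (simp add: power_mult_distrib add_increasing)
  then show ?thesis
    using dual_objective_pairing[of Y \<Lambda> \<nu>] Y psd by (simp add: dual_feasible_def pos_semidef_def)
qed

lemma dual_objective_le_phi: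
  assumes L: "\<Lambda> \<in> U" and Y: "dual_feasible S Y"
  shows "dual_objective S \<Lambda> Y \<le> (phi S \<Lambda>)\<^sup>2"
proof (rule ccontr)
  assume "\<not> dual_objective S \<Lambda> Y \<le> (phi S \<Lambda>)\<^sup>2"
  then have lt: "(phi S \<Lambda>)\<^sup>2 < dual_objective S \<Lambda> Y" by simp
  define r where "r = sqrt (dual_objective S \<Lambda> Y)"
  have "phi S \<Lambda> < r" unfolding r_def using lt by (rule real_less_rsqrt)
  then obtain \<nu> where "spec_norm (Jr S \<Lambda> \<nu>) < r"
    using phi_approx[OF L, of "r - phi S \<Lambda>"] by auto
  then have "(spec_norm (Jr S \<Lambda> \<nu>))\<^sup>2 < r\<^sup>2" by (intro power_strict_mono spec_norm_nonneg) auto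
  also have "r\<^sup>2 = dual_objective S \<Lambda> Y" using lt by (simp add: r_def less_imp_le[OF order_le_less_trans[OF zero_le_power2]])
  finally show False using weak_duality[OF L Y, of \<nu>] by simp
qed

text \<open>The open ball of radius \<open>\<phi>\<close> and the affine space of all \<open>J\<^sub>r\<close> are disjoint convex sets. A
  separating functional is bounded below on the affine space, hence vanishes on its directions, and
  its dual norm is controlled on the ball; normalize it.\<close>

lemma dual_certificate:
  assumes L: "\<Lambda> \<in> U" and pos: "phi S \<Lambda> > 0"
  obtains Z where "nuclear_norm Z = 1" "\<And>l. l \<in> {1..rdim S} \<Longrightarrow> Z \<bullet> Jbasis S \<Lambda> l = 0" "phi S \<Lambda> \<le> Z \<bullet> Jmat S \<Lambda> (\<lambda>_. 0)"
proof -
  let ?J0 = "Jmat S \<Lambda> (\<lambda>_. 0)"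
  define A where "A = {M :: ('k \<times> 'k, 'k) rmat. spec_norm M < phi S \<Lambda>}"
  define T where "T = range (Jr S \<Lambda>)"
  have "convex A"
  proof (rule convexI)
    fix M N :: "('k \<times> 'k, 'k) rmat" and s t :: real
    assume M: "M \<in> A" "N \<in> A" and st: "0 \<le> s" "0 \<le> t" "s + t = 1"
    have "spec_norm (s *\<^sub>R M + t *\<^sub>R N) \<le> s * spec_norm M + t * spec_norm N"
      using spec_norm_triangle[of "s *\<^sub>R M" "t *\<^sub>R N"] st by (simp add: spec_norm_scaleR)
    also have "\<dots> < phi S \<Lambda>" using M st by (intro convex_bound_lt) (auto simp: A_def)
    finally show "s *\<^sub>R M + t *\<^sub>R N \<in> A" by (simp add: A_def)
  qed
  moreover have "convex T"
  proof (rule convexI)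
    fix M N :: "('k \<times> 'k, 'k) rmat" and s t :: real
    assume M: "M \<in> T" "N \<in> T" and st: "0 \<le> s" "0 \<le> t" "s + t = 1"
    then obtain \<mu> \<nu> where M: "M = Jr S \<Lambda> \<mu>" "N = Jr S \<Lambda> \<nu>" by (auto simp: T_def)
    have "s *\<^sub>R M + t *\<^sub>R N = (s + t) *\<^sub>R ?J0 + (\<Sum>l=1..rdim S. (s * \<mu> l + t * \<nu> l) *\<^sub>R Jbasis S \<Lambda> l)"
      unfolding M Jr_split by (simp add: scaleR_add_right scaleR_add_left scaleR_sum_right sum.distrib)
    also have "\<dots> = Jr S \<Lambda> (\<lambda>l. s * \<mu> l + t * \<nu> l)" unfolding st(3) Jr_split by simp
    finally show "s *\<^sub>R M + t *\<^sub>R N \<in> T" by (simp add: T_def)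
  qed
  moreover have "A \<noteq> {}"
  proof -
    have "spec_norm (0 :: ('k \<times> 'k, 'k) rmat) \<le> 0" by (rule spec_norm_le) simp
    then have "0 \<in> A" using pos by (simp add: A_def)
    then show ?thesis by blast
  qed
  moreover have "T \<noteq> {}" by (simp add: T_def)
  moreover have "A \<inter> T = {}"
  proof -
    have "Jr S \<Lambda> \<nu> \<notin> A" for \<nu> using phi_le[OF L, of \<nu>] by (simp add: A_def)
    then show ?thesis by (auto simp: T_def)
  qed
  ultimately obtain a b where a: "a \<noteq> 0" and aA: "\<forall>x\<in>A. a \<bullet> x \<le> b" and aT: "\<forall>x\<in>T. a \<bullet> x \<ge> b"
    using separating_hyperplane_sets[of A T] by blast
  have J0T: "?J0 + t *\<^sub>R Jbasis S \<Lambda> l \<in> T" if "l \<in> {1..rdim S}" for t l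
  proof -
    have "(\<Sum>j=1..rdim S. (if j = l then t else 0) *\<^sub>R Jbasis S \<Lambda> j) = (\<Sum>j=1..rdim S. if j = l then t *\<^sub>R Jbasis S \<Lambda> l else 0)"
      by (rule sum.cong) auto
    then have "Jr S \<Lambda> (\<lambda>j. if j = l then t else 0) = ?J0 + t *\<^sub>R Jbasis S \<Lambda> l"
      using that unfolding Jr_split by simp
    then show ?thesis unfolding T_def by (metis rangeI)
  qed
  have orth: "a \<bullet> Jbasis S \<Lambda> l = 0" if "l \<in> {1..rdim S}" for l
  proof (rule ccontr)
    assume nz: "a \<bullet> Jbasis S \<Lambda> l \<noteq> 0"
    \<comment> \<open>Otherwise the functional takes the value \<open>b - 1\<close> on the affine space.\<close>
    define t where "t = (b - 1 - a \<bullet> ?J0) / (a \<bullet> Jbasis S \<Lambda> l)"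
    have "b \<le> a \<bullet> (?J0 + t *\<^sub>R Jbasis S \<Lambda> l)" using aT J0T[OF that] by blast
    also have "\<dots> = b - 1" using nz by (simp add: inner_add_right t_def)
    finally show False by simp
  qed
  have "a \<bullet> M \<le> (b / phi S \<Lambda>) * spec_norm M" for M
  proof (cases "M = 0")
    case False
    then have sp: "spec_norm M > 0" by (rule spec_norm_pos)
    have "a \<bullet> M \<le> (b * spec_norm M / phi S \<Lambda>)"
    proof (rule field_le_mult_one_interval)
      fix z :: real assume z: "0 < z" "z < 1"
      have "spec_norm ((z * phi S \<Lambda> / spec_norm M) *\<^sub>R M) = z * phi S \<Lambda>" using z pos sp by (simp add: spec_norm_scaleR)
      then have "(z * phi S \<Lambda> / spec_norm M) *\<^sub>R M \<in> A" using z pos by (simp add: A_def)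
      then have "(z * phi S \<Lambda> / spec_norm M) * (a \<bullet> M) \<le> b" using aA by fastforce
      then show "z * (a \<bullet> M) \<le> b * spec_norm M / phi S \<Lambda>" using sp pos by (simp add: field_simps)
    qed
    then show ?thesis by simp
  qed (simp add: spec_norm_def onorm_zero)
  then have nb: "nuclear_norm a \<le> b / phi S \<Lambda>" unfolding nuclear_norm_le_iff by blast
  have n0: "nuclear_norm a > 0" using a by (rule nuclear_norm_pos)
  define Z where "Z = (1 / nuclear_norm a) *\<^sub>R a"
  show thesis
  proof (rule that[of Z])
    show "nuclear_norm Z = 1" unfolding Z_def using n0 by (simp add: nuclear_norm_scaleR)
    show "Z \<bullet> Jbasis S \<Lambda> l = 0" if "l \<in> {1..rdim S}" for l using orth[OF that] by (simp add: Z_def)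
    have "?J0 = Jr S \<Lambda> (\<lambda>_. 0)" by (simp add: Jr_split)
    then have "b \<le> a \<bullet> ?J0" using aT unfolding T_def by auto
    then have "phi S \<Lambda> * nuclear_norm a \<le> a \<bullet> ?J0" using nb pos by (simp add: field_simps)
    then show "phi S \<Lambda> \<le> Z \<bullet> ?J0" using n0 by (simp add: Z_def field_simps)
  qed
qed

text \<open>The factor \<open>B\<close> of a dual point with prescribed \<open>p = X\<^sup>T B\<^sub>1\<close> and \<open>q = B\<^sub>2\<close>.\<close>

definition dual_factor :: "'k rvec \<Rightarrow> ('k \<times> 'k, 'k) rmat \<Rightarrow> ('k, 'k) rmat \<Rightarrow> ('k \<times> 'k + 'k, 'k) rmat" where
  "dual_factor \<Lambda> p q = (\<chi> i. case i of Inl a \<Rightarrow> (matrix_inv (transpose (Xmat S \<Lambda>)) ** p) $ a | Inr b \<Rightarrow> q $ b)"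

text \<open>For \<open>\<phi> > 0\<close> factor the certificate as \<open>Z = L R\<^sup>T\<close> with \<open>\<parallel>L\<parallel> = \<parallel>R\<parallel> = 1\<close> and take \<open>p = - \<phi> L\<close>, \<open>q = R\<close>: the
  dual objective is \<open>2 \<phi> \<langle>Z, J\<^sub>r(\<Lambda>, 0)\<rangle> - \<phi>\<^sup>2 \<ge> \<phi>\<^sup>2\<close>. For \<open>\<phi> = 0\<close> take \<open>p = 0\<close>.\<close>

lemma strong_duality:
  assumes L: "\<Lambda> \<in> U"
  shows "\<exists>Y. dual_feasible S Y \<and> (phi S \<Lambda>)\<^sup>2 \<le> dual_objective S \<Lambda> Y"
proof -
  let ?X = "Xmat S \<Lambda>" and ?J0 = "Jmat S \<Lambda> (\<lambda>_. 0)"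
  have inv: "invertible (transpose ?X)" using Xmat_invertible[OF L] by (rule transpose_invertible)
  have build: "\<exists>Y. dual_feasible S Y \<and> dual_objective S \<Lambda> Y = - (norm p)\<^sup>2 - 2 * (p \<bullet> (?J0 ** q))"
    if q: "norm q = 1" and orth: "\<And>l. l \<in> {1..rdim S} \<Longrightarrow> p \<bullet> (Jbasis S \<Lambda> l ** q) = 0"
    for p :: "('k \<times> 'k, 'k) rmat" and q :: "('k, 'k) rmat"
  proof -
    define B where "B = dual_factor \<Lambda> p q"
    have u: "transpose ?X ** upper_rows B = p"
    proof -
      have "upper_rows B = matrix_inv (transpose ?X) ** p"
        by (simp add: upper_rows_def B_def dual_factor_def vec_eq_iff)
      then show ?thesis by (simp add: matrix_mul_assoc matrix_inv_mult[OF inv])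
    qed
    have l: "lower_rows B = q" by (simp add: lower_rows_def B_def dual_factor_def vec_eq_iff)
    have "dual_feasible S (B ** transpose B)"
      unfolding dual_feasible_def trace_blk22_gram l
      using gram_pos_semidef[of B] q orth
      by (simp add: Xmat_Jbasis[OF L, symmetric] inner_blk12_gram u l)
    moreover have "dual_objective S \<Lambda> (B ** transpose B) = - (norm p)\<^sup>2 - 2 * (p \<bullet> (?J0 ** q))"
      unfolding dual_objective_def Xmat_gram[OF L, symmetric] Xmat_Jmat0[OF L, symmetric] inner_blk11_gram inner_blk12_gram u l
      by (rule refl)
    ultimately show ?thesis by blast
  qed
  show ?thesis
  proof (cases "phi S \<Lambda> > 0")
    case True
    obtain Z where Z: "nuclear_norm Z = 1" "\<And>l. l \<in> {1..rdim S} \<Longrightarrow> Z \<bullet> Jbasis S \<Lambda> l = 0" "phi S \<Lambda> \<le> Z \<bullet> ?J0"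
      using dual_certificate[OF L True] by blast
    obtain Lf :: "('k \<times> 'k, 'k) rmat" and R :: "('k, 'k) rmat" where LR: "Lf ** transpose R = Z" "Lf \<bullet> Lf = nuclear_norm Z" "R \<bullet> R = nuclear_norm Z"
      by (rule nuclear_factorization)
    define p where "p = (- phi S \<Lambda>) *\<^sub>R Lf"
    have pM: "p \<bullet> (M ** R) = - phi S \<Lambda> * (Z \<bullet> M)" for M
      by (simp add: p_def LR(1)[symmetric] inner_factor)
    have "norm R = 1" using LR(3) Z(1) by (simp add: norm_eq_1)
    moreover have "p \<bullet> (Jbasis S \<Lambda> l ** R) = 0" if "l \<in> {1..rdim S}" for l using Z(2)[OF that] by (simp add: pM)
    ultimately obtain Y where Y: "dual_feasible S Y" "dual_objective S \<Lambda> Y = - (norm p)\<^sup>2 - 2 * (p \<bullet> (?J0 ** R))"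
      using build[of R p] by blast
    have "norm Lf = 1" using LR(2) Z(1) by (simp add: norm_eq_1)
    then have "(norm p)\<^sup>2 = (phi S \<Lambda>)\<^sup>2" by (simp add: p_def)
    moreover have "p \<bullet> (?J0 ** R) \<le> - (phi S \<Lambda>)\<^sup>2"
      unfolding pM using mult_left_mono[OF Z(3), of "phi S \<Lambda>"] True by (simp add: power2_eq_square)
    ultimately have "(phi S \<Lambda>)\<^sup>2 \<le> dual_objective S \<Lambda> Y" using Y(2) by simp
    then show ?thesis using Y(1) by blast
  next
    case False
    then have "phi S \<Lambda> = 0" using phi_nonneg[OF L] by simp
    obtain q :: "('k, 'k) rmat" where "norm q = 1" using vector_choose_size[of 1] by auto
    then show ?thesis using build[of q 0] \<open>phi S \<Lambda> = 0\<close> by auto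
  qed
qed

end

section \<open>Functions touched by smooth functions\<close>

text \<open>A derivative relative to a subspace is only determined on that subspace.\<close>

lemma has_derivative_subspace_cong:
  assumes f: "(f has_derivative D) (at x within V)" and V: "subspace V" "x \<in> V"
    and D': "bounded_linear D'" and eq: "\<And>h. h \<in> V \<Longrightarrow> D h = D' h"
  shows "(f has_derivative D') (at x within V)"
  unfolding has_derivative_within_alt
proof (intro conjI D' allI impI)
  fix e :: real assume "e > 0"
  then obtain d where "d > 0" and d: "\<And>y. y \<in> V \<Longrightarrow> norm (y - x) < d \<Longrightarrow> norm (f y - f x - D (y - x)) \<le> e * norm (y - x)"
    using f unfolding has_derivative_within_alt by blast
  moreover have "D (y - x) = D' (y - x)" if "y \<in> V" for y
    by (rule eq) (rule subspace_diff[OF V(1) that V(2)])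
  ultimately show "\<exists>d>0. \<forall>y\<in>V. norm (y - x) < d \<longrightarrow> norm (f y - f x - D' (y - x)) \<le> e * norm (y - x)"
    by (intro exI[of _ d]) auto
qed

text \<open>Along every line of \<open>V\<close> through \<open>x\<close> the difference \<open>k - f\<close> has a local minimum at \<open>x\<close>.\<close>

lemma touching_derivatives_agree:
  fixes f k :: "'a::euclidean_space \<Rightarrow> real"
  assumes f: "(f has_derivative f') (at x within V)" and k: "(k has_derivative k') (at x within V)"
    and V: "subspace V" and U: "openin (top_of_set V) U" "x \<in> U"
    and le: "\<And>y. y \<in> U \<Longrightarrow> f y \<le> k y" and eq: "f x = k x" and h: "h \<in> V"
  shows "f' h = k' h"
proof -
  have xV: "x \<in> V" using U openin_imp_subset by blast
  obtain r where r: "r > 0" "ball x r \<inter> V \<subseteq> U" using U by (auto simp: openin_contains_ball)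
  define m where "m t = k (x + t *\<^sub>R h) - f (x + t *\<^sub>R h)" for t
  have "(m has_real_derivative (k' h - f' h)) (at 0)"
    unfolding m_def has_real_derivative_iff_has_vector_derivative
    by (intro has_vector_derivative_diff has_derivative_along_line[OF _ V xV h] f k)
  moreover have "m 0 \<le> m t" if t: "\<bar>0 - t\<bar> < r / (norm h + 1)" for t
  proof -
    have "\<bar>t\<bar> * norm h \<le> \<bar>t\<bar> * (norm h + 1)" by (intro mult_left_mono) auto
    also have "\<dots> < r" using t by (simp add: pos_less_divide_eq add_nonneg_pos)
    finally have "x + t *\<^sub>R h \<in> ball x r" by (simp add: dist_norm)
    moreover have "x + t *\<^sub>R h \<in> V" using xV h by (intro subspace_add[OF V] subspace_scale[OF V])
    ultimately have "x + t *\<^sub>R h \<in> U" using r by blast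
    then show ?thesis using le eq by (simp add: m_def)
  qed
  moreover have "r / (norm h + 1) > 0" using r by (simp add: add_nonneg_pos)
  ultimately have "k' h - f' h = 0" using DERIV_local_min[of m _ 0 "r / (norm h + 1)"] by blast
  then show ?thesis by simp
qed

lemma squeezed_derivative:
  fixes f m k :: "'a::euclidean_space \<Rightarrow> real"
  assumes f: "(f has_derivative f') (at x within V)" and k: "(k has_derivative k') (at x within V)"
    and V: "subspace V" and U: "openin (top_of_set V) U" "x \<in> U"
    and fm: "\<And>y. y \<in> U \<Longrightarrow> f y \<le> m y" and mk: "\<And>y. y \<in> U \<Longrightarrow> m y \<le> k y" and eq: "f x = m x" "k x = m x"
  shows "(m has_derivative f') (at x within V)"
  unfolding has_derivative_within_alt
proof (intro conjI allI impI)
  show bf: "bounded_linear f'" using f by (rule has_derivative_bounded_linear)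
  have xV: "x \<in> V" using U openin_imp_subset by blast
  have "f' h = k' h" if "h \<in> V" for h
    by (rule touching_derivatives_agree[OF f k V U]) (use fm mk eq that in \<open>auto intro: order_trans\<close>)
  then have k2: "(k has_derivative f') (at x within V)"
    by (intro has_derivative_subspace_cong[OF k V xV bf]) simp
  obtain r where r: "r > 0" "ball x r \<inter> V \<subseteq> U" using U by (auto simp: openin_contains_ball)
  fix e :: real assume e: "e > 0"
  obtain d1 where d1: "d1 > 0" "\<And>y. y \<in> V \<Longrightarrow> norm (y - x) < d1 \<Longrightarrow> norm (f y - f x - f' (y - x)) \<le> e * norm (y - x)"
    using f e unfolding has_derivative_within_alt by blast
  obtain d2 where d2: "d2 > 0" "\<And>y. y \<in> V \<Longrightarrow> norm (y - x) < d2 \<Longrightarrow> norm (k y - k x - f' (y - x)) \<le> e * norm (y - x)"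
    using k2 e unfolding has_derivative_within_alt by blast
  have "norm (m y - m x - f' (y - x)) \<le> e * norm (y - x)" if y: "y \<in> V" "norm (y - x) < min r (min d1 d2)" for y
  proof -
    have "y \<in> U" using r y by (auto simp: dist_norm norm_minus_commute)
    then have "f y \<le> m y" "m y \<le> k y" using fm mk by auto
    moreover have "\<bar>f y - f x - f' (y - x)\<bar> \<le> e * norm (y - x)" "\<bar>k y - k x - f' (y - x)\<bar> \<le> e * norm (y - x)"
      using d1(2)[of y] d2(2)[of y] y by auto
    ultimately show ?thesis using eq unfolding real_norm_def by linarith
  qed
  then show "\<exists>d>0. \<forall>y\<in>V. norm (y - x) < d \<longrightarrow> norm (m y - m x - f' (y - x)) \<le> e * norm (y - x)"
    using r(1) d1(1) d2(1) by (intro exI[of _ "min r (min d1 d2)"]) auto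
qed

text \<open>The generalized directional derivative dominates the difference quotients of \<open>f\<close> at \<open>x\<close> itself,
  which dominate those of the minorant.\<close>

lemma clarke_subdiff_of_minorant:
  fixes f \<psi> :: "'a::euclidean_space \<Rightarrow> real"
  assumes \<psi>: "(\<psi> has_derivative (\<lambda>h. g \<bullet> h)) (at x within V)"
    and V: "subspace V" and U: "openin (top_of_set V) U" "x \<in> U"
    and le: "\<And>y. y \<in> U \<Longrightarrow> \<psi> y \<le> f y" and eq: "\<psi> x = f x" and g: "g \<in> V"
  shows "g \<in> clarke_subdiff V f x"
  unfolding clarke_subdiff_def
proof (intro CollectI conjI g ballI)
  fix v assume v: "v \<in> V"
  have xV: "x \<in> V" using U openin_imp_subset by blast
  obtain r where r: "r > 0" "ball x r \<inter> V \<subseteq> U" using U by (auto simp: openin_contains_ball)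
  have "((\<lambda>t. \<psi> (x + t *\<^sub>R v)) has_real_derivative (g \<bullet> v)) (at 0)"
    unfolding has_real_derivative_iff_has_vector_derivative by (rule has_derivative_along_line[OF \<psi> V xV v])
  then have "((\<lambda>t. (\<psi> (x + t *\<^sub>R v) - \<psi> x) / t) \<longlongrightarrow> g \<bullet> v) (at 0)"
    by (simp add: DERIV_def)
  then have lim: "((\<lambda>t. (\<psi> (x + t *\<^sub>R v) - \<psi> x) / t) \<longlongrightarrow> g \<bullet> v) (at_right 0)"
    by (rule filterlim_mono) (auto simp: at_le)
  show "ereal (g \<bullet> v) \<le> clarke_deriv V f x v"
    unfolding clarke_deriv_def Limsup_def
  proof (rule INF_greatest)
    fix P :: "'a \<times> real \<Rightarrow> bool" assume "P \<in> {P. eventually P (inf (nhds x) (principal V) \<times>\<^sub>F at_right (0::real))}"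
    then have "eventually P (inf (nhds x) (principal V) \<times>\<^sub>F at_right (0::real))" by simp
    then obtain Pf Pg where Pf: "eventually Pf (inf (nhds x) (principal V))" and Pg: "eventually Pg (at_right (0::real))"
      and P: "\<And>a b. Pf a \<Longrightarrow> Pg b \<Longrightarrow> P (a, b)"
      unfolding eventually_prod_filter by blast
    have "Pf x" using Pf xV unfolding eventually_inf_principal by (auto dest: eventually_nhds_x_imp_x)
    have "((\<lambda>t. x + t *\<^sub>R v) \<longlongrightarrow> x + 0 *\<^sub>R v) (at_right (0::real))" by (intro tendsto_intros)
    then have near: "\<forall>\<^sub>F t in at_right (0::real). dist (x + t *\<^sub>R v) x < r"
      using r(1) by (simp add: tendsto_iff)
    have pos: "\<forall>\<^sub>F t in at_right (0::real). t > 0" by (simp add: eventually_at_right_less)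
    let ?s = "SUP p\<in>{p. P p}. (case p of (y, t) \<Rightarrow> ereal ((f (y + t *\<^sub>R v) - f y) / t))"
    have "\<forall>\<^sub>F t in at_right (0::real). ereal ((\<psi> (x + t *\<^sub>R v) - \<psi> x) / t) \<le> ?s"
      using Pg near pos
    proof eventually_elim
      case (elim t)
      have "x + t *\<^sub>R v \<in> V" using xV v by (intro subspace_add[OF V] subspace_scale[OF V])
      then have "x + t *\<^sub>R v \<in> U" using elim(2) r(2) by (auto simp: dist_commute)
      then have "\<psi> (x + t *\<^sub>R v) - \<psi> x \<le> f (x + t *\<^sub>R v) - f x" using le eq by simp
      then have "ereal ((\<psi> (x + t *\<^sub>R v) - \<psi> x) / t) \<le> ereal ((f (x + t *\<^sub>R v) - f x) / t)"
        using elim(3) by (simp add: divide_right_mono)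
      also have "\<dots> \<le> ?s"
        by (rule SUP_upper2[of "(x, t)"]) (use P \<open>Pf x\<close> elim(1) in auto)
      finally show ?case .
    qed
    then show "ereal (g \<bullet> v) \<le> ?s"
      by (intro tendsto_upperbound[OF tendsto_ereal[OF lim]]) auto
  qed
qed

lemma singular_vectors_exist:
  fixes Z :: "real^'n^'r"
  obtains v where "norm v = 1" "(transpose Z ** Z) *v v = (spec_norm Z)\<^sup>2 *\<^sub>R v"
proof -
  have "spec_norm Z \<in> singular_values Z"
    using Max_in[OF finite_singular_values[of Z]] by (simp add: Max_singular_values)
  then obtain w where w: "w \<noteq> 0" "(transpose Z ** Z) *v w = (spec_norm Z)\<^sup>2 *\<^sub>R w"
    by (auto simp: singular_values_def)
  show thesis
  proof (rule that[of "(1 / norm w) *\<^sub>R w"])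
    show "norm ((1 / norm w) *\<^sub>R w) = 1" using w(1) by simp
    show "(transpose Z ** Z) *v ((1 / norm w) *\<^sub>R w) = (spec_norm Z)\<^sup>2 *\<^sub>R ((1 / norm w) *\<^sub>R w)"
      by (simp add: matrix_vector_mult_scaleR w(2))
  qed
qed

text \<open>The derivative of the upper expansion: the quadratic term contributes nothing at \<open>x\<close>.\<close>

lemma has_derivative_quadratic_expansion:
  fixes F :: "'a::real_normed_vector \<Rightarrow> real^'c^'r"
  assumes F: "(F has_derivative F') (at x within V)"
  shows "((\<lambda>y. a + 2 * (w \<bullet> ((F y - F x) *v v)) + C * (norm (F y - F x))\<^sup>2) has_derivative (\<lambda>h. 2 * (w \<bullet> (F' h *v v)))) (at x within V)"
proof -
  have bl: "bounded_linear (\<lambda>M :: real^'c^'r. M *v v)"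
    by (rule bounded_linear_intro[of _ "norm v"])
      (auto simp: matrix_vector_mult_add_rdistrib scaleR_matrix_vector_assoc norm_matrix_vector_le_norm)
  have E: "((\<lambda>y. F y - F x) has_derivative F') (at x within V)"
    using has_derivative_diff[OF F has_derivative_const[of "F x"]] by simp
  have "((\<lambda>y. a + 2 * (w \<bullet> ((F y - F x) *v v)) + C * ((F y - F x) \<bullet> (F y - F x))) has_derivative
     (\<lambda>h. 0 + 2 * (w \<bullet> (F' h *v v)) + C * ((F x - F x) \<bullet> F' h + F' h \<bullet> (F x - F x)))) (at x within V)"
    by (intro has_derivative_add has_derivative_const has_derivative_mult_right has_derivative_inner_right
        bounded_linear.has_derivative[OF bl] has_derivative_inner E)
  then show ?thesis by (simp add: power2_norm_eq_inner)
qed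

section \<open>Sensitivity of the value\<close>

context stabilized_family begin

context
  fixes \<Lambda> \<nu> \<tau> Y
  assumes L: "\<Lambda> \<in> U" and po: "primal_optimum S \<Lambda> \<nu> \<tau>" and dopt: "dual_optimum S \<Lambda> Y"
begin

lemma optimal_dual_feasible: "dual_feasible S Y"
  using dopt by (simp add: dual_optimum_def)

lemma optimal_dual_facts: "transpose Y = Y" "trace (blk22 Y) = 1" "\<forall>l\<in>{1..rdim S}. blk12 Y \<bullet> col (rbasis S l) = 0"
  using optimal_dual_feasible by (auto simp: dual_feasible_def pos_semidef_def)

lemmas J_norm = primal_optimum_value(1)[OF L po]
lemmas tau_value = primal_optimum_value(2)[OF L po]

lemma dual_value: "dual_objective S \<Lambda> Y = (phi S \<Lambda>)\<^sup>2"
proof (rule antisym[OF dual_objective_le_phi[OF L optimal_dual_feasible]])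
  obtain Y' where "dual_feasible S Y'" "(phi S \<Lambda>)\<^sup>2 \<le> dual_objective S \<Lambda> Y'" using strong_duality[OF L] by blast
  then show "(phi S \<Lambda>)\<^sup>2 \<le> dual_objective S \<Lambda> Y" using dopt unfolding dual_optimum_def by (meson order_trans)
qed

lemma complementarity: "Y \<bullet> Fsdp S \<Lambda> \<nu> \<tau> = 0"
  unfolding dual_objective_pairing[OF optimal_dual_facts] dual_value tau_value by simp

text \<open>With zero gap, \<open>\<parallel>p + J q\<parallel>\<^sup>2 + (\<phi>\<^sup>2 - \<parallel>J q\<parallel>\<^sup>2) = 0\<close>, and both summands are nonnegative because \<open>\<parallel>q\<parallel> = 1\<close>.\<close>

lemma optimal_factor:
  obtains B :: "('k \<times> 'k + 'k, 'k \<times> 'k + 'k) rmat" where "Y = B ** transpose B" "norm (lower_rows B) = 1"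
    "transpose (Xmat S \<Lambda>) ** upper_rows B = - (Jr S \<Lambda> \<nu> ** lower_rows B)"
    "norm (Jr S \<Lambda> \<nu> ** lower_rows B) = phi S \<Lambda>"
proof -
  have "pos_semidef Y" using optimal_dual_feasible by (simp add: dual_feasible_def)
  then obtain B :: "('k \<times> 'k + 'k, 'k \<times> 'k + 'k) rmat" where B: "Y = B ** transpose B"
    by (rule pos_semidef_factorization)
  define p where "p = transpose (Xmat S \<Lambda>) ** upper_rows B"
  define q where "q = lower_rows B"
  have "(norm q)\<^sup>2 = 1" using optimal_dual_facts(2) unfolding B trace_blk22_gram q_def .
  then have q: "norm q = 1" using norm_ge_zero[of q] by (auto simp: power2_eq_1_iff)
  have "(norm (p + Jr S \<Lambda> \<nu> ** q))\<^sup>2 + \<tau> * (norm q)\<^sup>2 - (norm (Jr S \<Lambda> \<nu> ** q))\<^sup>2 = 0"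
    using complementarity unfolding Fsdp_factored[OF L] B sdp_pairing p_def q_def .
  then have sum0: "(norm (p + Jr S \<Lambda> \<nu> ** q))\<^sup>2 + ((phi S \<Lambda>)\<^sup>2 - (norm (Jr S \<Lambda> \<nu> ** q))\<^sup>2) = 0"
    using q tau_value by simp
  have le: "norm (Jr S \<Lambda> \<nu> ** q) \<le> phi S \<Lambda>"
    using norm_matrix_mult_le_spec[of "Jr S \<Lambda> \<nu>" q] J_norm q by simp
  then have le2: "(norm (Jr S \<Lambda> \<nu> ** q))\<^sup>2 \<le> (phi S \<Lambda>)\<^sup>2" by (intro power_mono) auto
  have "(norm (p + Jr S \<Lambda> \<nu> ** q))\<^sup>2 = 0" and e2: "(norm (Jr S \<Lambda> \<nu> ** q))\<^sup>2 = (phi S \<Lambda>)\<^sup>2"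
    using sum0 le2 zero_le_power2[of "norm (p + Jr S \<Lambda> \<nu> ** q)"] by linarith+
  then have "p = - (Jr S \<Lambda> \<nu> ** q)" by (simp add: eq_neg_iff_add_eq_0)
  moreover have "norm (Jr S \<Lambda> \<nu> ** q) = phi S \<Lambda>"
    using e2 phi_nonneg[OF L] by (simp add: power2_eq_iff_nonneg)
  ultimately show thesis using that B q unfolding p_def q_def by blast
qed

context
  assumes pos: "phi S \<Lambda> > 0"
begin

text \<open>In terms of the factor, \<open>Z = - p q\<^sup>T / \<phi>\<close>.\<close>

lemma Zstar_inner:
  assumes B: "Y = B ** transpose B"
  shows "Zstar S \<Lambda> Y \<bullet> M = - ((transpose (Xmat S \<Lambda>) ** upper_rows B) \<bullet> (M ** lower_rows B)) / phi S \<Lambda>"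
proof -
  have "transpose (Xmat S \<Lambda>) ** blk12 Y = (transpose (Xmat S \<Lambda>) ** upper_rows B) ** transpose (lower_rows B)"
    by (simp add: B blocks_of_gram matrix_mul_assoc)
  then show ?thesis by (simp add: Zstar_def inner_factor)
qed

lemma Zstar_le_spec: "Zstar S \<Lambda> Y \<bullet> M \<le> spec_norm M"
proof -
  obtain B :: "('k \<times> 'k + 'k, 'k \<times> 'k + 'k) rmat" where B: "Y = B ** transpose B" "norm (lower_rows B) = 1"
    "transpose (Xmat S \<Lambda>) ** upper_rows B = - (Jr S \<Lambda> \<nu> ** lower_rows B)"
    "norm (Jr S \<Lambda> \<nu> ** lower_rows B) = phi S \<Lambda>" by (rule optimal_factor)
  have "(Jr S \<Lambda> \<nu> ** lower_rows B) \<bullet> (M ** lower_rows B) \<le> phi S \<Lambda> * norm (M ** lower_rows B)"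
    using norm_cauchy_schwarz[of "Jr S \<Lambda> \<nu> ** lower_rows B" "M ** lower_rows B"] B(4) by simp
  also have "\<dots> \<le> phi S \<Lambda> * spec_norm M"
    using norm_matrix_mult_le_spec[of M "lower_rows B"] B(2) pos by simp
  finally show ?thesis using pos by (simp add: Zstar_inner[OF B(1)] B(3) field_simps)
qed

lemma Zstar_Jr: "Zstar S \<Lambda> Y \<bullet> Jr S \<Lambda> \<nu> = phi S \<Lambda>"
proof -
  obtain B :: "('k \<times> 'k + 'k, 'k \<times> 'k + 'k) rmat" where B: "Y = B ** transpose B" "norm (lower_rows B) = 1"
    "transpose (Xmat S \<Lambda>) ** upper_rows B = - (Jr S \<Lambda> \<nu> ** lower_rows B)"
    "norm (Jr S \<Lambda> \<nu> ** lower_rows B) = phi S \<Lambda>" by (rule optimal_factor)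
  show ?thesis using pos B(4)
    by (simp add: Zstar_inner[OF B(1)] B(3) flip: power2_norm_eq_inner) (simp add: power2_eq_square)
qed

lemma Zstar_subdiff: "Zstar S \<Lambda> Y \<in> spec_norm_subdiff (Jr S \<Lambda> \<nu>)"
  using Zstar_le_spec by (simp add: spec_norm_subdiff_def inner_diff_right Zstar_Jr J_norm)

lemma Zstar_nuclear: "nuclear_norm (Zstar S \<Lambda> Y) = 1"
proof (rule antisym)
  show "nuclear_norm (Zstar S \<Lambda> Y) \<le> 1" unfolding nuclear_norm_le_iff using Zstar_le_spec by simp
  have "phi S \<Lambda> \<le> nuclear_norm (Zstar S \<Lambda> Y) * phi S \<Lambda>"
    using inner_le_nuclear_spec[of "Zstar S \<Lambda> Y" "Jr S \<Lambda> \<nu>"] by (simp add: Zstar_Jr J_norm)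
  then show "1 \<le> nuclear_norm (Zstar S \<Lambda> Y)" using pos by simp
qed

lemma Zstar_Jbasis: "l \<in> {1..rdim S} \<Longrightarrow> Zstar S \<Lambda> Y \<bullet> Jbasis S \<Lambda> l = 0"
proof -
  assume l: "l \<in> {1..rdim S}"
  obtain B :: "('k \<times> 'k + 'k, 'k \<times> 'k + 'k) rmat" where B: "Y = B ** transpose B" by (rule optimal_factor)
  have "blk12 Y \<bullet> (Xmat S \<Lambda> ** Jbasis S \<Lambda> l) = 0" unfolding Xmat_Jbasis[OF L] using optimal_dual_facts(3) l by blast
  then show ?thesis unfolding Zstar_inner[OF B] unfolding B inner_blk12_gram by simp
qed

lemma Zstar_dual_ball: "Zstar S \<Lambda> Y \<in> dual_ball S \<Lambda>"
  unfolding dual_ball_def using Zstar_nuclear Zstar_Jbasis by (simp add: Wspace_orthogonal_iff[OF L])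

lemma dual_ball_inner: "Z \<in> dual_ball S \<Lambda> \<Longrightarrow> Z \<bullet> Jmat S \<Lambda> (\<lambda>_. 0) = Z \<bullet> Jr S \<Lambda> \<nu>"
  unfolding dual_ball_def Jr_split[of \<Lambda> \<nu>] inner_add_right inner_sum_right inner_scaleR_right
  by (auto simp: Wspace_orthogonal_iff[OF L])

lemma Zstar_maximal: assumes Z: "Z \<in> dual_ball S \<Lambda>"
  shows "Z \<bullet> Jmat S \<Lambda> (\<lambda>_. 0) \<le> Zstar S \<Lambda> Y \<bullet> Jmat S \<Lambda> (\<lambda>_. 0)"
proof -
  have "Z \<bullet> Jr S \<Lambda> \<nu> \<le> 1 * spec_norm (Jr S \<Lambda> \<nu>)"
    using Z nuclear_norm_le_iff[of Z 1] by (simp add: dual_ball_def)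
  then show ?thesis unfolding dual_ball_inner[OF Z] dual_ball_inner[OF Zstar_dual_ball] Zstar_Jr J_norm by simp
qed

text \<open>With \<open>u = B\<^sub>1\<close>, differentiating \<open>P \<otimes> 1 = X X\<^sup>T\<close> turns the first term into \<open>2 \<langle>u, X' p\<rangle>\<close>, and differentiating
  \<open>G = X J\<close> turns the second into \<open>2 \<langle>p, J' q\<rangle> + 2 \<langle>u, X' J q\<rangle>\<close>. Complementarity \<open>J q = - p\<close> cancels the terms with \<open>X'\<close>.\<close>

lemma gradient_formula:
  assumes i: "i \<in> I"
  shows "Zstar S \<Lambda> Y \<bullet> partial (\<lambda>\<Lambda>'. Jr S \<Lambda>' \<nu>) \<Lambda> i
     = - (blk11 Y \<bullet> kron (partial (lyapP S) \<Lambda> i) (mat 1)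
          + 2 * (blk12 Y \<bullet> partial (\<lambda>\<Lambda>'. Gmat S \<Lambda>' (\<lambda>_. 0)) \<Lambda> i)) / (2 * phi S \<Lambda>)"
proof -
  obtain B :: "('k \<times> 'k + 'k, 'k \<times> 'k + 'k) rmat" where B: "Y = B ** transpose B" and
    pq: "transpose (Xmat S \<Lambda>) ** upper_rows B = - (Jr S \<Lambda> \<nu> ** lower_rows B)" by (rule optimal_factor)
  define X X' J' where "X = Xmat S \<Lambda>" and "X' = partial (Xmat S) \<Lambda> i" and "J' = partial (\<lambda>\<Lambda>'. Jr S \<Lambda>' \<nu>) \<Lambda> i"
  define u q where "u = upper_rows B" and "q = lower_rows B"
  define p where "p = transpose X ** u"
  have Jq: "Jr S \<Lambda> \<nu> ** q = - p" using pq by (simp add: p_def X_def u_def q_def)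
  have sym11: "transpose (blk11 Y) = blk11 Y" unfolding B blocks_of_gram by (rule gram_symmetric)
  have "blk11 Y \<bullet> (X ** transpose X') = blk11 Y \<bullet> (X' ** transpose X)"
    using inner_transpose[of "blk11 Y" "X ** transpose X'"] by (simp add: sym11 matrix_transpose_mul)
  then have "blk11 Y \<bullet> kron (partial (lyapP S) \<Lambda> i) (mat 1) = 2 * (blk11 Y \<bullet> (X' ** transpose X))"
    unfolding Xmat_gram_derivative[OF L i, symmetric] by (simp add: X_def X'_def inner_add_right)
  also have "blk11 Y \<bullet> (X' ** transpose X) = u \<bullet> (X' ** p)"
    unfolding B blocks_of_gram inner_factor u_def[symmetric] p_def matrix_mul_assoc by (rule refl)
  finally have e1: "blk11 Y \<bullet> kron (partial (lyapP S) \<Lambda> i) (mat 1) = 2 * (u \<bullet> (X' ** p))" .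
  have "blk12 Y \<bullet> partial (\<lambda>\<Lambda>'. Gmat S \<Lambda>' (\<lambda>_. 0)) \<Lambda> i = blk12 Y \<bullet> (X ** J') + blk12 Y \<bullet> (X' ** Jr S \<Lambda> \<nu>)"
    unfolding Jr_derivative[OF L i, of \<nu>, symmetric] by (simp add: X_def X'_def J'_def inner_add_right)
  also have "blk12 Y \<bullet> (X ** J') = p \<bullet> (J' ** q)"
    unfolding B inner_blk12_gram by (simp add: p_def u_def q_def)
  also have "blk12 Y \<bullet> (X' ** Jr S \<Lambda> \<nu>) = u \<bullet> (X' ** (Jr S \<Lambda> \<nu> ** q))"
    unfolding B blocks_of_gram inner_factor u_def[symmetric] q_def[symmetric] matrix_mul_assoc by (rule refl)
  also have "X' ** (Jr S \<Lambda> \<nu> ** q) = - (X' ** p)"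
    unfolding Jq using matrix_scaleR_right[of X' "-1" p] by simp
  finally have e2: "blk12 Y \<bullet> partial (\<lambda>\<Lambda>'. Gmat S \<Lambda>' (\<lambda>_. 0)) \<Lambda> i = p \<bullet> (J' ** q) - u \<bullet> (X' ** p)"
    by simp
  have "Zstar S \<Lambda> Y \<bullet> J' = - (p \<bullet> (J' ** q)) / phi S \<Lambda>"
    unfolding Zstar_inner[OF B] by (simp add: p_def u_def q_def X_def)
  then show ?thesis unfolding J'_def[symmetric] e1 e2 using pos by (simp add: field_simps)
qed

abbreviation "g \<equiv> gsub S \<Lambda> \<nu> Y"

lemma gsub_component: "i \<in> I \<Longrightarrow> g $ i = Zstar S \<Lambda> Y \<bullet> partial (\<lambda>\<Lambda>'. Jr S \<Lambda>' \<nu>) \<Lambda> i"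
  by (simp add: gsub_def)

lemma gsub_in_gain_space: "g \<in> coord_space I"
  by (simp add: gsub_def coord_space_def)

lemma gsub_inner: "h \<in> coord_space I \<Longrightarrow> g \<bullet> h = (\<Sum>i\<in>I. h $ i * g $ i)"
  by (subst coord_space_expansion, assumption) (simp add: inner_sum_right inner_axis)

text \<open>The gradient formula says that \<open>2 \<phi> g\<close> collects the partial derivatives of the dual objective at the
  fixed point \<open>Y\<close>.\<close>

lemma dual_objective_derivative:
  "((\<lambda>\<Lambda>'. dual_objective S \<Lambda>' Y) has_derivative (\<lambda>h. 2 * phi S \<Lambda> * (g \<bullet> h))) (at \<Lambda> within coord_space I)"
proof -
  obtain P' where P': "(lyapP S has_derivative P') (at \<Lambda> within coord_space I)"
    by (rule analytic_matrix_derivative[OF U_coord[OF L] analytic_lyapP[OF L]])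
  obtain G' where G': "((\<lambda>\<Lambda>'. Gmat S \<Lambda>' (\<lambda>_. 0)) has_derivative G') (at \<Lambda> within coord_space I)"
    by (rule analytic_matrix_derivative[OF U_coord[OF L] analytic_Gmat[OF L]])
  have bl: "bounded_linear (\<lambda>A :: ('k, 'k) rmat. kron A (mat 1 :: ('k, 'k) rmat))"
    using linear_kron_left linear_conv_bounded_linear by blast
  have lk: "linear (\<lambda>A :: ('k, 'k) rmat. kron A (mat 1 :: ('k, 'k) rmat))" by (rule linear_kron_left)
  have D: "((\<lambda>\<Lambda>'. dual_objective S \<Lambda>' Y) has_derivative
      (\<lambda>h. - (blk11 Y \<bullet> kron (P' h) (mat 1)) - 2 * (blk12 Y \<bullet> G' h))) (at \<Lambda> within coord_space I)"
    unfolding dual_objective_def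
    by (intro has_derivative_diff has_derivative_minus has_derivative_mult_right has_derivative_inner_right
        bounded_linear.has_derivative[OF bl] P' G')
  show ?thesis
  proof (rule has_derivative_subspace_cong[OF D subspace_coord_space U_coord[OF L]])
    show "bounded_linear (\<lambda>h. 2 * phi S \<Lambda> * (g \<bullet> h))"
      by (intro bounded_linear_const_mult bounded_linear_inner_right)
    fix h assume h: "h \<in> coord_space I"
    have gi: "2 * phi S \<Lambda> * g $ i = - (blk11 Y \<bullet> kron (partial (lyapP S) \<Lambda> i) (mat 1)) - 2 * (blk12 Y \<bullet> partial (\<lambda>\<Lambda>'. Gmat S \<Lambda>' (\<lambda>_. 0)) \<Lambda> i)"
      if "i \<in> I" for i
      unfolding gsub_component[OF that] gradient_formula[OF that] using pos by simp
    have "- (blk11 Y \<bullet> kron (P' h) (mat 1)) - 2 * (blk12 Y \<bullet> G' h)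
      = (\<Sum>i\<in>I. h $ i * (- (blk11 Y \<bullet> kron (partial (lyapP S) \<Lambda> i) (mat 1)) - 2 * (blk12 Y \<bullet> partial (\<lambda>\<Lambda>'. Gmat S \<Lambda>' (\<lambda>_. 0)) \<Lambda> i)))"
      unfolding derivative_coord_expansion[OF P' U_coord[OF L] h] derivative_coord_expansion[OF G' U_coord[OF L] h]
        linear_sum[OF lk] linear_scale[OF lk] inner_sum_right inner_scaleR_right
      by (simp add: right_diff_distrib sum_subtractf sum_negf sum_distrib_left mult_ac)
    also have "\<dots> = (\<Sum>i\<in>I. h $ i * (2 * phi S \<Lambda> * g $ i))" by (intro sum.cong refl) (simp only: gi)
    also have "\<dots> = 2 * phi S \<Lambda> * (g \<bullet> h)" unfolding gsub_inner[OF h] sum_distrib_left by (simp add: mult_ac)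
    finally show "- (blk11 Y \<bullet> kron (P' h) (mat 1)) - 2 * (blk12 Y \<bullet> G' h) = 2 * phi S \<Lambda> * (g \<bullet> h)" .
  qed
qed

text \<open>By weak duality for the fixed dual point \<open>Y\<close>, a lower bound for \<open>\<phi>\<close> at every gain in \<open>U\<close>.\<close>

definition minorant where "minorant \<Lambda>' = sqrt (dual_objective S \<Lambda>' Y)"

lemma minorant_le: "\<Lambda>' \<in> U \<Longrightarrow> minorant \<Lambda>' \<le> phi S \<Lambda>'"
  unfolding minorant_def using real_sqrt_le_mono[OF dual_objective_le_phi[OF _ optimal_dual_feasible]] phi_nonneg by simp

lemma minorant_eq: "minorant \<Lambda> = phi S \<Lambda>"
  using pos by (simp add: minorant_def dual_value)

lemma minorant_derivative: "(minorant has_derivative (\<lambda>h. g \<bullet> h)) (at \<Lambda> within coord_space I)"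
proof -
  have p: "dual_objective S \<Lambda> Y > 0" using pos by (simp add: dual_value)
  have "((\<lambda>\<Lambda>'. sqrt (dual_objective S \<Lambda>' Y)) has_derivative
     (\<lambda>h. (2 * phi S \<Lambda> * (g \<bullet> h)) * (inverse (sqrt (dual_objective S \<Lambda> Y)) / 2))) (at \<Lambda> within coord_space I)"
    using has_derivative_real_sqrt[OF p dual_objective_derivative] by (simp add: mult_ac)
  moreover have "(\<lambda>h. (2 * phi S \<Lambda> * (g \<bullet> h)) * (inverse (sqrt (dual_objective S \<Lambda> Y)) / 2)) = (\<lambda>h. g \<bullet> h)"
    using pos by (simp add: fun_eq_iff dual_value)
  ultimately show ?thesis unfolding minorant_def[abs_def] by simp
qed

lemma gsub_clarke: "g \<in> clarke_subdiff (gain_space S) (phi S) \<Lambda>"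
  unfolding gain_space_def
  by (rule clarke_subdiff_of_minorant[OF minorant_derivative subspace_coord_space U_openin L minorant_le minorant_eq gsub_in_gain_space])

text \<open>A derivative of \<open>\<phi>\<close> must agree with that of the minorant touching it.\<close>

lemma phi_derivative_eq:
  assumes "phi S differentiable (at \<Lambda> within gain_space S)"
  shows "(phi S has_derivative (\<lambda>h. g \<bullet> h)) (at \<Lambda> within gain_space S)"
proof -
  obtain D where D: "(phi S has_derivative D) (at \<Lambda> within coord_space I)"
    using assms unfolding differentiable_def gain_space_def by blast
  show ?thesis unfolding gain_space_def
  proof (rule has_derivative_subspace_cong[OF D subspace_coord_space U_coord[OF L] bounded_linear_inner_right])
    fix h assume h: "h \<in> coord_space I"
    show "D h = g \<bullet> h"
      by (rule touching_derivatives_agree[OF minorant_derivative D subspace_coord_space U_openin L minorant_le minorant_eq h, symmetric])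
  qed
qed

context
  assumes simple: "singular_mult (Jr S \<Lambda> \<nu>) (Max (singular_values (Jr S \<Lambda> \<nu>))) = 1"
begin

text \<open>The square root of the quadratic upper expansion of the squared spectral norm of \<open>J\<^sub>r(\<cdot>, \<nu>)\<close> at the
  right singular vector \<open>v\<close>.\<close>

definition majorant where
  "majorant v C \<Lambda>' = sqrt ((phi S \<Lambda>)\<^sup>2 + 2 * ((Jr S \<Lambda> \<nu> *v v) \<bullet> ((Jr S \<Lambda>' \<nu> - Jr S \<Lambda> \<nu>) *v v))
     + C * (norm (Jr S \<Lambda>' \<nu> - Jr S \<Lambda> \<nu>))\<^sup>2)"

text \<open>\<open>\<phi>\<close> lies between the minorant and the majorant, which agree with it at \<open>\<Lambda>\<close>; so their derivatives
  agree there, and the derivative of the majorant is expressed by \<open>v\<close>.\<close>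

lemma simple_derivative:
  assumes v: "norm v = 1" "(transpose (Jr S \<Lambda> \<nu>) ** Jr S \<Lambda> \<nu>) *v v = (phi S \<Lambda>)\<^sup>2 *\<^sub>R v"
  shows "(phi S has_derivative (\<lambda>h. g \<bullet> h)) (at \<Lambda> within coord_space I)"
    and "i \<in> I \<Longrightarrow> g $ i = ((Jr S \<Lambda> \<nu> *v v) \<bullet> (partial (\<lambda>\<Lambda>'. Jr S \<Lambda>' \<nu>) \<Lambda> i *v v)) / phi S \<Lambda>"
proof -
  let ?J = "Jr S \<Lambda> \<nu>"
  have sp: "spec_norm ?J = phi S \<Lambda>" by (rule J_norm)
  obtain C where C: "\<And>E. (spec_norm (?J + E))\<^sup>2 \<le> (phi S \<Lambda>)\<^sup>2 + 2 * ((?J *v v) \<bullet> (E *v v)) + C * (norm E)\<^sup>2"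
    using spec_norm_sq_upper[of ?J v] simple v pos unfolding Max_singular_values sp by blast
  obtain J' where J': "((\<lambda>\<Lambda>'. Jr S \<Lambda>' \<nu>) has_derivative J') (at \<Lambda> within coord_space I)"
    by (rule analytic_matrix_derivative[OF U_coord[OF L] analytic_Jr[OF L]])
  have le: "phi S \<Lambda>' \<le> majorant v C \<Lambda>'" if "\<Lambda>' \<in> U" for \<Lambda>'
    unfolding majorant_def
  proof (rule real_le_rsqrt)
    have "(phi S \<Lambda>')\<^sup>2 \<le> (spec_norm (Jr S \<Lambda>' \<nu>))\<^sup>2"
      using phi_le[OF that] phi_nonneg[OF that] by (intro power_mono)
    also have "\<dots> = (spec_norm (?J + (Jr S \<Lambda>' \<nu> - ?J)))\<^sup>2" by simp
    also have "\<dots> \<le> (phi S \<Lambda>)\<^sup>2 + 2 * ((?J *v v) \<bullet> ((Jr S \<Lambda>' \<nu> - ?J) *v v)) + C * (norm (Jr S \<Lambda>' \<nu> - ?J))\<^sup>2" by (rule C)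
    finally show "(phi S \<Lambda>')\<^sup>2 \<le> (phi S \<Lambda>)\<^sup>2 + 2 * ((?J *v v) \<bullet> ((Jr S \<Lambda>' \<nu> - ?J) *v v)) + C * (norm (Jr S \<Lambda>' \<nu> - ?J))\<^sup>2" .
  qed
  have eq: "majorant v C \<Lambda> = phi S \<Lambda>" using pos by (simp add: majorant_def)
  have D: "(majorant v C has_derivative (\<lambda>h. ((?J *v v) \<bullet> (J' h *v v)) / phi S \<Lambda>)) (at \<Lambda> within coord_space I)"
  proof -
    have "0 < (phi S \<Lambda>)\<^sup>2 + 2 * ((?J *v v) \<bullet> ((?J - ?J) *v v)) + C * (norm (?J - ?J))\<^sup>2" using pos by simp
    from has_derivative_real_sqrt[OF this has_derivative_quadratic_expansion[OF J', of "(phi S \<Lambda>)\<^sup>2" "?J *v v" v C]]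
    show ?thesis unfolding majorant_def[abs_def] using pos by (simp add: field_simps)
  qed
  show "(phi S has_derivative (\<lambda>h. g \<bullet> h)) (at \<Lambda> within coord_space I)"
    by (rule squeezed_derivative[OF minorant_derivative D subspace_coord_space U_openin L minorant_le le minorant_eq eq])
  assume i: "i \<in> I"
  have "g \<bullet> axis i 1 = ((?J *v v) \<bullet> (J' (axis i 1) *v v)) / phi S \<Lambda>"
    by (rule touching_derivatives_agree[OF minorant_derivative D subspace_coord_space U_openin L])
      (use minorant_le le minorant_eq eq axis_in_coord_space[OF i] in \<open>auto intro: order_trans\<close>)
  then show "g $ i = ((?J *v v) \<bullet> (partial (\<lambda>\<Lambda>'. Jr S \<Lambda>' \<nu>) \<Lambda> i *v v)) / phi S \<Lambda>"
    unfolding partial_eq_derivative[OF J' U_coord[OF L] i] by (simp add: inner_axis)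
qed

lemma phi_has_gradient: "(phi S has_derivative (\<lambda>h. g \<bullet> h)) (at \<Lambda> within coord_space I)"
  by (rule singular_vectors_exist[of "Jr S \<Lambda> \<nu>"]) (rule simple_derivative(1), simp_all add: J_norm)

lemma phi_partial: "i \<in> I \<Longrightarrow> partial (phi S) \<Lambda> i = g $ i"
  using partial_eq_derivative[OF phi_has_gradient U_coord[OF L], of i] by (simp add: inner_axis)

lemma singular_pair_gradient:
  assumes uv: "singular_pair (Jr S \<Lambda> \<nu>) (Max (singular_values (Jr S \<Lambda> \<nu>))) u v"
  shows "Jr S \<Lambda> \<nu> *v v = phi S \<Lambda> *\<^sub>R u"
    "i \<in> I \<Longrightarrow> g $ i = u \<bullet> (partial (\<lambda>\<Lambda>'. Jr S \<Lambda>' \<nu>) \<Lambda> i *v v)"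
proof -
  have v: "norm v = 1" and Jv: "Jr S \<Lambda> \<nu> *v v = phi S \<Lambda> *\<^sub>R u" and Ju: "transpose (Jr S \<Lambda> \<nu>) *v u = phi S \<Lambda> *\<^sub>R v"
    using uv unfolding singular_pair_def Max_singular_values J_norm by auto
  show "Jr S \<Lambda> \<nu> *v v = phi S \<Lambda> *\<^sub>R u" by (rule Jv)
  have "(transpose (Jr S \<Lambda> \<nu>) ** Jr S \<Lambda> \<nu>) *v v = (phi S \<Lambda>)\<^sup>2 *\<^sub>R v"
    by (simp add: Jv matrix_vector_mult_scaleR Ju power2_eq_square flip: matrix_vector_mul_assoc)
  from simple_derivative(2)[OF v this] pos show "i \<in> I \<Longrightarrow> g $ i = u \<bullet> (partial (\<lambda>\<Lambda>'. Jr S \<Lambda>' \<nu>) \<Lambda> i *v v)"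
    by (simp add: Jv)
qed

end
end
end
end

theorem proposition4p3:
  fixes S :: "('n::{finite,linorder}, 'k::{finite,linorder}) lifted_system"
    and U :: "'k rvec set"
  assumes lift: "inner_quadratic_lift S"
    and U_open: "openin (top_of_set (gain_space S)) U"
    and U_sub: "U \<subseteq> hurwitz_gains S"
  shows
    "(\<forall>Q. pos_def Q \<longrightarrow>
        (\<forall>\<Lambda>\<in>U. pos_def (lyapQ S Q \<Lambda>) \<and>
           transpose (gain_A S \<Lambda>) ** lyapQ S Q \<Lambda> + lyapQ S Q \<Lambda> ** gain_A S \<Lambda> = - Q) \<and>
        real_analytic_on (lift_idx S) U (lyapQ S Q) \<and>
        (\<forall>\<Lambda>\<in>U. \<forall>i\<in>lift_idx S.
           transpose (gain_A S \<Lambda>) ** partial (lyapQ S Q) \<Lambda> i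
             + partial (lyapQ S Q) \<Lambda> i ** gain_A S \<Lambda>
           = - (transpose (partial (gain_A S) \<Lambda> i) ** lyapQ S Q \<Lambda>
                + lyapQ S Q \<Lambda> ** partial (gain_A S) \<Lambda> i)))
     \<and> real_analytic_on (lift_idx S) U (lyapP S)
     \<and> real_analytic_on (lift_idx S) U (Pf S)
     \<and> (\<forall>\<nu>. real_analytic_on (lift_idx S) U (\<lambda>\<Lambda>. Jr S \<Lambda> \<nu>))
     \<and> locally_lipschitz_on U (phi S)
     \<and> continuous_on U (phi S)
     \<and> (\<forall>\<Lambda>\<^sub>0\<in>U. \<exists>\<epsilon>>0. \<exists>R. \<forall>\<Lambda>\<in>U \<inter> ball \<Lambda>\<^sub>0 \<epsilon>. \<forall>\<nu>.
          reduced_minimizer S \<Lambda> \<nu> \<longrightarrow> L2_set \<nu> {1..rdim S} \<le> R)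
     \<and> (\<forall>\<Lambda>\<in>U. \<forall>\<nu> \<tau> Y.
          primal_optimum S \<Lambda> \<nu> \<tau> \<and> dual_optimum S \<Lambda> Y \<longrightarrow>
            trace (blk22 Y) = 1
          \<and> (\<forall>l\<in>{1..rdim S}. blk12 Y \<bullet> col (rbasis S l) = 0)
          \<and> Y \<bullet> Fsdp S \<Lambda> \<nu> \<tau> = 0
          \<and> (phi S \<Lambda> > 0 \<longrightarrow>
               Zstar S \<Lambda> Y \<in> spec_norm_subdiff (Jr S \<Lambda> \<nu>)
             \<and> nuclear_norm (Zstar S \<Lambda> Y) = 1
             \<and> Zstar S \<Lambda> Y \<in> dual_ball S \<Lambda>
             \<and> (\<forall>Z\<in>dual_ball S \<Lambda>.
                  Z \<bullet> Jmat S \<Lambda> (\<lambda>_. 0) \<le> Zstar S \<Lambda> Y \<bullet> Jmat S \<Lambda> (\<lambda>_. 0))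
             \<and> (\<forall>l\<in>{1..rdim S}. Zstar S \<Lambda> Y \<bullet> Jbasis S \<Lambda> l = 0)
             \<and> (\<forall>i\<in>lift_idx S.
                  Zstar S \<Lambda> Y \<bullet> partial (\<lambda>\<Lambda>'. Jr S \<Lambda>' \<nu>) \<Lambda> i
                  = - (blk11 Y \<bullet> kron (partial (lyapP S) \<Lambda> i) (mat 1)
                       + 2 * (blk12 Y \<bullet> partial (\<lambda>\<Lambda>'. Gmat S \<Lambda>' (\<lambda>_. 0)) \<Lambda> i))
                    / (2 * phi S \<Lambda>))
             \<and> gsub S \<Lambda> \<nu> Y \<in> clarke_subdiff (gain_space S) (phi S) \<Lambda>
             \<and> (phi S differentiable (at \<Lambda> within gain_space S) \<longrightarrow>
                  (phi S has_derivative (\<lambda>h. gsub S \<Lambda> \<nu> Y \<bullet> h)) (at \<Lambda> within gain_space S))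
             \<and> ((\<forall>\<nu>'. reduced_minimizer S \<Lambda> \<nu>' \<longrightarrow> (\<forall>l\<in>{1..rdim S}. \<nu>' l = \<nu> l)) \<and>
                singular_mult (Jr S \<Lambda> \<nu>) (Max (singular_values (Jr S \<Lambda> \<nu>))) = 1 \<longrightarrow>
                  phi S differentiable (at \<Lambda> within gain_space S)
                \<and> (\<forall>i\<in>lift_idx S. partial (phi S) \<Lambda> i = gsub S \<Lambda> \<nu> Y $ i)
                \<and> (\<forall>u v.
                     singular_pair (Jr S \<Lambda> \<nu>) (Max (singular_values (Jr S \<Lambda> \<nu>))) u v \<longrightarrow>
                       Jr S \<Lambda> \<nu> *v v = phi S \<Lambda> *\<^sub>R u
                     \<and> (\<forall>i\<in>lift_idx S.
                          gsub S \<Lambda> \<nu> Y $ i = u \<bullet> (partial (\<lambda>\<Lambda>'. Jr S \<Lambda>' \<nu>) \<Lambda> i *v v))))))"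
proof -
  interpret stabilized_family S U by (unfold_locales) (fact lift U_open U_sub)+
  have part1: "\<forall>Q. pos_def Q \<longrightarrow>
        (\<forall>\<Lambda>\<in>U. pos_def (lyapQ S Q \<Lambda>) \<and>
           transpose (gain_A S \<Lambda>) ** lyapQ S Q \<Lambda> + lyapQ S Q \<Lambda> ** gain_A S \<Lambda> = - Q) \<and>
        real_analytic_on (lift_idx S) U (lyapQ S Q) \<and>
        (\<forall>\<Lambda>\<in>U. \<forall>i\<in>lift_idx S.
           transpose (gain_A S \<Lambda>) ** partial (lyapQ S Q) \<Lambda> i
             + partial (lyapQ S Q) \<Lambda> i ** gain_A S \<Lambda>
           = - (transpose (partial (gain_A S) \<Lambda> i) ** lyapQ S Q \<Lambda>
                + lyapQ S Q \<Lambda> ** partial (gain_A S) \<Lambda> i))"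
    by (intro allI impI conjI ballI)
      (simp_all only: lyapQ_pos_def lyapQ_equation lyapQ_derivative_equation real_analytic_on_matrix analytic_lyapQ)
  have an: "real_analytic_on I U (lyapP S)" "real_analytic_on I U (Pf S)" "real_analytic_on I U (\<lambda>\<Lambda>. Jr S \<Lambda> \<nu>)" for \<nu>
    by (intro real_analytic_on_matrix analytic_lyapP analytic_Pf analytic_Jr; assumption)+
  show ?thesis
    apply (intro conjI)
    subgoal by (rule part1)
    subgoal by (rule an)
    subgoal by (rule an)
    subgoal by (intro allI an)
    subgoal by (rule phi_locally_lipschitz)
    subgoal by (rule phi_continuous)
    subgoal by (intro ballI reduced_minimizers_locally_bounded)
    subgoal
    proof (intro ballI allI impI, elim conjE, goal_cases)
      case (1 \<Lambda> \<nu> \<tau> Y)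
      note o = 1
      have "phi S differentiable (at \<Lambda> within gain_space S)" if "phi S \<Lambda> > 0"
        "singular_mult (Jr S \<Lambda> \<nu>) (Max (singular_values (Jr S \<Lambda> \<nu>))) = 1"
        unfolding differentiable_def gain_space_def using phi_has_gradient[OF o that] by blast
      then show ?case
        by (intro conjI impI ballI allI)
          (use optimal_dual_facts[OF o] complementarity[OF o] Zstar_subdiff[OF o] Zstar_nuclear[OF o] Zstar_dual_ball[OF o]
            Zstar_maximal[OF o] Zstar_Jbasis[OF o] gradient_formula[OF o] gsub_clarke[OF o] phi_derivative_eq[OF o]
            phi_partial[OF o] singular_pair_gradient[OF o] in blast)+
    qed
    done
qed

end
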